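(* Let $1\le p,q\le\infty$. (a) If $1<q<\infty$, then the Banach space $(\oplus_{n=1}^\infty \ell_p^n)_{\ell_q}$ has a greedy basis. (b) The spaces $(\oplus_{n=1}^\infty \ell_p^n)_{\ell_1}$ with $1<p\le\infty$, and $(\oplus_{n=1}^\infty \ell_p^n)_{c_0}$ with $1\le p<\infty$, do not have greedy bases.
   Context: All Banach spaces are real. $\ell_p^n$ is $\mathbb{R}^n$ with the $\ell_p$-norm (the max norm if $p=\infty$). For Banach spaces $E_n$ and $1\le q<\infty$, $(\oplus_{n=1}^\infty E_n)_{\ell_q}$ is the space of sequences $(v_n)$ with $v_n\in E_n$ and norm $\|(v_n)\|=(\sum_n\|v_n\|^q)^{1/q}<\infty$; $(\oplus_{n=1}^\infty E_n)_{c_0}$ is the space of sequences $(v_n)$ with $v_n\in E_n$ and $\|v_n\|\to 0$, with norm $\sup_n\|v_n\|$. Let $(x_i)_{i=1}^\infty$ be a Schauder basis of a Banach space $X$ with biorthogonal functionals $(x_i^* )$. For $x\in X$ and $n\ge 1$ put $$\sigma_n(x)=\inf\Big\{\Big\|x-\sum_{i\in A}a_ix_i\Big\| : (a_i)\subset\mathbb{R},\ A\subset\mathbb{N},\ |A|\le n\Big\}.$$ A set $A_n(x)\subset\mathbb{N}$ with $|A_n(x)|=n$ is a choice of indices of $n$ largest coefficients of $x$ if $\min\{|x_i^*(x)|: i\in A_n(x)\}\ge\max\{|x_i^*(x)|: i\in\mathbb{N}\setminus A_n(x)\}$, and then $G_n(x)=\sum_{i\in A_n(x)}x_i^*(x)x_i$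 is called an $n$-th greedy approximant to $x$. The basis $(x_i)$ is greedy with constant $C$ if $\|x-G_n(x)\|\le C\,\sigma_n(x)$ for all $x\in X$, $n\ge 1$ (and every such $G_n(x)$); it is greedy if it is greedy with some constant $C<\infty$. *)

theory Defs
  imports "HOL-Analysis.Analysis" "HOL-Library.Function_Algebras"
begin

instantiation "fun" :: (type, real_vector) real_vector
begin

definition scaleR_fun :: "real \<Rightarrow> ('a \<Rightarrow> 'b) \<Rightarrow> 'a \<Rightarrow> 'b"
  where "scaleR_fun c f = (\<lambda>x. c *\<^sub>R f x)"

instance
  by standard (simp_all add: scaleR_fun_def fun_eq_iff scaleR_add_right scaleR_add_left)

end

lemma scaleR_fun_apply [simp]: "(c *\<^sub>R f) x = c *\<^sub>R f x"
  by (simp add: scaleR_fun_def)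

text \<open>
  The spaces considered here depend on numerical parameters, so a normed space is represented by
  its set of vectors inside an ambient real vector space, together with its norm. The norm is
  only meaningful on the set of vectors. Below, ambient spaces are function spaces with
  the pointwise operations.
\<close>

record 'a nspace =
  vecs :: "'a set"
  nrm :: "'a \<Rightarrow> real"

definition ell :: "ereal \<Rightarrow> nat \<Rightarrow> (nat \<Rightarrow> real) nspace" where
  "ell p n = \<lparr>
     vecs = {x. \<forall>i\<ge>n. x i = 0},
     nrm = (\<lambda>x. if p = \<infinity> then Max ((\<lambda>i. \<bar>x i\<bar>) ` {..<n})
                else (\<Sum>i<n. \<bar>x i\<bar> powr real_of_ereal p) powr (1 / real_of_ereal p)) \<rparr>"

definition ell_sum :: "real \<Rightarrow> (nat \<Rightarrow> 'a nspace) \<Rightarrow> (nat \<Rightarrow> 'a) nspace" where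
  "ell_sum q E = \<lparr>
     vecs = {v. (\<forall>n. v n \<in> vecs (E n)) \<and> summable (\<lambda>n. nrm (E n) (v n) powr q)},
     nrm = (\<lambda>v. (\<Sum>n. nrm (E n) (v n) powr q) powr (1 / q)) \<rparr>"

definition c0_sum :: "(nat \<Rightarrow> 'a nspace) \<Rightarrow> (nat \<Rightarrow> 'a) nspace" where
  "c0_sum E = \<lparr>
     vecs = {v. (\<forall>n. v n \<in> vecs (E n)) \<and> (\<lambda>n. nrm (E n) (v n)) \<longlonglongrightarrow> 0},
     nrm = (\<lambda>v. SUP n. nrm (E n) (v n)) \<rparr>"

definition expands :: "'a::real_vector nspace \<Rightarrow> (nat \<Rightarrow> 'a) \<Rightarrow> (nat \<Rightarrow> real) \<Rightarrow> 'a \<Rightarrow> bool" where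
  "expands X e a x \<longleftrightarrow> (\<lambda>n. nrm X (x - (\<Sum>i<n. a i *\<^sub>R e i))) \<longlonglongrightarrow> 0"

definition schauder_basis :: "'a::real_vector nspace \<Rightarrow> (nat \<Rightarrow> 'a) \<Rightarrow> bool" where
  "schauder_basis X e \<longleftrightarrow> range e \<subseteq> vecs X \<and> (\<forall>x\<in>vecs X. \<exists>!a. expands X e a x)"

text \<open>The biorthogonal functionals of a Schauder basis are its coefficient functionals.\<close>

definition biorth :: "'a::real_vector nspace \<Rightarrow> (nat \<Rightarrow> 'a) \<Rightarrow> nat \<Rightarrow> 'a \<Rightarrow> real" where
  "biorth X e i x = (THE a. expands X e a x) i"

definition best_error :: "'a::real_vector nspace \<Rightarrow> (nat \<Rightarrow> 'a) \<Rightarrow> nat \<Rightarrow> 'a \<Rightarrow> real" where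
  "best_error X e n x =
     Inf {nrm X (x - (\<Sum>i\<in>A. a i *\<^sub>R e i)) | a A. finite A \<and> card A \<le> n}"

text \<open>
  For \<^term>\<open>n \<ge> 1\<close>, the pairwise comparison says that the minimum of the absolute coefficients
  over \<^term>\<open>A\<close> is at least their supremum over the complement of \<^term>\<open>A\<close>.
\<close>

definition greedy_set :: "'a::real_vector nspace \<Rightarrow> (nat \<Rightarrow> 'a) \<Rightarrow> nat \<Rightarrow> 'a \<Rightarrow> nat set \<Rightarrow> bool" where
  "greedy_set X e n x A \<longleftrightarrow> finite A \<and> card A = n \<and>
     (\<forall>i\<in>A. \<forall>j\<in>- A. \<bar>biorth X e j x\<bar> \<le> \<bar>biorth X e i x\<bar>)"

definition greedy_approx :: "'a::real_vector nspace \<Rightarrow> (nat \<Rightarrow> 'a) \<Rightarrow> nat set \<Rightarrow> 'a \<Rightarrow> 'a" where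
  "greedy_approx X e A x = (\<Sum>i\<in>A. biorth X e i x *\<^sub>R e i)"

definition greedy_with :: "real \<Rightarrow> 'a::real_vector nspace \<Rightarrow> (nat \<Rightarrow> 'a) \<Rightarrow> bool" where
  "greedy_with C X e \<longleftrightarrow> schauder_basis X e \<and>
     (\<forall>x\<in>vecs X. \<forall>n\<ge>1. \<forall>A. greedy_set X e n x A \<longrightarrow>
        nrm X (x - greedy_approx X e A x) \<le> C * best_error X e n x)"

definition has_greedy_basis :: "'a::real_vector nspace \<Rightarrow> bool" where
  "has_greedy_basis X \<longleftrightarrow> (\<exists>e C. greedy_with C X e)"

end

theory Submission
  imports Defs "HOL-Real_Asymp.Real_Asymp"
begin

text \<open>
  Greedy bases are unconditional and democratic. In the \<open>c\<^sub>0\<close>-sum a gliding hump makes sums of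
  basis vectors bounded, so by democracy the basis is equivalent to that of \<open>c\<^sub>0\<close>. In the
  \<open>\<ell>\<^sub>1\<close>-sum it makes them grow linearly, so the coefficients are in weak \<open>\<ell>\<^sub>1\<close>. The cotype of
  \<open>\<ell>\<^sub>p\<^sup>n\<^sup>*\<close> then bounds, uniformly in \<open>n\<close>, the number of basis vectors that live essentially on the
  \<open>n\<close>-th summand, and this forces the basis to be equivalent to that of \<open>\<ell>\<^sub>1\<close>. Either way \<open>\<ell>\<^sub>p\<^sup>n\<close> would be
  uniformly complemented in \<open>c\<^sub>0\<close> or \<open>\<ell>\<^sub>1\<close>, which a trace computation with Khintchine's
  inequality excludes.

  For \<open>1 < q < \<infinity>\<close>, functions that are constant on dyadic blocks of length \<open>2\<^sup>l\<close> in their \<open>l\<close>-th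
  coordinate, \<open>l \<le> n\<close>, form a subspace of \<open>\<ell>\<^sub>q(\<ell>\<^sub>p\<^sup>n)\<close> which contains \<open>\<ell>\<^sub>p\<^sup>n\<close> as a complemented
  subspace and which is itself complemented by Stein's inequality for conditional expectations.
  By Pelczynski's decomposition method the \<open>\<ell>\<^sub>q\<close>-sum of these subspaces is isomorphic to the given
  space. Its normalized block indicators form a 1-unconditional basis, which is democratic since
  the geometric decay of the weights \<open>2 powr (- l / q)\<close> lets the shortest block at each point dominate.
\<close>

section \<open>Inequalities for powers\<close>

text \<open>For p different from q the unit vectors of the q-sum itself are unconditional but not
  democratic: n of them in one block have norm n^(1/p), taken from n different blocks n^(1/q). Part
  (a) therefore needs a different basis, in an isomorphic space arranged so that any m basis vectors
  have norm comparable to m^(1/q), whatever p is.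

  In the l1 case the linear growth of sums controls coefficients only in weak l1, and summing m of
  them costs a factor 1 + log m. The loss is harmless because it meets a saving by a power: m
  vectors that live on one block satisfy m \<le> K (1 + log m) m^(1/r) with r > 1, so m is bounded,
  and after that no logarithm is left.

  Both nonexistence proofs end with the trace of the identity of a block. It equals the dimension N,
  while the factorization through the basis bounds it by a multiple of N^\<gamma>, where \<gamma> =
  max (1 - 1/p) (1/2) for c0 and \<gamma> = max (1/p) (1/2) for l1. These are below 1 exactly when p
  is finite, respectively when p > 1.\<close>

lemma convex_on_powr_nonneg:
  assumes "1 \<le> (p::real)" shows "convex_on {0..} (\<lambda>x. x powr p)"
proof (rule convex_onI)
  show "convex {0::real..}" by simp
  fix t x y :: real assume t: "0 < t" "t < 1" and xy: "x \<in> {0..}" "y \<in> {0..}"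
  \<comment> \<open>If one of the two points is 0, convexity reduces to
    \<open>s powr p \<le> s\<close> for 0 < s < 1.\<close>
  have sc: "(s * z) powr p \<le> s * z powr p" if "0 < s" "s < 1" "0 \<le> z" for s z :: real
  proof -
    have "s powr p \<le> s" using powr_mono'[of 1 p s] that assms by simp
    then show ?thesis using that by (simp add: powr_mult mult_right_mono)
  qed
  show "((1 - t) *\<^sub>R x + t *\<^sub>R y) powr p \<le> (1 - t) * x powr p + t * y powr p"
  proof (cases "x = 0 \<or> y = 0")
    case True then show ?thesis using sc[of t y] sc[of "1-t" x] t xy by auto
  next
    case False
    then show ?thesis using convex_onD[OF powr_convex[OF assms], of t x y] t xy by auto
  qed
qed

text \<open>Jensen's inequality with equal weights.\<close>

lemma powr_sum_le:
  assumes "finite I" "1 \<le> (p::real)" "\<And>i. i \<in> I \<Longrightarrow> 0 \<le> x i"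
  shows "(\<Sum>i\<in>I. x i) powr p \<le> real (card I) powr (p - 1) * (\<Sum>i\<in>I. x i powr p)"
proof (cases "I = {}")
  case False
  then have c: "0 < real (card I)" using assms(1) by (simp add: card_gt_0_iff)
  have "(\<Sum>i\<in>I. (1 / real (card I)) *\<^sub>R x i) powr p \<le> (\<Sum>i\<in>I. (1 / real (card I)) * x i powr p)"
    by (rule convex_on_sum[OF assms(1) False convex_on_powr_nonneg[OF assms(2)]]) (use assms c in auto)
  then have "((\<Sum>i\<in>I. x i) / real (card I)) powr p \<le> (\<Sum>i\<in>I. x i powr p) / real (card I)"
    by (simp add: sum_divide_distrib)
  then have "(\<Sum>i\<in>I. x i) powr p / real (card I) powr p \<le> (\<Sum>i\<in>I. x i powr p) / real (card I)"
    using c assms by (simp add: powr_divide sum_nonneg)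
  from mult_left_mono[OF this, of "real (card I) powr p"]
  have "(\<Sum>i\<in>I. x i) powr p \<le> real (card I) powr p * ((\<Sum>i\<in>I. x i powr p) / real (card I))"
    using c by simp
  then show ?thesis using c by (simp add: powr_diff field_simps)
qed simp

text \<open>Normalization reduces this to convexity: with A and B the two norms, (a + b) / (A + B)
  is the convex combination of a / A and b / B with weights A / (A + B) and B / (A + B).\<close>

lemma minkowski_sum:
  assumes "finite I" "1 \<le> (p::real)" "\<And>i. i \<in> I \<Longrightarrow> 0 \<le> a i" "\<And>i. i \<in> I \<Longrightarrow> 0 \<le> b i"
  shows "(\<Sum>i\<in>I. (a i + b i) powr p) powr (1/p) \<le> (\<Sum>i\<in>I. a i powr p) powr (1/p) + (\<Sum>i\<in>I. b i powr p) powr (1/p)"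
proof -
  define A where "A = (\<Sum>i\<in>I. a i powr p) powr (1/p)"
  define B where "B = (\<Sum>i\<in>I. b i powr p) powr (1/p)"
  have Ap: "A powr p = (\<Sum>i\<in>I. a i powr p)" and Bp: "B powr p = (\<Sum>i\<in>I. b i powr p)"
    using assms by (auto simp: A_def B_def powr_powr sum_nonneg)
  show ?thesis
  proof (cases "A = 0 \<or> B = 0")
    case True
    then have "(\<forall>i\<in>I. a i = 0) \<or> (\<forall>i\<in>I. b i = 0)"
      using Ap Bp assms by (auto simp: sum_nonneg_eq_0_iff)
    then show ?thesis by (auto simp: sum.neutral cong: sum.cong)
  next
    case False
    then have AB: "0 < A" "0 < B" by (auto simp: A_def B_def)
    define t where "t = B / (A + B)"
    have t: "0 \<le> t" "t \<le> 1" "1 - t = A / (A + B)" using AB by (auto simp: t_def field_simps)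
    have "((a i + b i) / (A + B)) powr p \<le> (1 - t) * (a i / A) powr p + t * (b i / B) powr p" if "i \<in> I" for i
    proof -
      have "(a i + b i) / (A + B) = (1 - t) *\<^sub>R (a i / A) + t *\<^sub>R (b i / B)"
        unfolding t(3) using AB by (simp add: t_def add_divide_distrib)
      then show ?thesis
        using convex_onD[OF convex_on_powr_nonneg[OF assms(2)], of t "a i / A" "b i / B"] t assms(3,4)[OF that] AB
        by simp
    qed
    then have "(\<Sum>i\<in>I. ((a i + b i) / (A + B)) powr p) \<le> (\<Sum>i\<in>I. (1 - t) * (a i / A) powr p + t * (b i / B) powr p)"
      by (rule sum_mono)
    also have "\<dots> = (1 - t) * ((\<Sum>i\<in>I. a i powr p) / A powr p) + t * ((\<Sum>i\<in>I. b i powr p) / B powr p)"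
      using assms AB by (simp add: sum.distrib powr_divide sum_distrib_left sum_divide_distrib)
    also have "\<dots> = 1" unfolding Ap[symmetric] Bp[symmetric] using AB by simp
    finally have "(\<Sum>i\<in>I. (a i + b i) powr p) / (A + B) powr p \<le> 1"
      using assms AB by (simp add: powr_divide sum_divide_distrib)
    then have "(\<Sum>i\<in>I. (a i + b i) powr p) \<le> (A + B) powr p" using AB by (simp add: divide_le_eq)
    then have "(\<Sum>i\<in>I. (a i + b i) powr p) powr (1/p) \<le> ((A + B) powr p) powr (1/p)"
      using assms by (intro powr_mono2) (auto intro: sum_nonneg)
    also have "\<dots> = A + B" using AB assms(2) by (simp add: powr_powr)
    finally show ?thesis unfolding A_def B_def .
  qed
qed

lemma holder_sum:
  assumes "finite I" "1 < (p::real)" "1 < q" "1/p + 1/q = 1" "\<And>i. i \<in> I \<Longrightarrow> 0 \<le> a i" "\<And>i. i \<in> I \<Longrightarrow> 0 \<le> b i"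
  shows "(\<Sum>i\<in>I. a i * b i) \<le> (\<Sum>i\<in>I. a i powr p) powr (1/p) * (\<Sum>i\<in>I. b i powr q) powr (1/q)"
proof -
  define A where "A = (\<Sum>i\<in>I. a i powr p) powr (1/p)"
  define B where "B = (\<Sum>i\<in>I. b i powr q) powr (1/q)"
  have Ap: "A powr p = (\<Sum>i\<in>I. a i powr p)" and Bp: "B powr q = (\<Sum>i\<in>I. b i powr q)"
    using assms by (auto simp: A_def B_def powr_powr sum_nonneg)
  show ?thesis
  proof (cases "A = 0 \<or> B = 0")
    case True
    then have "(\<forall>i\<in>I. a i = 0) \<or> (\<forall>i\<in>I. b i = 0)"
      using Ap Bp assms by (auto simp: sum_nonneg_eq_0_iff)
    then show ?thesis by (auto simp: sum.neutral cong: sum.cong)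
  next
    case False
    then have AB: "0 < A" "0 < B" by (auto simp: A_def B_def)
    have "(\<Sum>i\<in>I. (a i / A) * (b i / B)) \<le> (\<Sum>i\<in>I. (a i / A) powr p / p + (b i / B) powr q / q)"
      using AB assms by (intro sum_mono Youngs_inequality) auto
    also have "\<dots> = ((\<Sum>i\<in>I. a i powr p) / A powr p) / p + ((\<Sum>i\<in>I. b i powr q) / B powr q) / q"
      using assms AB by (simp add: sum.distrib powr_divide sum_divide_distrib)
    also have "\<dots> = 1" unfolding Ap[symmetric] Bp[symmetric] using AB assms by simp
    finally have "(\<Sum>i\<in>I. a i * b i) / (A * B) \<le> 1" by (simp add: sum_divide_distrib)
    then show ?thesis using AB by (simp add: divide_le_eq A_def B_def)
  qed
qed

text \<open>Each term is at most the r-norm A, so x^s \<le> x^r * A^(s - r), and the sum over I is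
  at most A^s.\<close>

lemma sum_powr_mono_exponent:
  assumes "finite I" "0 < (r::real)" "r \<le> s" "\<And>i. i \<in> I \<Longrightarrow> 0 \<le> x i"
  shows "(\<Sum>i\<in>I. x i powr s) powr (1/s) \<le> (\<Sum>i\<in>I. x i powr r) powr (1/r)"
proof -
  define A where "A = (\<Sum>i\<in>I. x i powr r) powr (1/r)"
  have Ar: "A powr r = (\<Sum>i\<in>I. x i powr r)" using assms by (auto simp: A_def powr_powr sum_nonneg)
  show ?thesis
  proof (cases "A = 0")
    case True
    then have "\<forall>i\<in>I. x i = 0" using Ar assms by (auto simp: sum_nonneg_eq_0_iff)
    then show ?thesis using assms by (auto simp: sum.neutral cong: sum.cong)
  next
    case False
    then have A: "0 < A" by (simp add: A_def)
    have le: "x i \<le> A" if "i \<in> I" for i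
    proof -
      have "x i powr r \<le> A powr r" unfolding Ar by (rule member_le_sum) (use that assms in auto)
      then show ?thesis using assms that A by (meson less_imp_le not_le powr_less_mono2)
    qed
    have "(\<Sum>i\<in>I. x i powr s) = (\<Sum>i\<in>I. x i powr r * x i powr (s - r))"
      using assms by (simp flip: powr_add)
    also have "\<dots> \<le> (\<Sum>i\<in>I. x i powr r * A powr (s - r))"
      using assms le by (intro sum_mono mult_left_mono powr_mono2) auto
    also have "\<dots> = A powr s" by (simp add: sum_distrib_right[symmetric] Ar[symmetric] powr_add[symmetric])
    finally have "(\<Sum>i\<in>I. x i powr s) powr (1/s) \<le> (A powr s) powr (1/s)"
      using assms by (intro powr_mono2) (auto intro: sum_nonneg)
    also have "\<dots> = A" using A assms by (simp add: powr_powr)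
    finally show ?thesis unfolding A_def .
  qed
qed

lemma sum_powr_antimono_exponent:
  assumes "finite I" "0 < (r::real)" "r \<le> s" "\<And>i. i \<in> I \<Longrightarrow> 0 \<le> x i"
  shows "(\<Sum>i\<in>I. x i powr r) powr (1/r) \<le> real (card I) powr (1/r - 1/s) * (\<Sum>i\<in>I. x i powr s) powr (1/s)"
proof -
  have "(\<Sum>i\<in>I. x i powr r) powr (s/r) \<le> real (card I) powr (s/r - 1) * (\<Sum>i\<in>I. (x i powr r) powr (s/r))"
    by (rule powr_sum_le) (use assms in auto)
  then have "((\<Sum>i\<in>I. x i powr r) powr (s/r)) powr (1/s) \<le> (real (card I) powr (s/r - 1) * (\<Sum>i\<in>I. x i powr s)) powr (1/s)"
    using assms by (intro powr_mono2) (auto simp: powr_powr)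
  then show ?thesis using assms by (simp add: powr_powr powr_mult sum_nonneg diff_divide_distrib)
qed

section \<open>Seminormed spaces and finite-dimensional blocks\<close>

locale seminormed =
  fixes X :: "'a::real_vector nspace"
  assumes zero_mem [simp, intro]: "0 \<in> vecs X"
    and add_mem [simp, intro]: "x \<in> vecs X \<Longrightarrow> y \<in> vecs X \<Longrightarrow> x + y \<in> vecs X"
    and scale_mem [simp, intro]: "x \<in> vecs X \<Longrightarrow> c *\<^sub>R x \<in> vecs X"
    and nonneg [simp]: "x \<in> vecs X \<Longrightarrow> 0 \<le> nrm X x"
    and triangle: "x \<in> vecs X \<Longrightarrow> y \<in> vecs X \<Longrightarrow> nrm X (x + y) \<le> nrm X x + nrm X y"
    and scale [simp]: "x \<in> vecs X \<Longrightarrow> nrm X (c *\<^sub>R x) = \<bar>c\<bar> * nrm X x"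
begin

lemma minus_mem [simp, intro]: "x \<in> vecs X \<Longrightarrow> - x \<in> vecs X"
  using scale_mem[of x "-1"] by simp

lemma diff_mem [simp, intro]: "x \<in> vecs X \<Longrightarrow> y \<in> vecs X \<Longrightarrow> x - y \<in> vecs X"
  using add_mem[of x "- y"] minus_mem[of y] by simp

lemma sum_mem [simp, intro]: "(\<And>i. i \<in> A \<Longrightarrow> f i \<in> vecs X) \<Longrightarrow> sum f A \<in> vecs X"
  by (induction A rule: infinite_finite_induct) auto

lemma nrm_zero [simp]: "nrm X 0 = 0"
  using scale[of 0 0] by simp

lemma nrm_minus [simp]: "x \<in> vecs X \<Longrightarrow> nrm X (- x) = nrm X x"
  using scale[of x "-1"] by simp

lemma nrm_minus_commute: "x \<in> vecs X \<Longrightarrow> y \<in> vecs X \<Longrightarrow> nrm X (x - y) = nrm X (y - x)"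
  using nrm_minus[of "x - y"] by simp

lemma triangle_diff: "x \<in> vecs X \<Longrightarrow> y \<in> vecs X \<Longrightarrow> nrm X (x - y) \<le> nrm X x + nrm X y"
  using triangle[of x "- y"] by simp

lemma reverse_triangle: "x \<in> vecs X \<Longrightarrow> y \<in> vecs X \<Longrightarrow> nrm X x - nrm X y \<le> nrm X (x + y)"
  using triangle_diff[of "x + y" y] by simp

lemma reverse_triangle_diff: "x \<in> vecs X \<Longrightarrow> y \<in> vecs X \<Longrightarrow> \<bar>nrm X x - nrm X y\<bar> \<le> nrm X (x - y)"
  using triangle[of "x - y" y] triangle[of "y - x" x] nrm_minus_commute[of x y] by simp

lemma nrm_sum_le: "(\<And>i. i \<in> A \<Longrightarrow> f i \<in> vecs X) \<Longrightarrow> nrm X (sum f A) \<le> (\<Sum>i\<in>A. nrm X (f i))"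
proof (induction A rule: infinite_finite_induct)
  case (insert x F)
  then have "nrm X (f x + sum f F) \<le> nrm X (f x) + nrm X (sum f F)" by (intro triangle) auto
  with insert show ?case by simp
qed auto

end

lemma ell_vecs: "x \<in> vecs (ell p n) \<longleftrightarrow> (\<forall>i\<ge>n. x i = 0)"
  by (simp add: ell_def)

lemma nrm_ell_infinity: "nrm (ell \<infinity> n) x = Max ((\<lambda>i. \<bar>x i\<bar>) ` {..<n})"
  by (simp add: ell_def)

lemma nrm_ell_real: "nrm (ell (ereal r) n) x = (\<Sum>i<n. \<bar>x i\<bar> powr r) powr (1 / r)"
  by (simp add: ell_def)

lemma exponent_cases:
  assumes "1 \<le> (p::ereal)"
  obtains "p = \<infinity>" | r where "1 \<le> r" "p = ereal r"
  using assms by (cases p) auto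

lemma Max_lessThan_le_iff: "0 < n \<Longrightarrow> Max (f ` {..<n}) \<le> c \<longleftrightarrow> (\<forall>i<n. f i \<le> c)"
  for f :: "nat \<Rightarrow> real"
  by (subst Max_le_iff) (auto simp: lessThan_empty_iff bot_nat_def)

lemma Max_lessThan_ge: "i < n \<Longrightarrow> f i \<le> Max (f ` {..<n})"
  for f :: "nat \<Rightarrow> real"
  by (intro Max_ge) auto

text \<open>With 1 / \<infinity> = 0, comparisons of exponents and powers of the dimension take one
  form for all p.\<close>

definition invexp :: "ereal \<Rightarrow> real" where
  "invexp p = (if p = \<infinity> then 0 else 1 / real_of_ereal p)"

lemma invexp_simps [simp]: "invexp \<infinity> = 0" "invexp (ereal r) = 1 / r"
  by (simp_all add: invexp_def)

context
  fixes p :: ereal and n :: nat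
  assumes p: "1 \<le> p" and n: "0 < n"
begin

lemma ell_nrm_nonneg: "0 \<le> nrm (ell p n) x"
  using p
proof (cases rule: exponent_cases)
  case 1
  have "\<bar>x 0\<bar> \<le> Max ((\<lambda>i. \<bar>x i\<bar>) ` {..<n})" using n by (intro Max_ge) auto
  then show ?thesis using 1 by (simp add: nrm_ell_infinity)
qed (simp add: nrm_ell_real)

lemma ell_nrm_mono:
  assumes "\<And>i. i < n \<Longrightarrow> \<bar>x i\<bar> \<le> \<bar>y i\<bar>"
  shows "nrm (ell p n) x \<le> nrm (ell p n) y"
  using p
proof (cases rule: exponent_cases)
  case 1
  have "Max ((\<lambda>i. \<bar>x i\<bar>) ` {..<n}) \<le> Max ((\<lambda>i. \<bar>y i\<bar>) ` {..<n})"
    using n assms by (auto simp: Max_lessThan_le_iff intro: order_trans[OF _ Max_lessThan_ge[where f="\<lambda>i. \<bar>y i\<bar>"]])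
  then show ?thesis using 1 by (simp add: nrm_ell_infinity)
next
  case (2 r)
  then show ?thesis unfolding 2 nrm_ell_real
    using assms by (intro powr_mono2 sum_mono sum_nonneg) auto
qed

lemma ell_nrm_cong: "(\<And>i. i < n \<Longrightarrow> \<bar>x i\<bar> = \<bar>y i\<bar>) \<Longrightarrow> nrm (ell p n) x = nrm (ell p n) y"
  by (intro antisym ell_nrm_mono) auto

lemma ell_nrm_scale: "nrm (ell p n) (c *\<^sub>R x) = \<bar>c\<bar> * nrm (ell p n) x"
  using p
proof (cases rule: exponent_cases)
  case 1
  have "Max ((\<lambda>i. \<bar>c\<bar> * \<bar>x i\<bar>) ` {..<n}) = \<bar>c\<bar> * Max ((\<lambda>i. \<bar>x i\<bar>) ` {..<n})"
    using n mono_Max_commute[of "\<lambda>z. \<bar>c\<bar> * z" "(\<lambda>i. \<bar>x i\<bar>) ` {..<n}"]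
    by (auto simp: mono_def mult_left_mono image_image lessThan_empty_iff bot_nat_def)
  then show ?thesis using 1 by (simp add: nrm_ell_infinity abs_mult)
next
  case (2 r)
  have "(\<Sum>i<n. \<bar>c * x i\<bar> powr r) = \<bar>c\<bar> powr r * (\<Sum>i<n. \<bar>x i\<bar> powr r)"
    by (simp add: abs_mult powr_mult sum_distrib_left)
  then show ?thesis using 2 by (simp add: nrm_ell_real powr_mult powr_powr sum_nonneg)
qed

lemma ell_nrm_triangle: "nrm (ell p n) (x + y) \<le> nrm (ell p n) x + nrm (ell p n) y"
  using p
proof (cases rule: exponent_cases)
  case 1
  have "\<bar>x i + y i\<bar> \<le> Max ((\<lambda>i. \<bar>x i\<bar>) ` {..<n}) + Max ((\<lambda>i. \<bar>y i\<bar>) ` {..<n})" if "i < n" for i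
  proof -
    have "\<bar>x i\<bar> \<le> Max ((\<lambda>i. \<bar>x i\<bar>) ` {..<n})" "\<bar>y i\<bar> \<le> Max ((\<lambda>i. \<bar>y i\<bar>) ` {..<n})"
      using that by (auto intro!: Max_ge)
    then show ?thesis by linarith
  qed
  then show ?thesis unfolding 1 nrm_ell_infinity using n by (subst Max_le_iff) auto
next
  case (2 r)
  have "(\<Sum>i<n. \<bar>x i + y i\<bar> powr r) powr (1/r) \<le> (\<Sum>i<n. (\<bar>x i\<bar> + \<bar>y i\<bar>) powr r) powr (1/r)"
    using 2 by (intro powr_mono2 sum_mono sum_nonneg) auto
  also have "\<dots> \<le> (\<Sum>i<n. \<bar>x i\<bar> powr r) powr (1/r) + (\<Sum>i<n. \<bar>y i\<bar> powr r) powr (1/r)"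
    using 2 by (intro minkowski_sum) auto
  finally show ?thesis unfolding 2 nrm_ell_real by simp
qed

lemma seminormed_ell: "seminormed (ell p n)"
  by unfold_locales (auto simp: ell_vecs ell_nrm_nonneg ell_nrm_scale ell_nrm_triangle)

lemma ell_coord_le: "i < n \<Longrightarrow> \<bar>x i\<bar> \<le> nrm (ell p n) x"
  using p
proof (cases rule: exponent_cases)
  case 1
  assume "i < n"
  then have "\<bar>x i\<bar> \<le> Max ((\<lambda>i. \<bar>x i\<bar>) ` {..<n})" by (intro Max_ge) auto
  then show ?thesis using 1 by (simp add: nrm_ell_infinity)
next
  case (2 r)
  assume "i < n"
  then have "\<bar>x i\<bar> powr r \<le> (\<Sum>i<n. \<bar>x i\<bar> powr r)" by (intro member_le_sum) auto
  then have "(\<bar>x i\<bar> powr r) powr (1/r) \<le> (\<Sum>i<n. \<bar>x i\<bar> powr r) powr (1/r)" using 2 by (intro powr_mono2) auto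
  then show ?thesis using 2 by (simp add: nrm_ell_real powr_powr)
qed

lemma ell_nrm_le_powr_sum:
  assumes "1 \<le> s" "invexp p \<le> 1 / s"
  shows "nrm (ell p n) x \<le> (\<Sum>i<n. \<bar>x i\<bar> powr s) powr (1/s)"
  using p
proof (cases rule: exponent_cases)
  case 1
  have "\<bar>x i\<bar> \<le> (\<Sum>i<n. \<bar>x i\<bar> powr s) powr (1/s)" if "i < n" for i
  proof -
    have "\<bar>x i\<bar> powr s \<le> (\<Sum>i<n. \<bar>x i\<bar> powr s)" using that by (intro member_le_sum) auto
    then have "(\<bar>x i\<bar> powr s) powr (1/s) \<le> (\<Sum>i<n. \<bar>x i\<bar> powr s) powr (1/s)" using assms by (intro powr_mono2) auto
    then show ?thesis using assms by (simp add: powr_powr)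
  qed
  then show ?thesis unfolding 1 nrm_ell_infinity using n by (subst Max_le_iff) auto
next
  case (2 r)
  then have "s \<le> r" using assms by (simp add: field_simps)
  then show ?thesis unfolding 2 nrm_ell_real using assms by (intro sum_powr_mono_exponent) auto
qed

lemma ell_nrm_le_sum: "nrm (ell p n) x \<le> (\<Sum>i<n. \<bar>x i\<bar>)"
proof -
  have "invexp p \<le> 1" using p by (cases rule: exponent_cases) auto
  then show ?thesis using ell_nrm_le_powr_sum[of 1 x] by (simp add: sum_nonneg)
qed

lemma powr_sum_le_ell_nrm:
  assumes "1 \<le> s" "invexp p \<le> 1 / s"
  shows "(\<Sum>i<n. \<bar>x i\<bar> powr s) powr (1/s) \<le> real n powr (1/s - invexp p) * nrm (ell p n) x"
  using p
proof (cases rule: exponent_cases)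
  case 1
  have "(\<Sum>i<n. \<bar>x i\<bar> powr s) \<le> (\<Sum>i<n. (nrm (ell p n) x) powr s)"
    using ell_coord_le assms by (intro sum_mono powr_mono2) auto
  also have "\<dots> = real n * (nrm (ell p n) x) powr s" by simp
  finally have "(\<Sum>i<n. \<bar>x i\<bar> powr s) powr (1/s) \<le> (real n * (nrm (ell p n) x) powr s) powr (1/s)"
    using assms by (intro powr_mono2) (auto intro: sum_nonneg)
  then show ?thesis using 1 assms ell_nrm_nonneg by (simp add: powr_mult powr_powr)
next
  case (2 r)
  then have "s \<le> r" using assms by (simp add: field_simps)
  then show ?thesis unfolding 2 nrm_ell_real
    using sum_powr_antimono_exponent[of "{..<n}" s r "\<lambda>i. \<bar>x i\<bar>"] assms by auto
qed

lemma ell_nrm_le_powr_sum':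
  assumes "1 \<le> s" "1 / s \<le> invexp p"
  shows "nrm (ell p n) x \<le> real n powr (invexp p - 1/s) * (\<Sum>i<n. \<bar>x i\<bar> powr s) powr (1/s)"
  using p
proof (cases rule: exponent_cases)
  case 1 then show ?thesis using assms by simp
next
  case (2 r)
  then have "r \<le> s" using assms by (simp add: field_simps)
  then show ?thesis unfolding 2 nrm_ell_real
    using sum_powr_antimono_exponent[of "{..<n}" r s "\<lambda>i. \<bar>x i\<bar>"] assms 2 by auto
qed

lemma powr_sum_le_ell_nrm':
  assumes "1 \<le> s" "1 / s \<le> invexp p"
  shows "(\<Sum>i<n. \<bar>x i\<bar> powr s) powr (1/s) \<le> nrm (ell p n) x"
  using p
proof (cases rule: exponent_cases)
  case 1 then show ?thesis using assms by simp
next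
  case (2 r)
  then have "r \<le> s" using assms by (simp add: field_simps)
  then show ?thesis unfolding 2 nrm_ell_real using 2 by (intro sum_powr_mono_exponent) auto
qed

text \<open>At most one of the constants here and in \<open>l2_le_ell_nrm\<close> exceeds 1,
  depending on the side of 2 on which p lies. These powers of the dimension decide the exponent in
  the trace estimates.\<close>

lemma ell_nrm_le_l2: "nrm (ell p n) x \<le> real n powr (max 0 (invexp p - 1/2)) * sqrt (\<Sum>i<n. (x i)\<^sup>2)"
  using ell_nrm_le_powr_sum[of 2 x] ell_nrm_le_powr_sum'[of 2 x] n
  by (cases "invexp p \<le> 1/2") (auto simp: powr_half_sqrt sum_nonneg max_def)

lemma l2_le_ell_nrm: "sqrt (\<Sum>i<n. (x i)\<^sup>2) \<le> real n powr (max 0 (1/2 - invexp p)) * nrm (ell p n) x"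
  using powr_sum_le_ell_nrm[of 2 x] powr_sum_le_ell_nrm'[of 2 x] n
  by (cases "invexp p \<le> 1/2") (auto simp: powr_half_sqrt sum_nonneg max_def)

lemma sum_le_ell_nrm: "(\<Sum>i<n. \<bar>x i\<bar>) \<le> real n powr (1 - invexp p) * nrm (ell p n) x"
proof -
  have "invexp p \<le> 1" using p by (cases rule: exponent_cases) auto
  then show ?thesis using powr_sum_le_ell_nrm[of 1 x] by (simp add: sum_nonneg)
qed

lemma ell_nrm_le_bound:
  assumes "\<And>i. i < n \<Longrightarrow> \<bar>x i\<bar> \<le> 1"
  shows "nrm (ell p n) x \<le> real n powr invexp p"
proof -
  have "nrm (ell p n) x \<le> nrm (ell p n) (\<lambda>i. 1)" using assms by (intro ell_nrm_mono) auto
  also have "\<dots> = real n powr invexp p"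
    using p by (cases rule: exponent_cases) (use n in \<open>auto simp: nrm_ell_infinity nrm_ell_real image_constant_conv lessThan_empty_iff bot_nat_def\<close>)
  finally show ?thesis .
qed

end

lemma ell_Suc_nrm_nonneg: "1 \<le> p \<Longrightarrow> 0 \<le> nrm (ell p (Suc n)) x"
  by (rule ell_nrm_nonneg) simp_all

lemma ell_nrm_extend:
  assumes p: "1 \<le> p" and n: "0 < n" and "n \<le> m" and x: "\<And>i. n \<le> i \<Longrightarrow> x i = 0"
  shows "nrm (ell p m) x = nrm (ell p n) x"
  using p
proof (cases rule: exponent_cases)
  case 1
  have "Max ((\<lambda>i. \<bar>x i\<bar>) ` {..<m}) = Max ((\<lambda>i. \<bar>x i\<bar>) ` {..<n})"
  proof (rule antisym)
    have "\<bar>x i\<bar> \<le> Max ((\<lambda>i. \<bar>x i\<bar>) ` {..<n})" for i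
      using ell_coord_le[OF p n, of i x] ell_nrm_nonneg[OF p n, of x] x[of i]
      by (cases "i < n") (auto simp: 1 nrm_ell_infinity)
    then show "Max ((\<lambda>i. \<bar>x i\<bar>) ` {..<m}) \<le> Max ((\<lambda>i. \<bar>x i\<bar>) ` {..<n})"
      using n \<open>n \<le> m\<close> by (simp add: Max_lessThan_le_iff)
    show "Max ((\<lambda>i. \<bar>x i\<bar>) ` {..<n}) \<le> Max ((\<lambda>i. \<bar>x i\<bar>) ` {..<m})"
      using n \<open>n \<le> m\<close> by (auto simp: Max_lessThan_le_iff intro!: Max_lessThan_ge[where f="\<lambda>i. \<bar>x i\<bar>"])
  qed
  then show ?thesis using 1 by (simp add: nrm_ell_infinity)
next
  case (2 r)
  have "(\<Sum>i<m. \<bar>x i\<bar> powr r) = (\<Sum>i<n. \<bar>x i\<bar> powr r)"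
    using \<open>n \<le> m\<close> x by (intro sum.mono_neutral_right) auto
  then show ?thesis using 2 by (simp add: nrm_ell_real)
qed

lemma ell_nrm_mono_dim:
  assumes p: "1 \<le> p" and n: "0 < n" and "n \<le> m"
  shows "nrm (ell p n) x \<le> nrm (ell p m) x"
proof -
  have "nrm (ell p n) x = nrm (ell p n) (\<lambda>i. if i < n then x i else 0)"
    using p n by (intro ell_nrm_cong) auto
  also have "\<dots> = nrm (ell p m) (\<lambda>i. if i < n then x i else 0)"
    using assms by (intro ell_nrm_extend[symmetric]) auto
  also have "\<dots> \<le> nrm (ell p m) x" using p n \<open>n \<le> m\<close> by (intro ell_nrm_mono) auto
  finally show ?thesis .
qed

section \<open>Infinite sums of spaces\<close>

lemma ell_sum_vecs:
  "v \<in> vecs (ell_sum q E) \<longleftrightarrow> (\<forall>n. v n \<in> vecs (E n)) \<and> summable (\<lambda>n. nrm (E n) (v n) powr q)"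
  by (simp add: ell_sum_def)

lemma ell_sum_nrm: "nrm (ell_sum q E) v = (\<Sum>n. nrm (E n) (v n) powr q) powr (1 / q)"
  by (simp add: ell_sum_def)

lemma ell_sum_nrm_powr:
  assumes "0 < q" "v \<in> vecs (ell_sum q E)"
  shows "nrm (ell_sum q E) v powr q = (\<Sum>n. nrm (E n) (v n) powr q)"
  using assms by (simp add: ell_sum_nrm ell_sum_vecs powr_powr suminf_nonneg)

lemma ell_sum_finite_le:
  assumes "0 < q" "v \<in> vecs (ell_sum q E)" "finite I"
  shows "(\<Sum>n\<in>I. nrm (E n) (v n) powr q) \<le> nrm (ell_sum q E) v powr q"
  unfolding ell_sum_nrm_powr[OF assms(1,2)]
  by (rule sum_le_suminf) (use assms in \<open>auto simp: ell_sum_vecs\<close>)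

text \<open>Bounded partial sums give membership and the norm estimate together; maps into q-sums
  are bounded in this way.\<close>

lemma ell_sum_boundI:
  assumes "0 < q" "\<And>n. v n \<in> vecs (E n)" "0 \<le> K"
    and "\<And>N. (\<Sum>n<N. nrm (E n) (v n) powr q) \<le> K powr q"
  shows "v \<in> vecs (ell_sum q E)" "nrm (ell_sum q E) v \<le> K"
proof -
  have s: "summable (\<lambda>n. nrm (E n) (v n) powr q)"
    by (rule summableI_nonneg_bounded[of _ "K powr q"]) (use assms in auto)
  then show "v \<in> vecs (ell_sum q E)" using assms by (simp add: ell_sum_vecs)
  have "(\<Sum>n. nrm (E n) (v n) powr q) \<le> K powr q"
    by (rule suminf_le_const[OF s]) (use assms in auto)
  then have "(\<Sum>n. nrm (E n) (v n) powr q) powr (1/q) \<le> (K powr q) powr (1/q)"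
    using s assms by (intro powr_mono2 suminf_nonneg) auto
  then show "nrm (ell_sum q E) v \<le> K" using assms by (simp add: ell_sum_nrm powr_powr)
qed

lemma ell_sum_nrm_nonneg: "0 \<le> nrm (ell_sum q E) v"
  by (simp add: ell_sum_nrm)

lemma ell_sum_coord_le:
  assumes "0 < q" "v \<in> vecs (ell_sum q E)" "\<And>n. seminormed (E n)"
  shows "nrm (E n) (v n) \<le> nrm (ell_sum q E) v"
proof -
  have "nrm (E n) (v n) powr q \<le> nrm (ell_sum q E) v powr q"
    using ell_sum_finite_le[OF assms(1,2), of "{n}"] by simp
  moreover have "0 \<le> nrm (E n) (v n)" using seminormed.nonneg[OF assms(3)] assms(2) by (simp add: ell_sum_vecs)
  ultimately show ?thesis
    using assms(1) ell_sum_nrm_nonneg[of q E v] by (meson not_le powr_less_mono2)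
qed

lemma seminormed_ell_sum:
  assumes q: "1 \<le> q" and E: "\<And>n. seminormed (E n)"
  shows "seminormed (ell_sum q E)"
proof
  let ?X = "ell_sum q E"
  show "0 \<in> vecs ?X" using q by (auto simp: ell_sum_vecs seminormed.zero_mem[OF E] seminormed.nrm_zero[OF E])
  fix x assume x: "x \<in> vecs ?X"
  show "0 \<le> nrm ?X x" by (rule ell_sum_nrm_nonneg)
  have nn: "0 \<le> nrm (E n) (x n)" for n using seminormed.nonneg[OF E] x by (simp add: ell_sum_vecs)
  fix c :: real
  have eq: "nrm (E n) ((c *\<^sub>R x) n) powr q = \<bar>c\<bar> powr q * nrm (E n) (x n) powr q" for n
    using x nn seminormed.scale[OF E] by (simp add: ell_sum_vecs powr_mult)
  then show "c *\<^sub>R x \<in> vecs ?X" using x seminormed.scale_mem[OF E] by (simp add: ell_sum_vecs summable_mult)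
  have "(\<Sum>n. nrm (E n) ((c *\<^sub>R x) n) powr q) = \<bar>c\<bar> powr q * (\<Sum>n. nrm (E n) (x n) powr q)"
    unfolding eq using x by (intro suminf_mult) (simp add: ell_sum_vecs)
  then show "nrm ?X (c *\<^sub>R x) = \<bar>c\<bar> * nrm ?X x"
    using x q by (simp add: ell_sum_nrm powr_mult powr_powr suminf_nonneg ell_sum_vecs)
  fix y assume y: "y \<in> vecs ?X"
  have nny: "0 \<le> nrm (E n) (y n)" for n using seminormed.nonneg[OF E] y by (simp add: ell_sum_vecs)
  have mem: "(x + y) n \<in> vecs (E n)" for n using x y seminormed.add_mem[OF E] by (simp add: ell_sum_vecs)
  have "(\<Sum>n<N. nrm (E n) ((x + y) n) powr q) \<le> (nrm ?X x + nrm ?X y) powr q" for N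
  proof -
    have tail: "(\<Sum>n<N. nrm (E n) (z n) powr q) powr (1/q) \<le> nrm ?X z" if "z \<in> vecs ?X" for z
    proof -
      have "(\<Sum>n<N. nrm (E n) (z n) powr q) powr (1/q) \<le> (nrm ?X z powr q) powr (1/q)"
        using that q by (intro powr_mono2 ell_sum_finite_le sum_nonneg) auto
      then show ?thesis using q by (simp add: powr_powr ell_sum_nrm_nonneg)
    qed
    have "(\<Sum>n<N. nrm (E n) ((x + y) n) powr q) \<le> (\<Sum>n<N. (nrm (E n) (x n) + nrm (E n) (y n)) powr q)"
      using q x y mem seminormed.triangle[OF E] seminormed.nonneg[OF E]
      by (intro sum_mono powr_mono2) (auto simp: ell_sum_vecs)
    also have "\<dots> = ((\<Sum>n<N. (nrm (E n) (x n) + nrm (E n) (y n)) powr q) powr (1/q)) powr q"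
      using q by (simp add: powr_powr sum_nonneg)
    also have "\<dots> \<le> ((\<Sum>n<N. nrm (E n) (x n) powr q) powr (1/q) + (\<Sum>n<N. nrm (E n) (y n) powr q) powr (1/q)) powr q"
      using q nn nny by (intro powr_mono2 minkowski_sum) auto
    also have "\<dots> \<le> (nrm ?X x + nrm ?X y) powr q"
      using q x y tail by (intro powr_mono2 add_mono) auto
    finally show ?thesis .
  qed
  from ell_sum_boundI[of q "x + y" E, OF _ mem _ this] q
  show "x + y \<in> vecs ?X" "nrm ?X (x + y) \<le> nrm ?X x + nrm ?X y"
    by (auto simp: ell_sum_nrm_nonneg)
qed

lemma c0_sum_vecs:
  "v \<in> vecs (c0_sum E) \<longleftrightarrow> (\<forall>n. v n \<in> vecs (E n)) \<and> (\<lambda>n. nrm (E n) (v n)) \<longlonglongrightarrow> 0"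
  by (simp add: c0_sum_def)

lemma c0_sum_nrm: "nrm (c0_sum E) v = (SUP n. nrm (E n) (v n))"
  by (simp add: c0_sum_def)

lemma c0_sum_coord_le:
  assumes "v \<in> vecs (c0_sum E)"
  shows "nrm (E n) (v n) \<le> nrm (c0_sum E) v"
proof -
  have "bounded (range (\<lambda>n. nrm (E n) (v n)))"
    using assms by (intro convergent_imp_bounded) (auto simp: c0_sum_vecs)
  then show ?thesis unfolding c0_sum_nrm by (intro cSUP_upper bounded_imp_bdd_above) auto
qed

lemma c0_sum_nrm_le: "(\<And>n. nrm (E n) (v n) \<le> K) \<Longrightarrow> nrm (c0_sum E) v \<le> K"
  unfolding c0_sum_nrm by (intro cSUP_least) auto

lemma seminormed_c0_sum:
  assumes E: "\<And>n. seminormed (E n)"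
  shows "seminormed (c0_sum E)"
proof
  let ?X = "c0_sum E"
  show "0 \<in> vecs ?X" by (auto simp: c0_sum_vecs seminormed.zero_mem[OF E] seminormed.nrm_zero[OF E])
  fix x assume x: "x \<in> vecs ?X"
  have nn: "0 \<le> nrm (E n) (x n)" for n using seminormed.nonneg[OF E] x by (simp add: c0_sum_vecs)
  show nX: "0 \<le> nrm ?X x" using order_trans[OF nn c0_sum_coord_le[OF x]] .
  fix c :: real
  have eq: "nrm (E n) ((c *\<^sub>R x) n) = \<bar>c\<bar> * nrm (E n) (x n)" for n
    using x nn seminormed.scale[OF E] by (simp add: c0_sum_vecs)
  show cx: "c *\<^sub>R x \<in> vecs ?X"
    using x seminormed.scale_mem[OF E] eq tendsto_mult_left[of "\<lambda>n. nrm (E n) (x n)" 0 sequentially "\<bar>c\<bar>"]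
    by (simp add: c0_sum_vecs)
  show "nrm ?X (c *\<^sub>R x) = \<bar>c\<bar> * nrm ?X x"
  proof (rule antisym)
    show "nrm ?X (c *\<^sub>R x) \<le> \<bar>c\<bar> * nrm ?X x"
      using c0_sum_coord_le[OF x] by (intro c0_sum_nrm_le) (simp only: eq, simp add: mult_left_mono)
    show "\<bar>c\<bar> * nrm ?X x \<le> nrm ?X (c *\<^sub>R x)"
    proof (cases "c = 0")
      case True then show ?thesis using c0_sum_coord_le[OF cx, of 0] eq[of 0] by simp
    next
      case False
      have "nrm ?X x \<le> nrm ?X (c *\<^sub>R x) / \<bar>c\<bar>"
      proof (rule c0_sum_nrm_le)
        fix n show "nrm (E n) (x n) \<le> nrm ?X (c *\<^sub>R x) / \<bar>c\<bar>"
          using c0_sum_coord_le[OF cx, of n] eq[of n] False by (simp add: field_simps)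
      qed
      then show ?thesis using False by (simp add: field_simps)
    qed
  qed
  fix y assume y: "y \<in> vecs ?X"
  have tri: "nrm (E n) ((x + y) n) \<le> nrm (E n) (x n) + nrm (E n) (y n)" for n
    using x y seminormed.triangle[OF E] by (simp add: c0_sum_vecs)
  have mem: "(x + y) n \<in> vecs (E n)" for n using x y seminormed.add_mem[OF E] by (simp add: c0_sum_vecs)
  have "(\<lambda>n. nrm (E n) ((x + y) n)) \<longlonglongrightarrow> 0"
  proof (rule tendsto_sandwich[of "\<lambda>_. 0"])
    show "(\<lambda>n. nrm (E n) (x n) + nrm (E n) (y n)) \<longlonglongrightarrow> 0"
      using x y tendsto_add[of _ 0 _ _ 0] by (fastforce simp: c0_sum_vecs)
  qed (use tri mem seminormed.nonneg[OF E] in auto)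
  then show "x + y \<in> vecs ?X" using mem by (simp add: c0_sum_vecs)
  show "nrm ?X (x + y) \<le> nrm ?X x + nrm ?X y"
    using tri c0_sum_coord_le[OF x] c0_sum_coord_le[OF y]
    by (intro c0_sum_nrm_le) (meson add_mono order_trans)
qed

section \<open>Consequences of greediness\<close>

context seminormed
begin

lemma expands_finite_sum:
  assumes "finite F"
  shows "expands X e (\<lambda>i. if i \<in> F then a i else 0) (\<Sum>i\<in>F. a i *\<^sub>R e i)"
proof -
  obtain N where N: "F \<subseteq> {..<N}" using finite_nat_iff_bounded assms by blast
  have "nrm X ((\<Sum>i\<in>F. a i *\<^sub>R e i) - (\<Sum>i<n. (if i \<in> F then a i else 0) *\<^sub>R e i)) = 0" if "N \<le> n" for n
  proof -
    have "(\<Sum>i<n. (if i \<in> F then a i else 0) *\<^sub>R e i) = (\<Sum>i\<in>F. a i *\<^sub>R e i)"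
      using N that by (intro sum.mono_neutral_cong_right) auto
    then show ?thesis by (simp only: diff_self nrm_zero)
  qed
  then show ?thesis unfolding expands_def
    by (intro tendsto_eventually eventually_sequentiallyI[of N])
qed

lemma diff_combination_mem:
  assumes "range e \<subseteq> vecs X" "x \<in> vecs X"
  shows "x - (\<Sum>i\<in>A. a i *\<^sub>R e i) \<in> vecs X"
  using assms by (intro diff_mem sum_mem scale_mem) auto

lemma best_error_le:
  assumes "range e \<subseteq> vecs X" "x \<in> vecs X" "finite A" "card A \<le> n"
  shows "best_error X e n x \<le> nrm X (x - (\<Sum>i\<in>A. a i *\<^sub>R e i))"
  unfolding best_error_def
proof (rule cInf_lower)
  show "bdd_below {nrm X (x - (\<Sum>i\<in>A. a i *\<^sub>R e i)) | a A. finite A \<and> card A \<le> n}"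
  proof (rule bdd_belowI[of _ 0])
    fix y assume "y \<in> {nrm X (x - (\<Sum>i\<in>A. a i *\<^sub>R e i)) | a A. finite A \<and> card A \<le> n}"
    then obtain a A where "y = nrm X (x - (\<Sum>i\<in>A. a i *\<^sub>R e i))" by blast
    moreover have "x - (\<Sum>i\<in>A. a i *\<^sub>R e i) \<in> vecs X" using assms by (intro diff_combination_mem) auto
    ultimately show "0 \<le> y" by simp
  qed
  show "nrm X (x - (\<Sum>i\<in>A. a i *\<^sub>R e i)) \<in> {nrm X (x - (\<Sum>i\<in>A. a i *\<^sub>R e i)) | a A. finite A \<and> card A \<le> n}"
    using assms by blast
qed

lemma best_error_nonneg:
  assumes "range e \<subseteq> vecs X" "x \<in> vecs X"
  shows "0 \<le> best_error X e n x"
  unfolding best_error_def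
proof (rule cInf_greatest)
  show "{nrm X (x - (\<Sum>i\<in>A. a i *\<^sub>R e i)) | a A. finite A \<and> card A \<le> n} \<noteq> {}"
  proof -
    have "nrm X (x - (\<Sum>i\<in>{}. 0 *\<^sub>R e i)) \<in> {nrm X (x - (\<Sum>i\<in>A. a i *\<^sub>R e i)) | a A. finite A \<and> card A \<le> n}"
      by (intro CollectI exI[of _ "{}"] exI[of _ "\<lambda>_. 0"] conjI refl) auto
    then show ?thesis by blast
  qed
next
  fix y assume "y \<in> {nrm X (x - (\<Sum>i\<in>A. a i *\<^sub>R e i)) | a A. finite A \<and> card A \<le> n}"
  then obtain a A where "y = nrm X (x - (\<Sum>i\<in>A. a i *\<^sub>R e i))" by blast
  moreover have "x - (\<Sum>i\<in>A. a i *\<^sub>R e i) \<in> vecs X" using assms by (intro diff_combination_mem) auto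
  ultimately show "0 \<le> y" by simp
qed

end

locale greedy_basis = seminormed X for X :: "'a::real_vector nspace" +
  fixes e :: "nat \<Rightarrow> 'a" and C :: real
  assumes greedy: "greedy_with C X e" and C_ge_1: "1 \<le> C"
begin

abbreviation f where "f i x \<equiv> biorth X e i x"

lemma schauder: "schauder_basis X e"
  using greedy unfolding greedy_with_def by blast

lemma e_mem [simp, intro]: "e i \<in> vecs X"
  using schauder unfolding schauder_basis_def by blast

lemma range_e: "range e \<subseteq> vecs X"
  by auto

lemma expands_unique: "x \<in> vecs X \<Longrightarrow> expands X e a x \<Longrightarrow> expands X e b x \<Longrightarrow> a = b"
  using schauder unfolding schauder_basis_def by blast

lemma expands_biorth: "x \<in> vecs X \<Longrightarrow> expands X e (\<lambda>i. f i x) x"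
  unfolding biorth_def using schauder theI'[of "\<lambda>a. expands X e a x"] unfolding schauder_basis_def by blast

lemma biorth_eqI: "x \<in> vecs X \<Longrightarrow> expands X e a x \<Longrightarrow> f i x = a i"
  using expands_unique[OF _ expands_biorth, of x a] by metis

lemma biorth_finite_sum: "finite F \<Longrightarrow> f i (\<Sum>i\<in>F. a i *\<^sub>R e i) = (if i \<in> F then a i else 0)"
  by (rule biorth_eqI[OF _ expands_finite_sum]) auto

lemma biorth_add:
  assumes "x \<in> vecs X" "y \<in> vecs X"
  shows "f i (x + y) = f i x + f i y"
proof (rule biorth_eqI[of _ "\<lambda>i. f i x + f i y"])
  have *: "(x + y) - (\<Sum>i<n. (f i x + f i y) *\<^sub>R e i) = (x - (\<Sum>i<n. f i x *\<^sub>R e i)) + (y - (\<Sum>i<n. f i y *\<^sub>R e i))" for n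
    by (simp add: sum.distrib scaleR_add_left)
  show "expands X e (\<lambda>i. f i x + f i y) (x + y)"
    unfolding expands_def *
  proof (rule tendsto_sandwich[of "\<lambda>_. 0"])
    show "(\<lambda>n. nrm X (x - (\<Sum>i<n. f i x *\<^sub>R e i)) + nrm X (y - (\<Sum>i<n. f i y *\<^sub>R e i))) \<longlonglongrightarrow> 0"
      using tendsto_add[OF expands_biorth[OF assms(1), unfolded expands_def] expands_biorth[OF assms(2), unfolded expands_def]]
      by simp
    show "\<forall>\<^sub>F n in sequentially. nrm X ((x - (\<Sum>i<n. f i x *\<^sub>R e i)) + (y - (\<Sum>i<n. f i y *\<^sub>R e i)))
        \<le> nrm X (x - (\<Sum>i<n. f i x *\<^sub>R e i)) + nrm X (y - (\<Sum>i<n. f i y *\<^sub>R e i))"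
      using assms by (intro always_eventually allI triangle) auto
    show "\<forall>\<^sub>F n in sequentially. 0 \<le> nrm X ((x - (\<Sum>i<n. f i x *\<^sub>R e i)) + (y - (\<Sum>i<n. f i y *\<^sub>R e i)))"
      using assms by (intro always_eventually allI nonneg) auto
  qed auto
qed (use assms in auto)

lemma biorth_scale:
  assumes "x \<in> vecs X"
  shows "f i (c *\<^sub>R x) = c * f i x"
proof (rule biorth_eqI[of _ "\<lambda>i. c * f i x"])
  have *: "c *\<^sub>R x - (\<Sum>i<n. (c * f i x) *\<^sub>R e i) = c *\<^sub>R (x - (\<Sum>i<n. f i x *\<^sub>R e i))" for n
    by (simp add: scaleR_diff_right scaleR_sum_right)
  have "nrm X (c *\<^sub>R x - (\<Sum>i<n. (c * f i x) *\<^sub>R e i)) = \<bar>c\<bar> * nrm X (x - (\<Sum>i<n. f i x *\<^sub>R e i))" for n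
    unfolding * using assms by (intro scale) auto
  then show "expands X e (\<lambda>i. c * f i x) (c *\<^sub>R x)"
    unfolding expands_def using tendsto_mult_right_zero[OF expands_biorth[OF assms, unfolded expands_def]] by simp
qed (use assms in auto)

lemma biorth_zero: "f i 0 = 0"
  using biorth_scale[of 0 i 0] by simp

lemma biorth_sum: "(\<And>k. k \<in> A \<Longrightarrow> g k \<in> vecs X) \<Longrightarrow> f i (sum g A) = (\<Sum>k\<in>A. f i (g k))"
  by (induction A rule: infinite_finite_induct) (auto simp: biorth_add biorth_zero)

lemma greedy_le:
  assumes "x \<in> vecs X" "1 \<le> card A" "greedy_set X e (card A) x A" "finite B" "card B \<le> card A"
  shows "nrm X (x - greedy_approx X e A x) \<le> C * nrm X (x - (\<Sum>i\<in>B. b i *\<^sub>R e i))"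
proof -
  have "nrm X (x - greedy_approx X e A x) \<le> C * best_error X e (card A) x"
    using greedy assms unfolding greedy_with_def by blast
  also have "\<dots> \<le> C * nrm X (x - (\<Sum>i\<in>B. b i *\<^sub>R e i))"
    using C_ge_1 assms by (intro mult_left_mono best_error_le range_e) auto
  finally show ?thesis .
qed

text \<open>The form in which the greedy inequality is used below: deleting a greedy set A costs at
  most C times the norm obtained by giving arbitrary values to the coefficients on a set B that is
  no larger.\<close>

lemma greedy_finite_sum_le:
  assumes F: "finite F" "A \<subseteq> F" "B \<subseteq> F" "card B \<le> card A"
    and le: "\<And>i j. i \<in> A \<Longrightarrow> j \<in> F - A \<Longrightarrow> \<bar>a j\<bar> \<le> \<bar>a i\<bar>"
  shows "nrm X (\<Sum>i\<in>F - A. a i *\<^sub>R e i) \<le> C * nrm X (\<Sum>i\<in>F. (if i \<in> B then b i else a i) *\<^sub>R e i)"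
proof (cases "A = {}")
  case True
  then have "B = {}" using F finite_subset by fastforce
  then show ?thesis using True C_ge_1 mult_right_mono[OF C_ge_1, of "nrm X (\<Sum>i\<in>F. a i *\<^sub>R e i)"] by auto
next
  case False
  define x where "x = (\<Sum>i\<in>F. a i *\<^sub>R e i)"
  have x: "x \<in> vecs X" by (auto simp: x_def)
  have fin: "finite A" "finite B" using F finite_subset by auto
  have c: "1 \<le> card A" using False fin by (simp add: Suc_le_eq card_gt_0_iff)
  have fx: "f i x = (if i \<in> F then a i else 0)" for i unfolding x_def by (rule biorth_finite_sum[OF F(1)])
  have "greedy_set X e (card A) x A" using fin F le by (auto simp: greedy_set_def fx)
  \<comment> \<open>Subtracting \<open>a i - b i\<close> on B leaves the coefficients b
    there.\<close>
  from greedy_le[OF x c this fin(2) F(4), of "\<lambda>i. a i - b i"]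
  have "nrm X (x - greedy_approx X e A x) \<le> C * nrm X (x - (\<Sum>i\<in>B. (a i - b i) *\<^sub>R e i))" .
  moreover have "x - greedy_approx X e A x = (\<Sum>i\<in>F - A. a i *\<^sub>R e i)"
  proof -
    have "greedy_approx X e A x = (\<Sum>i\<in>A. a i *\<^sub>R e i)"
      using F(2) by (auto simp: greedy_approx_def fx intro!: sum.cong)
    then show ?thesis using F by (simp add: x_def sum_diff)
  qed
  moreover have "x - (\<Sum>i\<in>B. (a i - b i) *\<^sub>R e i) = (\<Sum>i\<in>F. (if i \<in> B then b i else a i) *\<^sub>R e i)"
  proof -
    have "(\<Sum>i\<in>B. (a i - b i) *\<^sub>R e i) = (\<Sum>i\<in>F. (if i \<in> B then a i - b i else 0) *\<^sub>R e i)"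
      using F by (intro sum.mono_neutral_cong_left) auto
    then show ?thesis
      by (auto simp: x_def sum_subtractf[symmetric] scaleR_diff_left[symmetric] intro!: sum.cong)
  qed
  ultimately show ?thesis by (simp only:)
qed

lemma suppression:
  assumes "finite F" "A \<subseteq> F"
  shows "nrm X (\<Sum>i\<in>A. a i *\<^sub>R e i) \<le> C * nrm X (\<Sum>i\<in>F. a i *\<^sub>R e i)"
proof -
  \<comment> \<open>With large coefficients on \<open>F - A\<close> the set \<open>F - A\<close> becomes greedy, and undoing the change is
    an approximation by \<open>card (F - A)\<close> terms.\<close>
  define a' where "a' = (\<lambda>i. if i \<in> F - A then (\<Sum>j\<in>F. \<bar>a j\<bar>) else a i)"
  have "nrm X (\<Sum>i\<in>F - (F - A). a' i *\<^sub>R e i) \<le> C * nrm X (\<Sum>i\<in>F. (if i \<in> F - A then a i else a' i) *\<^sub>R e i)"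
    using assms by (intro greedy_finite_sum_le)
      (auto simp: a'_def abs_of_nonneg[OF sum_nonneg] intro!: member_le_sum[where f="\<lambda>j. \<bar>a j\<bar>"])
  moreover have "F - (F - A) = A" using assms by auto
  moreover have "(\<Sum>i\<in>A. a' i *\<^sub>R e i) = (\<Sum>i\<in>A. a i *\<^sub>R e i)"
    by (intro sum.cong) (auto simp: a'_def)
  moreover have "(\<Sum>i\<in>F. (if i \<in> F - A then a i else a' i) *\<^sub>R e i) = (\<Sum>i\<in>F. a i *\<^sub>R e i)"
    by (intro sum.cong) (auto simp: a'_def)
  ultimately show ?thesis by (simp only:)
qed

lemma sign_change:
  assumes "finite F" "\<And>i. i \<in> F \<Longrightarrow> \<epsilon> i \<in> {-1, 1}"
  shows "nrm X (\<Sum>i\<in>F. (\<epsilon> i * a i) *\<^sub>R e i) \<le> 2 * C * nrm X (\<Sum>i\<in>F. a i *\<^sub>R e i)"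
proof -
  let ?P = "{i\<in>F. \<epsilon> i = 1}" and ?N = "{i\<in>F. \<epsilon> i = -1}"
  have "F = ?P \<union> ?N" using assms by auto
  then have "(\<Sum>i\<in>F. (\<epsilon> i * a i) *\<^sub>R e i) = (\<Sum>i\<in>?P \<union> ?N. (\<epsilon> i * a i) *\<^sub>R e i)" by simp
  also have "\<dots> = (\<Sum>i\<in>?P. (\<epsilon> i * a i) *\<^sub>R e i) + (\<Sum>i\<in>?N. (\<epsilon> i * a i) *\<^sub>R e i)"
    using assms by (intro sum.union_disjoint) auto
  also have "\<dots> = (\<Sum>i\<in>?P. a i *\<^sub>R e i) - (\<Sum>i\<in>?N. a i *\<^sub>R e i)"
    by (simp add: sum_negf)
  finally have "nrm X (\<Sum>i\<in>F. (\<epsilon> i * a i) *\<^sub>R e i) \<le> nrm X (\<Sum>i\<in>?P. a i *\<^sub>R e i) + nrm X (\<Sum>i\<in>?N. a i *\<^sub>R e i)"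
    by (auto intro!: triangle_diff)
  then show ?thesis using suppression[of F ?P a] suppression[of F ?N a] assms(1) by auto
qed

text \<open>In the sum over both sets B carries the larger coefficients and is greedy. Removing A
  instead is a competing approximation with no more terms.\<close>

lemma democratic_disjoint:
  assumes "finite A" "finite B" "A \<inter> B = {}" "card A \<le> card B"
    and "\<And>i. i \<in> A \<Longrightarrow> \<bar>a i\<bar> \<le> 1" "\<And>i. i \<in> B \<Longrightarrow> 1 \<le> \<bar>b i\<bar>"
  shows "nrm X (\<Sum>i\<in>A. a i *\<^sub>R e i) \<le> C * nrm X (\<Sum>i\<in>B. b i *\<^sub>R e i)"
proof -
  let ?c = "\<lambda>i. if i \<in> A then a i else b i"
  have le: "\<bar>a j\<bar> \<le> \<bar>b i\<bar>" if "i \<in> B" "j \<in> A" for i j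
    using assms(5)[OF that(2)] assms(6)[OF that(1)] by linarith
  have "nrm X (\<Sum>i\<in>(A \<union> B) - B. ?c i *\<^sub>R e i) \<le> C * nrm X (\<Sum>i\<in>A \<union> B. (if i \<in> A then 0 else ?c i) *\<^sub>R e i)"
  proof (rule greedy_finite_sum_le)
    fix i j assume "i \<in> B" "j \<in> A \<union> B - B"
    then show "\<bar>if j \<in> A then a j else b j\<bar> \<le> \<bar>if i \<in> A then a i else b i\<bar>"
      using le assms(3) by auto
  qed (use assms in auto)
  moreover have "A \<union> B - B = A" using assms by auto
  moreover have "(\<Sum>i\<in>A. ?c i *\<^sub>R e i) = (\<Sum>i\<in>A. a i *\<^sub>R e i)"
    by (intro sum.cong) auto
  moreover have "(\<Sum>i\<in>A \<union> B. (if i \<in> A then 0 else ?c i) *\<^sub>R e i) = (\<Sum>i\<in>B. b i *\<^sub>R e i)"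
    using assms by (intro sum.mono_neutral_cong_right) auto
  ultimately show ?thesis by (simp only:)
qed

lemma democratic:
  assumes "finite A" "finite B" "card A \<le> card B"
    and "\<And>i. i \<in> A \<Longrightarrow> \<bar>a i\<bar> \<le> 1" "\<And>i. i \<in> B \<Longrightarrow> 1 \<le> \<bar>b i\<bar>"
  shows "nrm X (\<Sum>i\<in>A. a i *\<^sub>R e i) \<le> C\<^sup>2 * nrm X (\<Sum>i\<in>B. b i *\<^sub>R e i)"
proof -
  obtain N where N: "A \<union> B \<subseteq> {..<N}"
    using finite_nat_iff_bounded[of "A \<union> B"] assms(1,2) by auto
  \<comment> \<open>Indices beyond both sets: each of A and B is disjoint from D, so two disjoint
    comparisons suffice and cost C twice.\<close>
  define D where "D = {N..<N + card B}"
  have D: "finite D" "card D = card B" "A \<inter> D = {}" "D \<inter> B = {}" using N by (auto simp: D_def)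
  have "nrm X (\<Sum>i\<in>A. a i *\<^sub>R e i) \<le> C * nrm X (\<Sum>i\<in>D. 1 *\<^sub>R e i)"
    using democratic_disjoint[where A=A and B=D and a=a and b="\<lambda>_. 1", OF assms(1) D(1,3) _ assms(4)] D(2) assms(3) by simp
  also have "\<dots> \<le> C * (C * nrm X (\<Sum>i\<in>B. b i *\<^sub>R e i))"
    using democratic_disjoint[where A=D and B=B and a="\<lambda>_. 1" and b=b, OF D(1) assms(2) D(4) _ _ assms(5)] D(2) C_ge_1
    by (intro mult_left_mono) simp_all
  finally show ?thesis by (simp add: power2_eq_square)
qed

text \<open>Uniqueness of expansions gives this: a basis vector of norm 0 would also be represented
  by the coefficients 0.\<close>

lemma nrm_e_pos: "0 < nrm X (e i)"
proof (rule ccontr)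
  assume "\<not> 0 < nrm X (e i)"
  then have z: "nrm X (e i) = 0" using nonneg[OF e_mem[of i]] by linarith
  have "expands X e (\<lambda>_. 0) (e i)" by (simp add: expands_def z)
  then have "f i (e i) = 0" using biorth_eqI[OF e_mem] by metis
  moreover have "f i (e i) = 1" using biorth_finite_sum[of "{i}" i "\<lambda>_. 1"] by simp
  ultimately show False by simp
qed

lemma nrm_e_le: "nrm X (e i) \<le> C\<^sup>2 * nrm X (e j)"
  using democratic[of "{i}" "{j}" "\<lambda>_. 1" "\<lambda>_. 1"] by simp

lemma partial_sum_tendsto:
  assumes "x \<in> vecs X"
  shows "(\<lambda>n. nrm X (\<Sum>i<n. f i x *\<^sub>R e i)) \<longlonglongrightarrow> nrm X x"
proof -
  have "(\<lambda>n. nrm X (\<Sum>i<n. f i x *\<^sub>R e i) - nrm X x) \<longlonglongrightarrow> 0"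
  proof (rule tendsto_rabs_zero_cancel, rule tendsto_sandwich[of "\<lambda>_. 0"])
    show "(\<lambda>n. nrm X (x - (\<Sum>i<n. f i x *\<^sub>R e i))) \<longlonglongrightarrow> 0"
      using expands_biorth[OF assms] by (simp add: expands_def)
    show "\<forall>\<^sub>F n in sequentially. \<bar>nrm X (\<Sum>i<n. f i x *\<^sub>R e i) - nrm X x\<bar> \<le> nrm X (x - (\<Sum>i<n. f i x *\<^sub>R e i))"
    proof (intro always_eventually allI)
      fix n
      have m: "(\<Sum>i<n. f i x *\<^sub>R e i) \<in> vecs X" by auto
      show "\<bar>nrm X (\<Sum>i<n. f i x *\<^sub>R e i) - nrm X x\<bar> \<le> nrm X (x - (\<Sum>i<n. f i x *\<^sub>R e i))"
        using reverse_triangle_diff[OF assms m] by linarith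
    qed
  qed auto
  then show ?thesis by (simp add: LIM_zero_iff)
qed

text \<open>\<open>suppression\<close> inside the partial sums of x, whose norms converge to that of
  x.\<close>

lemma projection_bound:
  assumes "finite A" "x \<in> vecs X"
  shows "nrm X (\<Sum>i\<in>A. f i x *\<^sub>R e i) \<le> C * nrm X x"
proof (rule LIMSEQ_le_const)
  show "(\<lambda>n. C * nrm X (\<Sum>i<n. f i x *\<^sub>R e i)) \<longlonglongrightarrow> C * nrm X x"
    by (intro tendsto_mult_left partial_sum_tendsto assms)
  obtain N where "A \<subseteq> {..<N}" using finite_nat_iff_bounded assms by blast
  then have sub: "A \<subseteq> {..<n}" if "N \<le> n" for n using that by auto
  show "\<exists>N. \<forall>n\<ge>N. nrm X (\<Sum>i\<in>A. f i x *\<^sub>R e i) \<le> C * nrm X (\<Sum>i<n. f i x *\<^sub>R e i)"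
    using suppression[OF finite_lessThan sub] by (intro exI[of _ N] allI impI) simp
qed

lemma coefficient_bound:
  assumes "x \<in> vecs X"
  shows "\<bar>f i x\<bar> * nrm X (e i) \<le> C * nrm X x"
  using projection_bound[of "{i}" x] assms by simp

end

lemma greedy_basisI:
  assumes "seminormed X" "greedy_with C X e"
  shows "greedy_basis X e (max C 1)"
proof -
  interpret seminormed X by fact
  show ?thesis
  proof
    have r: "range e \<subseteq> vecs X" using assms unfolding greedy_with_def schauder_basis_def by blast
    have "C * best_error X e n x \<le> max C 1 * best_error X e n x" if "x \<in> vecs X" for n x
      using best_error_nonneg[OF r that] by (intro mult_right_mono) auto
    then show "greedy_with (max C 1) X e" using assms(2) unfolding greedy_with_def by (meson order_trans)
  qed auto
qed

section \<open>Random signs\<close>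

text \<open>A choice of signs on I is coded by the set of indices with sign 1, so that averages over
  signs become sums over \<open>Pow I\<close>.\<close>

definition sg :: "nat set \<Rightarrow> nat \<Rightarrow> real" where
  "sg A i = (if i \<in> A then 1 else -1)"

lemma abs_sg [simp]: "\<bar>sg A i\<bar> = 1"
  by (simp add: sg_def)

lemma sum_Pow_insert:
  fixes g :: "nat set \<Rightarrow> real"
  assumes "finite I" "x \<notin> I"
  shows "(\<Sum>A\<in>Pow (insert x I). g A) = (\<Sum>A\<in>Pow I. g A + g (insert x A))"
proof -
  have "inj_on (insert x) (Pow I)" using assms(2) by (auto simp: inj_on_def)
  moreover have "Pow I \<inter> insert x ` Pow I = {}" using assms(2) by auto
  ultimately show ?thesis
    using assms(1) by (simp add: Pow_insert sum.union_disjoint sum.reindex sum.distrib)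
qed

lemma signed_sum_insert:
  assumes "finite I" "x \<notin> I" "A \<subseteq> I"
  shows "(\<Sum>i\<in>insert x I. sg A i * c i) = (\<Sum>i\<in>I. sg A i * c i) - c x"
    and "(\<Sum>i\<in>insert x I. sg (insert x A) i * c i) = (\<Sum>i\<in>I. sg A i * c i) + c x"
proof -
  have "x \<notin> A" using assms by auto
  then show "(\<Sum>i\<in>insert x I. sg A i * c i) = (\<Sum>i\<in>I. sg A i * c i) - c x"
    using assms by (simp add: sg_def)
  have "(\<Sum>i\<in>I. sg (insert x A) i * c i) = (\<Sum>i\<in>I. sg A i * c i)"
    using assms(2) by (intro sum.cong) (auto simp: sg_def)
  then show "(\<Sum>i\<in>insert x I. sg (insert x A) i * c i) = (\<Sum>i\<in>I. sg A i * c i) + c x"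
    using assms by (simp add: sg_def)
qed

lemma sum_signed_square:
  assumes "finite I"
  shows "(\<Sum>A\<in>Pow I. (\<Sum>i\<in>I. sg A i * c i)\<^sup>2) = 2 ^ card I * (\<Sum>i\<in>I. (c i)\<^sup>2)"
  using assms
proof (induction I)
  case (insert x I)
  have "(\<Sum>A\<in>Pow (insert x I). (\<Sum>i\<in>insert x I. sg A i * c i)\<^sup>2)
      = (\<Sum>A\<in>Pow I. ((\<Sum>i\<in>I. sg A i * c i) - c x)\<^sup>2 + ((\<Sum>i\<in>I. sg A i * c i) + c x)\<^sup>2)"
    unfolding sum_Pow_insert[OF insert.hyps]
    by (rule sum.cong) (simp_all only: Pow_iff signed_sum_insert[OF insert.hyps])
  also have "\<dots> = (\<Sum>A\<in>Pow I. 2 * (\<Sum>i\<in>I. sg A i * c i)\<^sup>2 + 2 * (c x)\<^sup>2)"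
    by (rule sum.cong) (simp_all add: power2_eq_square algebra_simps)
  also have "\<dots> = 2 * (\<Sum>A\<in>Pow I. (\<Sum>i\<in>I. sg A i * c i)\<^sup>2) + 2 * (2 ^ card I * (c x)\<^sup>2)"
    using insert.hyps by (simp add: sum.distrib sum_distrib_left card_Pow)
  also have "\<dots> = 2 ^ card (insert x I) * (\<Sum>i\<in>insert x I. (c i)\<^sup>2)"
    unfolding insert.IH using insert.hyps by (simp add: algebra_simps)
  finally show ?case .
qed simp

lemma sum_signed_fourth_le:
  assumes "finite I"
  shows "(\<Sum>A\<in>Pow I. (\<Sum>i\<in>I. sg A i * c i) ^ 4) \<le> 3 * 2 ^ card I * (\<Sum>i\<in>I. (c i)\<^sup>2)\<^sup>2"
  using assms
proof (induction I)
  case (insert x I)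
  have "(\<Sum>A\<in>Pow (insert x I). (\<Sum>i\<in>insert x I. sg A i * c i) ^ 4)
      = (\<Sum>A\<in>Pow I. ((\<Sum>i\<in>I. sg A i * c i) - c x) ^ 4 + ((\<Sum>i\<in>I. sg A i * c i) + c x) ^ 4)"
    unfolding sum_Pow_insert[OF insert.hyps]
    by (rule sum.cong) (simp_all only: Pow_iff signed_sum_insert[OF insert.hyps])
  also have "\<dots> = (\<Sum>A\<in>Pow I. 2 * (\<Sum>i\<in>I. sg A i * c i) ^ 4 + 12 * (c x)\<^sup>2 * (\<Sum>i\<in>I. sg A i * c i)\<^sup>2 + 2 * (c x) ^ 4)"
    by (rule sum.cong) (simp_all add: eval_nat_numeral algebra_simps)
  also have "\<dots> = 2 * (\<Sum>A\<in>Pow I. (\<Sum>i\<in>I. sg A i * c i) ^ 4)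
      + 12 * (c x)\<^sup>2 * (\<Sum>A\<in>Pow I. (\<Sum>i\<in>I. sg A i * c i)\<^sup>2) + 2 * (2 ^ card I * (c x) ^ 4)"
    using insert.hyps by (simp add: sum.distrib sum_distrib_left card_Pow)
  \<comment> \<open>Enlarging the factor 2 of the last term to 6 completes the square of the sum of
    squares over \<open>insert x I\<close>.\<close>
  also have "\<dots> \<le> 2 * (3 * 2 ^ card I * (\<Sum>i\<in>I. (c i)\<^sup>2)\<^sup>2)
      + 12 * (c x)\<^sup>2 * (2 ^ card I * (\<Sum>i\<in>I. (c i)\<^sup>2)) + 6 * (2 ^ card I * (c x) ^ 4)"
    unfolding sum_signed_square[OF insert.hyps(1)]
    using insert.IH by (intro add_mono mult_left_mono order_refl) auto
  also have "\<dots> = 3 * 2 ^ card (insert x I) * (\<Sum>i\<in>insert x I. (c i)\<^sup>2)\<^sup>2"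
    using insert.hyps by (simp add: eval_nat_numeral algebra_simps)
  finally show ?case .
qed simp

text \<open>The pointwise bound \<open>v \<ge> 3/2 v\<^sup>2 - 1/2 v\<^sup>4\<close> for \<open>v \<ge> 0\<close>, scaled so that the second and
  fourth moments give the best constant, replaces the usual interpolation between moments.\<close>

lemma khintchine:
  assumes "finite I"
  shows "2 ^ card I * sqrt (\<Sum>i\<in>I. (c i)\<^sup>2) \<le> sqrt 3 * (\<Sum>A\<in>Pow I. \<bar>\<Sum>i\<in>I. sg A i * c i\<bar>)"
proof (cases "(\<Sum>i\<in>I. (c i)\<^sup>2) = 0")
  case True then show ?thesis by (simp add: sum_nonneg)
next
  case False
  define s where "s = sqrt (\<Sum>i\<in>I. (c i)\<^sup>2)"
  have s: "0 < s" using False sum_nonneg[of I "\<lambda>i. (c i)\<^sup>2"] by (simp add: s_def less_le)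
  have s2: "(\<Sum>i\<in>I. (c i)\<^sup>2) = s\<^sup>2" by (simp add: s_def sum_nonneg)
  define S where "S = (\<lambda>A. \<Sum>i\<in>I. sg A i * c i)"
  have pt: "3/2 * (v::real)\<^sup>2 - 1/2 * v ^ 4 \<le> v" if "0 \<le> v" for v
  proof -
    have "0 \<le> v * ((v - 1)\<^sup>2 * (v + 2))" using that by simp
    then show ?thesis by (simp add: eval_nat_numeral algebra_simps)
  qed
  have sq3: "sqrt 3 ^ 4 = 9" "(sqrt 3)\<^sup>2 = 3" by (simp_all add: power4_eq_xxxx)
  \<comment> \<open>The pointwise bound is applied to v = |S A| / (sqrt 3 * s). Over all signs v^2
    has average 1/3 and v^4 average at most 1/3, so v has average at least 3/2 * 1/3 - 1/2 * 1/3 =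
    1/3.\<close>
  have "(\<Sum>A\<in>Pow I. (S A)\<^sup>2 / (2 * s\<^sup>2) - S A ^ 4 / (18 * s ^ 4)) \<le> (\<Sum>A\<in>Pow I. \<bar>S A\<bar> / (sqrt 3 * s))"
  proof (rule sum_mono)
    fix A
    show "(S A)\<^sup>2 / (2 * s\<^sup>2) - S A ^ 4 / (18 * s ^ 4) \<le> \<bar>S A\<bar> / (sqrt 3 * s)"
      using pt[of "\<bar>S A\<bar> / (sqrt 3 * s)"] s by (simp add: power_divide power_mult_distrib sq3)
  qed
  also have "(\<Sum>A\<in>Pow I. (S A)\<^sup>2 / (2 * s\<^sup>2) - S A ^ 4 / (18 * s ^ 4))
      = (\<Sum>A\<in>Pow I. (S A)\<^sup>2) / (2 * s\<^sup>2) - (\<Sum>A\<in>Pow I. S A ^ 4) / (18 * s ^ 4)"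
    by (simp add: sum_subtractf sum_divide_distrib)
  finally have "2 ^ card I * s\<^sup>2 / (2 * s\<^sup>2) - (\<Sum>A\<in>Pow I. S A ^ 4) / (18 * s ^ 4)
      \<le> (\<Sum>A\<in>Pow I. \<bar>S A\<bar>) / (sqrt 3 * s)"
    unfolding S_def sum_signed_square[OF assms] s2 by (simp add: sum_divide_distrib)
  moreover have "(\<Sum>A\<in>Pow I. S A ^ 4) / (18 * s ^ 4) \<le> 3 * 2 ^ card I * (s\<^sup>2)\<^sup>2 / (18 * s ^ 4)"
    using sum_signed_fourth_le[OF assms, of c] s by (intro divide_right_mono) (auto simp: S_def s2)
  moreover have "3 * 2 ^ card I * (s\<^sup>2)\<^sup>2 / (18 * s ^ 4) = 2 ^ card I / 6" "2 ^ card I * s\<^sup>2 / (2 * s\<^sup>2) = 2 ^ card I / 2"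
    using s by (simp_all add: power2_eq_square power4_eq_xxxx)
  ultimately have "2 ^ card I / 3 \<le> (\<Sum>A\<in>Pow I. \<bar>S A\<bar>) / (sqrt 3 * s)" by linarith
  then have "2 ^ card I * s * sqrt 3 \<le> 3 * (\<Sum>A\<in>Pow I. \<bar>S A\<bar>)" using s by (simp add: field_simps)
  also have "3 * (\<Sum>A\<in>Pow I. \<bar>S A\<bar>) = sqrt 3 * (sqrt 3 * (\<Sum>A\<in>Pow I. \<bar>S A\<bar>))" by simp
  finally have "sqrt 3 * (2 ^ card I * s) \<le> sqrt 3 * (sqrt 3 * (\<Sum>A\<in>Pow I. \<bar>S A\<bar>))" by (simp add: mult_ac)
  then show ?thesis by (simp add: s_def S_def)
qed

text \<open>Khintchine's inequality for every k, after which the sum over k and the average over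
  signs change places and the uniform bound L applies.\<close>

lemma square_function_le:
  assumes "finite I" "\<And>k. k \<in> K \<Longrightarrow> 0 \<le> b k"
    and L: "\<And>A. A \<subseteq> I \<Longrightarrow> (\<Sum>k\<in>K. b k * \<bar>\<Sum>i\<in>I. sg A i * c k i\<bar>) \<le> L"
  shows "(\<Sum>k\<in>K. b k * sqrt (\<Sum>i\<in>I. (c k i)\<^sup>2)) \<le> sqrt 3 * L"
proof -
  have "2 ^ card I * (\<Sum>k\<in>K. b k * sqrt (\<Sum>i\<in>I. (c k i)\<^sup>2)) = (\<Sum>k\<in>K. b k * (2 ^ card I * sqrt (\<Sum>i\<in>I. (c k i)\<^sup>2)))"
    by (simp add: sum_distrib_left mult_ac)
  also have "\<dots> \<le> (\<Sum>k\<in>K. b k * (sqrt 3 * (\<Sum>A\<in>Pow I. \<bar>\<Sum>i\<in>I. sg A i * c k i\<bar>)))"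
    using assms(1,2) by (intro sum_mono mult_left_mono khintchine) auto
  also have "\<dots> = sqrt 3 * (\<Sum>A\<in>Pow I. \<Sum>k\<in>K. b k * \<bar>\<Sum>i\<in>I. sg A i * c k i\<bar>)"
    by (subst sum.swap) (simp add: sum_distrib_left mult_ac)
  also have "\<dots> \<le> sqrt 3 * (\<Sum>A\<in>Pow I. L)"
    using L by (intro mult_left_mono sum_mono) auto
  also have "\<dots> = 2 ^ card I * (sqrt 3 * L)" using assms(1) by (simp add: card_Pow)
  finally show ?thesis by simp
qed

lemma sum_mult_le_sqrt: "(\<Sum>i\<in>I. y i * z i) \<le> sqrt (\<Sum>i\<in>I. (y i)\<^sup>2) * sqrt (\<Sum>i\<in>I. (z i :: real)\<^sup>2)"
proof -
  have "(\<Sum>i\<in>I. y i * z i) \<le> sqrt ((\<Sum>i\<in>I. y i * z i)\<^sup>2)" by simp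
  also have "\<dots> \<le> sqrt ((\<Sum>i\<in>I. (y i)\<^sup>2) * (\<Sum>i\<in>I. (z i)\<^sup>2))"
    by (intro real_sqrt_le_mono Cauchy_Schwarz_ineq_sum)
  finally show ?thesis by (simp add: real_sqrt_mult)
qed

text \<open>The left side is the trace of a product. Cauchy-Schwarz over i for each j leaves the
  l1-norm of the square functions of y, and Khintchine bounds that norm by the worst choice of
  signs.\<close>

lemma trace_le:
  assumes "finite I"
    and L: "\<And>A. A \<subseteq> I \<Longrightarrow> (\<Sum>j\<in>J. \<bar>\<Sum>i\<in>I. sg A i * y i j\<bar>) \<le> \<alpha>"
    and \<beta>: "\<And>j. j \<in> J \<Longrightarrow> sqrt (\<Sum>i\<in>I. (z i j)\<^sup>2) \<le> \<beta>" and "0 \<le> \<beta>"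
  shows "(\<Sum>i\<in>I. \<Sum>j\<in>J. y i j * z i j) \<le> sqrt 3 * \<alpha> * \<beta>"
proof -
  have "(\<Sum>i\<in>I. \<Sum>j\<in>J. y i j * z i j) = (\<Sum>j\<in>J. \<Sum>i\<in>I. y i j * z i j)" by (rule sum.swap)
  also have "\<dots> \<le> (\<Sum>j\<in>J. sqrt (\<Sum>i\<in>I. (y i j)\<^sup>2) * \<beta>)"
    using \<beta> by (intro sum_mono order_trans[OF sum_mult_le_sqrt] mult_left_mono) (auto intro: sum_nonneg)
  also have "\<dots> = (\<Sum>j\<in>J. 1 * sqrt (\<Sum>i\<in>I. (y i j)\<^sup>2)) * \<beta>" by (simp add: sum_distrib_right)
  also have "\<dots> \<le> (sqrt 3 * \<alpha>) * \<beta>"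
    using L \<open>0 \<le> \<beta>\<close> by (intro mult_right_mono square_function_le[OF assms(1)]) auto
  finally show ?thesis .
qed

section \<open>Greedy bases of sums of finite-dimensional blocks\<close>

lemma sum_fun_apply: "(\<Sum>i\<in>A. g i) x = (\<Sum>i\<in>A. g i x)"
  by (induction A rule: infinite_finite_induct) auto

definition single :: "nat \<Rightarrow> (nat \<Rightarrow> real) \<Rightarrow> nat \<Rightarrow> nat \<Rightarrow> real" where
  "single n u = (\<lambda>m. if m = n then u else 0)"

lemma single_add: "single n (u + v) = single n u + single n v"
  by (auto simp: single_def fun_eq_iff)

lemma single_scale: "single n (c *\<^sub>R u) = c *\<^sub>R single n u"
  by (auto simp: single_def fun_eq_iff)

lemma single_sum: "single n (\<Sum>i\<in>A. g i) = (\<Sum>i\<in>A. single n (g i))"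
proof (induction A rule: infinite_finite_induct)
  case (insert x A) show ?case unfolding sum.insert[OF insert(1,2)] single_add insert(3) ..
qed (auto simp: single_def fun_eq_iff)

definition unit_vec :: "nat \<Rightarrow> nat \<Rightarrow> real" where
  "unit_vec i = (\<lambda>k. if k = i then 1 else 0)"

lemma ell_vec_eq_sum:
  assumes "u \<in> vecs (ell p (Suc n))"
  shows "u = (\<Sum>i\<le>n. u i *\<^sub>R unit_vec i)"
proof
  fix k
  have "(\<Sum>i\<le>n. u i *\<^sub>R unit_vec i) k = (\<Sum>i\<le>n. if i = k then u i else 0)"
    unfolding sum_fun_apply by (intro sum.cong) (auto simp: unit_vec_def)
  then show "u k = (\<Sum>i\<le>n. u i *\<^sub>R unit_vec i) k" using assms by (auto simp: ell_vecs)
qed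

text \<open>Common ground of the c0 and the l1 case: the blocks are included contractively and
  projected onto contractively.\<close>

locale block_greedy_basis = greedy_basis X e C for X :: "(nat \<Rightarrow> nat \<Rightarrow> real) nspace" and e C +
  fixes p :: ereal
  assumes p: "1 \<le> p"
    and block_mem: "x \<in> vecs X \<Longrightarrow> x n \<in> vecs (ell p (Suc n))"
    and block_le: "x \<in> vecs X \<Longrightarrow> nrm (ell p (Suc n)) (x n) \<le> nrm X x"
    and single_mem: "u \<in> vecs (ell p (Suc n)) \<Longrightarrow> single n u \<in> vecs X"
    and single_le: "u \<in> vecs (ell p (Suc n)) \<Longrightarrow> nrm X (single n u) \<le> nrm (ell p (Suc n)) u"
begin

abbreviation bn where "bn n u \<equiv> nrm (ell p (Suc n)) u"

lemma coord_le: "x \<in> vecs X \<Longrightarrow> i \<le> n \<Longrightarrow> \<bar>x n i\<bar> \<le> nrm X x"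
  using order_trans[OF ell_coord_le[OF p, of "Suc n" i "x n"] block_le[of x n]] by simp

lemma bn_le_of_coords:
  assumes "\<And>i. i \<le> n \<Longrightarrow> \<bar>u i\<bar> \<le> \<eta>"
  shows "bn n u \<le> real (Suc n) * \<eta>"
proof -
  have "bn n u \<le> (\<Sum>i<Suc n. \<bar>u i\<bar>)" by (rule ell_nrm_le_sum[OF p]) simp
  also have "\<dots> \<le> (\<Sum>i<Suc n. \<eta>)" using assms by (intro sum_mono) auto
  finally show ?thesis by simp
qed

text \<open>Only finitely many coordinates are involved, so infinitely many bounded vectors cannot all
  have different roundings.\<close>

lemma close_pair:
  assumes "0 < \<epsilon>" "finite F"
  obtains j k where "j \<noteq> k" "j \<notin> F" "k \<notin> F"
    "\<And>n i. n < N \<Longrightarrow> i \<le> n \<Longrightarrow> \<bar>e j n i - e k n i\<bar> \<le> \<epsilon>"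
proof -
  define P where "P = (SIGMA n:{..<N}. {..n})"
  define K where "K = C\<^sup>2 * nrm X (e 0)"
  define g where "g = (\<lambda>j. \<lambda>z\<in>P. \<lfloor>e j (fst z) (snd z) / \<epsilon>\<rfloor>)"
  have bd: "\<bar>e j n i\<bar> \<le> K" if "i \<le> n" for j n i
    using coord_le[OF e_mem that, of j] nrm_e_le[of j 0] by (simp add: K_def)
  have "g j \<in> (\<Pi>\<^sub>E z\<in>P. {\<lfloor>- K / \<epsilon>\<rfloor>..\<lfloor>K / \<epsilon>\<rfloor>})" for j
  proof (rule PiE_I)
    fix z assume z: "z \<in> P"
    then have "- K \<le> e j (fst z) (snd z)" "e j (fst z) (snd z) \<le> K"
      using bd[of "snd z" "fst z" j] by (auto simp: P_def abs_le_iff)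
    then have "(- K) / \<epsilon> \<le> e j (fst z) (snd z) / \<epsilon>" "e j (fst z) (snd z) / \<epsilon> \<le> K / \<epsilon>"
      using assms(1) by (intro divide_right_mono; simp)+
    then show "g j z \<in> {\<lfloor>- K / \<epsilon>\<rfloor>..\<lfloor>K / \<epsilon>\<rfloor>}"
      using z unfolding g_def by (simp add: floor_mono)
  qed (auto simp: g_def)
  then have "finite (g ` (- F))"
    by (intro finite_subset[of "g ` (- F)" "\<Pi>\<^sub>E z\<in>P. {\<lfloor>- K / \<epsilon>\<rfloor>..\<lfloor>K / \<epsilon>\<rfloor>}"] finite_PiE)
      (auto simp: P_def)
  moreover have "infinite (- F)" using assms(2) by simp
  ultimately have "\<not> inj_on g (- F)" using finite_imageD by blast
  then obtain j k where jk: "j \<notin> F" "k \<notin> F" "j \<noteq> k" "g j = g k" by (auto simp: inj_on_def)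
  show thesis
  proof (rule that[OF jk(3,1,2)])
    fix n i assume "n < N" "i \<le> n"
    then have "(n, i) \<in> P" by (simp add: P_def)
    with jk(4) have "\<lfloor>e j n i / \<epsilon>\<rfloor> = \<lfloor>e k n i / \<epsilon>\<rfloor>"
      unfolding g_def by (metis (mono_tags, lifting) fst_conv restrict_apply' snd_conv)
    then have "\<bar>e j n i / \<epsilon> - e k n i / \<epsilon>\<bar> \<le> 1" by linarith
    then have "\<bar>e j n i - e k n i\<bar> / \<epsilon> \<le> 1" using assms(1) by (simp add: diff_divide_distrib[symmetric] abs_divide)
    then show "\<bar>e j n i - e k n i\<bar> \<le> \<epsilon>" using assms(1) by simp
  qed
qed

lemma unit_vec_mem: "i \<le> n \<Longrightarrow> unit_vec i \<in> vecs (ell p (Suc n))"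
  by (simp add: ell_vecs unit_vec_def)

lemma biorth_single:
  assumes "u \<in> vecs (ell p (Suc n))"
  shows "f j (single n u) = (\<Sum>i\<le>n. u i * f j (single n (unit_vec i)))"
proof -
  have "f j (single n u) = f j (\<Sum>i\<le>n. u i *\<^sub>R single n (unit_vec i))"
    by (subst ell_vec_eq_sum[OF assms]) (simp add: single_sum single_scale)
  also have "\<dots> = (\<Sum>i\<le>n. f j (u i *\<^sub>R single n (unit_vec i)))"
    by (intro biorth_sum) (auto intro!: single_mem unit_vec_mem)
  also have "\<dots> = (\<Sum>i\<le>n. u i * f j (single n (unit_vec i)))"
    by (intro sum.cong refl biorth_scale) (auto intro!: single_mem unit_vec_mem)
  finally show ?thesis .
qed

text \<open>A common bound for all coefficient functionals: C comes from projecting onto one basis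
  vector, \<open>C^2\<close> from comparing its norm with that of \<open>e 0\<close>.\<close>

definition coef_const where "coef_const = C ^ 3 / nrm X (e 0)"

lemma coef_const_pos: "0 < coef_const"
  using C_ge_1 nrm_e_pos[of 0] by (simp add: coef_const_def)

lemma biorth_le: "x \<in> vecs X \<Longrightarrow> \<bar>f j x\<bar> \<le> coef_const * nrm X x"
proof -
  assume x: "x \<in> vecs X"
  have "\<bar>f j x\<bar> * nrm X (e 0) \<le> \<bar>f j x\<bar> * (C\<^sup>2 * nrm X (e j))"
    by (intro mult_left_mono nrm_e_le) auto
  also have "\<dots> \<le> C\<^sup>2 * (C * nrm X x)"
    using mult_left_mono[OF coefficient_bound[OF x, of j], of "C\<^sup>2"] by (simp add: mult_ac)
  finally show ?thesis using nrm_e_pos[of 0] by (simp add: coef_const_def field_simps eval_nat_numeral)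
qed

lemma biorth_single_le: "u \<in> vecs (ell p (Suc n)) \<Longrightarrow> \<bar>f j (single n u)\<bar> \<le> coef_const * bn n u"
  using order_trans[OF biorth_le[OF single_mem] mult_left_mono[OF single_le]] coef_const_pos by (simp add: less_imp_le)

text \<open>The functional is tested on the vector of its own coefficients on the n-th block. For
  its Euclidean norm s this yields s * s \<le> const * s.\<close>

lemma l2_biorth_le:
  "sqrt (\<Sum>i\<le>n. (f j (single n (unit_vec i)))\<^sup>2) \<le> coef_const * real (Suc n) powr (max 0 (invexp p - 1/2))"
proof -
  define y where "y = (\<lambda>i. if i \<le> n then f j (single n (unit_vec i)) else 0)"
  define s where "s = sqrt (\<Sum>i\<le>n. (f j (single n (unit_vec i)))\<^sup>2)"
  have y: "y \<in> vecs (ell p (Suc n))" by (simp add: y_def ell_vecs)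
  have "s * s = (\<Sum>i\<le>n. (f j (single n (unit_vec i)))\<^sup>2)" by (simp add: s_def sum_nonneg)
  also have "\<dots> = f j (single n y)" unfolding biorth_single[OF y] by (simp add: y_def power2_eq_square)
  also have "\<dots> \<le> coef_const * bn n y" using biorth_single_le[OF y, of j] by linarith
  also have "\<dots> \<le> coef_const * (real (Suc n) powr (max 0 (invexp p - 1/2)) * sqrt (\<Sum>i<Suc n. (y i)\<^sup>2))"
    using coef_const_pos by (intro mult_left_mono ell_nrm_le_l2[OF p]) auto
  also have "(\<Sum>i<Suc n. (y i)\<^sup>2) = (\<Sum>i\<le>n. (f j (single n (unit_vec i)))\<^sup>2)"
    unfolding lessThan_Suc_atMost by (intro sum.cong) (auto simp: y_def)
  also have "sqrt \<dots> = s" by (simp add: s_def)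
  finally have le: "s * s \<le> coef_const * real (Suc n) powr (max 0 (invexp p - 1/2)) * s" by (simp add: mult_ac)
  show ?thesis
  proof (cases "s = 0")
    case True then show ?thesis using coef_const_pos by (simp add: s_def[symmetric])
  next
    case False
    then have "0 < s" by (simp add: s_def sum_nonneg less_le)
    then show ?thesis using le unfolding s_def[symmetric] by (metis mult_right_le_imp_le)
  qed
qed

lemma coordinate_expansion:
  assumes "x \<in> vecs X" "i \<le> n"
  shows "(\<lambda>J. \<Sum>j<J. f j x * e j n i) \<longlonglongrightarrow> x n i"
proof (rule LIM_zero_cancel, rule tendsto_rabs_zero_cancel, rule tendsto_sandwich[of "\<lambda>_. 0"])
  show "(\<lambda>J. nrm X (x - (\<Sum>j<J. f j x *\<^sub>R e j))) \<longlonglongrightarrow> 0"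
    using expands_biorth[OF assms(1)] by (simp only: expands_def)
  show "\<forall>\<^sub>F J in sequentially. \<bar>(\<Sum>j<J. f j x * e j n i) - x n i\<bar> \<le> nrm X (x - (\<Sum>j<J. f j x *\<^sub>R e j))"
  proof (intro always_eventually allI)
    fix J
    have m: "x - (\<Sum>j<J. f j x *\<^sub>R e j) \<in> vecs X" using assms by (intro diff_combination_mem range_e)
    have "(x - (\<Sum>j<J. f j x *\<^sub>R e j)) n i = x n i - (\<Sum>j<J. f j x * e j n i)"
      by (simp add: sum_fun_apply)
    then show "\<bar>(\<Sum>j<J. f j x * e j n i) - x n i\<bar> \<le> nrm X (x - (\<Sum>j<J. f j x *\<^sub>R e j))"
      using coord_le[OF m assms(2)] by linarith
  qed
qed auto

text \<open>Expanding the unit vectors of the n-th block in the basis writes the trace of the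
  identity there, which is \<open>Suc n\<close>, as the limit of these double sums.\<close>

lemma dim_le_trace:
  assumes "\<And>J. (\<Sum>i\<le>n. \<Sum>j<J. f j (single n (unit_vec i)) * e j n i) \<le> B"
  shows "real (Suc n) \<le> B"
proof (rule LIMSEQ_le_const2)
  have "(\<lambda>J. \<Sum>i\<le>n. \<Sum>j<J. f j (single n (unit_vec i)) * e j n i) \<longlonglongrightarrow> (\<Sum>i\<le>n. single n (unit_vec i) n i)"
    by (intro tendsto_sum coordinate_expansion single_mem unit_vec_mem) auto
  also have "(\<Sum>i\<le>n. single n (unit_vec i) n i) = real (Suc n)"
    by (simp add: single_def unit_vec_def)
  finally show "(\<lambda>J. \<Sum>i\<le>n. \<Sum>j<J. f j (single n (unit_vec i)) * e j n i) \<longlonglongrightarrow> real (Suc n)" .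
qed (use assms in auto)

end

lemma powr_unbounded:
  assumes "\<gamma> < (1::real)"
  obtains n where "c * real (Suc n) powr \<gamma> < real (Suc n)"
proof -
  have "filterlim (\<lambda>x::real. x powr (1 - \<gamma>)) at_top at_top"
    using real_powr_at_top[of "1 - \<gamma>"] assms by simp
  then have "filterlim (\<lambda>n. real (Suc n) powr (1 - \<gamma>)) at_top sequentially"
    by (rule filterlim_compose) (rule filterlim_compose[OF filterlim_real_sequentially filterlim_Suc])
  then have "\<forall>\<^sub>F n in sequentially. c < real (Suc n) powr (1 - \<gamma>)"
    by (simp add: filterlim_at_top_dense)
  then obtain n where "c < real (Suc n) powr (1 - \<gamma>)" by (auto simp: eventually_sequentially)
  then have "c * real (Suc n) powr \<gamma> < real (Suc n) powr (1 - \<gamma>) * real (Suc n) powr \<gamma>"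
    by (intro mult_strict_right_mono) auto
  then show thesis using that by (simp add: powr_add[symmetric])
qed

section \<open>The case of \<open>c\<^sub>0\<close>-sums\<close>

lemma single_mem_blocks:
  assumes p: "1 \<le> p" and "u \<in> vecs (ell p (Suc n))"
  shows "single n u m \<in> vecs (ell p (Suc m))"
  using assms seminormed.zero_mem[OF seminormed_ell[OF p, of "Suc m"]] by (auto simp: single_def)

lemma block_single_zero: "1 \<le> p \<Longrightarrow> m \<noteq> n \<Longrightarrow> nrm (ell p (Suc m)) (single n u m) = 0"
  using seminormed.nrm_zero[OF seminormed_ell[of p "Suc m"]] by (simp add: single_def)

lemma single_same [simp]: "single n u n = u"
  by (simp add: single_def)

lemma (in seminormed) combination_mem:
  assumes "range e \<subseteq> vecs X"
  shows "(\<Sum>i\<in>A. s i *\<^sub>R e i) \<in> vecs X"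
  using assms by (intro sum_mem scale_mem) auto

lemma sum_extend_pair:
  fixes e :: "nat \<Rightarrow> 'a::real_vector"
  assumes "finite A" "j \<notin> A" "k \<notin> A" "j \<noteq> k"
  shows "(\<Sum>i\<in>insert j (insert k A). (s(j := 1, k := -1)) i *\<^sub>R e i) = (\<Sum>i\<in>A. s i *\<^sub>R e i) + (e j - e k)"
proof -
  have "(\<Sum>i\<in>A. (s(j := 1, k := -1)) i *\<^sub>R e i) = (\<Sum>i\<in>A. s i *\<^sub>R e i)"
    using assms by (intro sum.cong) auto
  then show ?thesis using assms by simp
qed

locale c0_greedy_basis = greedy_basis "c0_sum (\<lambda>n. ell p (Suc n))" e C for p :: ereal and e C +
  assumes p: "1 \<le> p"
begin

abbreviation X0 where "X0 \<equiv> c0_sum (\<lambda>n. ell p (Suc n))"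

sublocale block_greedy_basis X0 e C p
proof
  show "1 \<le> p" by (rule p)
  fix n u assume u: "u \<in> vecs (ell p (Suc n))"
  have "(\<lambda>m. nrm (ell p (Suc m)) (single n u m)) \<longlonglongrightarrow> 0"
  proof (rule tendsto_eventually, rule eventually_sequentiallyI[of "Suc n"])
    fix m assume "Suc n \<le> m"
    then show "nrm (ell p (Suc m)) (single n u m) = 0" by (intro block_single_zero p) auto
  qed
  then show "single n u \<in> vecs X0"
    using single_mem_blocks[OF p u] by (simp add: c0_sum_vecs)
  show "nrm X0 (single n u) \<le> nrm (ell p (Suc n)) u"
  proof (rule c0_sum_nrm_le)
    fix m show "nrm (ell p (Suc m)) (single n u m) \<le> nrm (ell p (Suc n)) u"
      using block_single_zero[OF p, of m n u] ell_nrm_nonneg[OF p, of "Suc n" u] by (cases "m = n") auto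
  qed
next
  fix x n assume "x \<in> vecs X0"
  then show "x n \<in> vecs (ell p (Suc n))" "nrm (ell p (Suc n)) (x n) \<le> nrm X0 x"
    using c0_sum_coord_le[of x "\<lambda>n. ell p (Suc n)" n] by (auto simp: c0_sum_vecs)
qed

text \<open>Gliding hump for a maximum norm: d is small before block N and v from N on, so in each
  block only one of them counts.\<close>

lemma nrm_add_le_max:
  assumes v: "v \<in> vecs X0" and d: "d \<in> vecs X0" and "0 < \<epsilon>" "nrm X0 v \<le> M" "nrm X0 d \<le> M"
    and "\<And>n. n < N \<Longrightarrow> bn n (d n) \<le> \<epsilon>" "\<And>n. N \<le> n \<Longrightarrow> bn n (v n) \<le> \<epsilon>"
  shows "nrm X0 (v + d) \<le> M + \<epsilon>"
proof (rule c0_sum_nrm_le)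
  fix n
  have "bn n ((v + d) n) \<le> bn n (v n) + bn n (d n)"
    using ell_nrm_triangle[OF p, of "Suc n" "v n" "d n"] by simp
  also have "\<dots> \<le> M + \<epsilon>"
  proof (cases "n < N")
    case True
    then show ?thesis using assms(6)[OF True] block_le[OF v, of n] assms(4) by linarith
  next
    case False
    then show ?thesis using assms(7)[of n] block_le[OF d, of n] assms(5) by linarith
  qed
  finally show "bn n ((v + d) n) \<le> M + \<epsilon>" .
qed

text \<open>Differences \<open>e j - e k\<close> of vectors that almost agree on the first N blocks
  are almost disjoint from the sum built so far, so that each one raises the norm by at most
  \<epsilon>. The starting bound is that of a single difference.\<close>

lemma exists_bounded_signed_sum:
  assumes "0 < \<epsilon>"
  shows "\<exists>A s. finite A \<and> card A = 2 * m \<and> (\<forall>i. \<bar>s i :: real\<bar> = 1) \<and>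
    nrm X0 (\<Sum>i\<in>A. s i *\<^sub>R e i) \<le> 2 * (C\<^sup>2 * nrm X0 (e 0)) + real m * \<epsilon>"
proof (induction m)
  case 0
  have "0 \<le> C\<^sup>2 * nrm X0 (e 0)" by simp
  then show ?case
    by (intro exI[of _ "{}"] exI[of _ "\<lambda>_. 1"]) (simp only: sum.empty nrm_zero, simp)
next
  case (Suc m)
  then obtain A s where A: "finite A" "card A = 2 * m" "\<forall>i. \<bar>s i :: real\<bar> = 1"
    "nrm X0 (\<Sum>i\<in>A. s i *\<^sub>R e i) \<le> 2 * (C\<^sup>2 * nrm X0 (e 0)) + real m * \<epsilon>" by blast
  define v where "v = (\<Sum>i\<in>A. s i *\<^sub>R e i)"
  have v: "v \<in> vecs X0" unfolding v_def by (intro combination_mem range_e)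
  have "(\<lambda>n. bn n (v n)) \<longlonglongrightarrow> 0" using v by (simp add: c0_sum_vecs)
  then have "\<forall>\<^sub>F n in sequentially. bn n (v n) < \<epsilon>" using assms by (rule order_tendstoD)
  then obtain N where N: "\<And>n. N \<le> n \<Longrightarrow> bn n (v n) < \<epsilon>" by (auto simp: eventually_sequentially)
  \<comment> \<open>A block before N has at most N coordinates, so with this tolerance its norm is
    at most \<epsilon>; the +1 keeps the denominator positive for N = 0.\<close>
  obtain j k where jk: "j \<noteq> k" "j \<notin> A" "k \<notin> A"
    "\<And>n i. n < N \<Longrightarrow> i \<le> n \<Longrightarrow> \<bar>e j n i - e k n i\<bar> \<le> \<epsilon> / (real N + 1)"
    using close_pair[of "\<epsilon> / (real N + 1)" A N] assms A(1) by auto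
  have d: "e j - e k \<in> vecs X0" by auto
  have "nrm X0 (v + (e j - e k)) \<le> (2 * (C\<^sup>2 * nrm X0 (e 0)) + real m * \<epsilon>) + \<epsilon>"
  proof (rule nrm_add_le_max[OF v d assms])
    show "nrm X0 v \<le> 2 * (C\<^sup>2 * nrm X0 (e 0)) + real m * \<epsilon>" using A(4) by (simp only: v_def)
    have "nrm X0 (e j - e k) \<le> 2 * (C\<^sup>2 * nrm X0 (e 0))"
      using triangle_diff[OF e_mem[of j] e_mem[of k]] nrm_e_le[of j 0] nrm_e_le[of k 0] by linarith
    moreover have "0 \<le> real m * \<epsilon>" using assms by simp
    ultimately show "nrm X0 (e j - e k) \<le> 2 * (C\<^sup>2 * nrm X0 (e 0)) + real m * \<epsilon>" by linarith
    fix n show "bn n (v n) \<le> \<epsilon>" if "N \<le> n" using N[OF that] by linarith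
    assume n: "n < N"
    have "bn n ((e j - e k) n) \<le> real (Suc n) * (\<epsilon> / (real N + 1))"
      using jk(4)[OF n] by (intro bn_le_of_coords) simp
    also have "\<dots> \<le> (real N + 1) * (\<epsilon> / (real N + 1))" using n assms by (intro mult_right_mono) auto
    finally show "bn n ((e j - e k) n) \<le> \<epsilon>" by simp
  qed
  moreover have "v + (e j - e k) = (\<Sum>i\<in>insert j (insert k A). (s(j := 1, k := -1)) i *\<^sub>R e i)"
    unfolding v_def using sum_extend_pair[OF A(1) jk(2,3,1), of s e] by simp
  moreover have "card (insert j (insert k A)) = 2 * Suc m" using A jk by simp
  moreover have "\<forall>i. \<bar>(s(j := 1, k := -1)) i\<bar> = 1" using A(3) by simp
  moreover have "(2 * (C\<^sup>2 * nrm X0 (e 0)) + real m * \<epsilon>) + \<epsilon> = 2 * (C\<^sup>2 * nrm X0 (e 0)) + real (Suc m) * \<epsilon>"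
    by (simp add: algebra_simps)
  ultimately show ?case using A(1)
    by (intro exI[of _ "insert j (insert k A)"] exI[of _ "s(j := 1, k := -1)"]) (simp only: finite_insert simp_thms)
qed

definition M where "M = C\<^sup>2 * (2 * (C\<^sup>2 * nrm X0 (e 0)) + 1)"

text \<open>One bounded signed sum with at least as many terms is enough, since democracy carries
  its bound over. This is the upper c0-estimate for the basis.\<close>

lemma bounded_sums:
  assumes "finite A" "\<And>i. i \<in> A \<Longrightarrow> \<bar>a i\<bar> \<le> 1"
  shows "nrm X0 (\<Sum>i\<in>A. a i *\<^sub>R e i) \<le> M"
proof -
  define m where "m = card A"
  \<comment> \<open>With this error per step all m steps together add at most 1.\<close>
  obtain B s where B: "finite B" "card B = 2 * m" "\<forall>i. \<bar>s i :: real\<bar> = 1"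
    "nrm X0 (\<Sum>i\<in>B. s i *\<^sub>R e i) \<le> 2 * (C\<^sup>2 * nrm X0 (e 0)) + real m * (1 / (real m + 1))"
    using exists_bounded_signed_sum[of "1 / (real m + 1)" m] by auto
  have "nrm X0 (\<Sum>i\<in>A. a i *\<^sub>R e i) \<le> C\<^sup>2 * nrm X0 (\<Sum>i\<in>B. s i *\<^sub>R e i)"
    using B assms by (intro democratic) (auto simp: m_def)
  also have "\<dots> \<le> C\<^sup>2 * (2 * (C\<^sup>2 * nrm X0 (e 0)) + real m * (1 / (real m + 1)))"
    using B(4) by (intro mult_left_mono) auto
  also have "\<dots> \<le> M" unfolding M_def by (intro mult_left_mono add_left_mono) (auto simp: field_simps)
  finally show ?thesis .
qed

text \<open>With t the signs of the inner sums, the left side becomes a pairing of signs with the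
  n-th block of w. The coefficients of w are at most 1 in absolute value, so
  \<open>bounded_sums\<close> applies.\<close>

lemma coordinate_sums_le:
  "(\<Sum>j<J. \<bar>\<Sum>i\<le>n. sg A i * e j n i\<bar>) \<le> real (Suc n) powr (1 - invexp p) * M"
proof -
  define t where "t = (\<lambda>j. sgn (\<Sum>i\<le>n. sg A i * e j n i))"
  define w where "w = (\<Sum>j<J. t j *\<^sub>R e j)"
  have w: "w \<in> vecs X0" unfolding w_def by (intro combination_mem range_e)
  have "(\<Sum>j<J. \<bar>\<Sum>i\<le>n. sg A i * e j n i\<bar>) = (\<Sum>j<J. t j * (\<Sum>i\<le>n. sg A i * e j n i))"
    by (simp add: t_def abs_sgn mult.commute)
  also have "\<dots> = (\<Sum>i\<le>n. \<Sum>j<J. sg A i * (t j * e j n i))"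
    unfolding sum_distrib_left by (subst sum.swap) (simp add: mult_ac)
  also have "\<dots> = (\<Sum>i\<le>n. sg A i * w n i)" by (simp add: w_def sum_fun_apply sum_distrib_left)
  also have "\<dots> \<le> (\<Sum>i\<le>n. \<bar>w n i\<bar>)"
    by (intro sum_mono) (auto simp: sg_def)
  also have "\<dots> \<le> real (Suc n) powr (1 - invexp p) * bn n (w n)"
    using sum_le_ell_nrm[OF p, of "Suc n" "w n"] by (simp add: lessThan_Suc_atMost)
  also have "\<dots> \<le> real (Suc n) powr (1 - invexp p) * M"
  proof (intro mult_left_mono)
    have "nrm X0 w \<le> M" unfolding w_def by (rule bounded_sums) (auto simp: t_def sgn_real_def)
    then show "bn n (w n) \<le> M" using block_le[OF w, of n] by linarith
  qed auto
  finally show ?thesis .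
qed

lemma not_finite_exponent: "p = \<infinity>"
proof (rule ccontr)
  assume "p \<noteq> \<infinity>"
  then have th: "0 < invexp p" using p by (cases p) auto
  \<comment> \<open>The total power of the dimension in the trace estimate, equal to max (1 - 1/p)
    (1/2).\<close>
  define \<gamma> where "\<gamma> = 1 - invexp p + max 0 (invexp p - 1/2)"
  have "\<gamma> < 1" using th by (auto simp: \<gamma>_def max_def)
  then obtain n where n: "sqrt 3 * M * coef_const * real (Suc n) powr \<gamma> < real (Suc n)" by (rule powr_unbounded)
  have "real (Suc n) \<le> sqrt 3 * (real (Suc n) powr (1 - invexp p) * M) * (coef_const * real (Suc n) powr (max 0 (invexp p - 1/2)))"
  proof (rule dim_le_trace)
    fix J
    have "(\<Sum>i\<le>n. \<Sum>j<J. e j n i * f j (single n (unit_vec i)))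
        \<le> sqrt 3 * (real (Suc n) powr (1 - invexp p) * M) * (coef_const * real (Suc n) powr (max 0 (invexp p - 1/2)))"
      using coef_const_pos by (intro trace_le coordinate_sums_le l2_biorth_le) auto
    then show "(\<Sum>i\<le>n. \<Sum>j<J. f j (single n (unit_vec i)) * e j n i)
        \<le> sqrt 3 * (real (Suc n) powr (1 - invexp p) * M) * (coef_const * real (Suc n) powr (max 0 (invexp p - 1/2)))"
      by (simp only: mult.commute)
  qed
  also have "\<dots> = sqrt 3 * M * coef_const * real (Suc n) powr \<gamma>" by (simp add: \<gamma>_def powr_add mult_ac)
  finally show False using n by linarith
qed

end

lemma c0_sum_no_greedy_basis:
  assumes "1 \<le> p" "p < \<infinity>"
  shows "\<not> has_greedy_basis (c0_sum (\<lambda>n. ell p (Suc n)))"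
proof
  assume "has_greedy_basis (c0_sum (\<lambda>n. ell p (Suc n)))"
  then obtain e C where g: "greedy_with C (c0_sum (\<lambda>n. ell p (Suc n))) e" unfolding has_greedy_basis_def by blast
  interpret c0_greedy_basis p e "max C 1"
    unfolding c0_greedy_basis_def c0_greedy_basis_axioms_def
    using greedy_basisI[OF seminormed_c0_sum[OF seminormed_ell[OF assms(1)]] g] assms(1) by simp
  show False using not_finite_exponent assms(2) by simp
qed

section \<open>The case of \<open>\<ell>\<^sub>1\<close>-sums\<close>

text \<open>The assumption says that the k-th largest term is at most R / k. The induction removes a
  smallest term, which is at most R / card A.\<close>

lemma sum_le_harm:
  fixes a :: "'b \<Rightarrow> real"
  assumes "finite A" "\<And>i. i \<in> A \<Longrightarrow> 0 \<le> a i"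
    and "\<And>B t. B \<subseteq> A \<Longrightarrow> (\<And>i. i \<in> B \<Longrightarrow> t \<le> a i) \<Longrightarrow> 0 < t \<Longrightarrow> real (card B) * t \<le> R" and "0 \<le> R"
  shows "(\<Sum>i\<in>A. a i) \<le> R * harm (card A)"
  using assms(1,2,3)
proof (induction "card A" arbitrary: A)
  case 0 then show ?case by (simp add: harm_def)
next
  case (Suc m)
  then have ne: "A \<noteq> {}" by auto
  define j where "j = arg_min_on a A"
  have j: "j \<in> A" "\<And>i. i \<in> A \<Longrightarrow> a j \<le> a i"
    using arg_min_if_finite[OF Suc.prems(1) ne, of a] unfolding j_def by (auto simp: not_less)
  have m: "card (A - {j}) = m" using Suc.hyps(2) j(1) Suc.prems(1) by simp
  have "(\<Sum>i\<in>A - {j}. a i) \<le> R * harm (card (A - {j}))"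
  proof (rule Suc.hyps(1))
    show "m = card (A - {j})" using m by simp
    show "finite (A - {j})" using Suc.prems(1) by simp
    show "0 \<le> a i" if "i \<in> A - {j}" for i using Suc.prems(2) that by simp
    show "real (card B) * t \<le> R" if "B \<subseteq> A - {j}" "\<And>i. i \<in> B \<Longrightarrow> t \<le> a i" "0 < t" for B t
      using that by (intro Suc.prems(3)) auto
  qed
  moreover have "a j \<le> R * inverse (real (Suc m))"
  proof (cases "a j > 0")
    case True
    have "real (card A) * a j \<le> R" by (rule Suc.prems(3)[OF subset_refl j(2) True])
    then show ?thesis using Suc.hyps(2)[symmetric] by (simp add: field_simps)
  next
    case False
    then have "a j \<le> 0" by simp
    also have "0 \<le> R * inverse (real (Suc m))" using assms(4) by simp
    finally show ?thesis .
  qed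
  moreover have "(\<Sum>i\<in>A. a i) = a j + (\<Sum>i\<in>A - {j}. a i)"
    using j(1) Suc.prems(1) by (simp add: sum.remove)
  ultimately show ?case unfolding m Suc.hyps(2)[symmetric] harm_Suc by (simp add: algebra_simps)
qed

lemma harm_Suc_le: "harm (Suc k) \<le> 1 + ln (real (Suc k))"
proof (induction k)
  case (Suc k)
  have "ln (real (Suc k) / real (Suc (Suc k))) \<le> real (Suc k) / real (Suc (Suc k)) - 1"
    by (rule ln_le_minus_one) simp
  also have "\<dots> = - inverse (real (Suc (Suc k)))" by (simp add: field_simps)
  finally have "inverse (real (Suc (Suc k))) \<le> ln (real (Suc (Suc k))) - ln (real (Suc k))"
    by (simp add: ln_div)
  then show ?case unfolding harm_Suc[of "Suc k"] using Suc.IH by linarith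
qed (simp add: harm_def)

lemma harm_le_ln_Suc: "harm m \<le> 1 + ln (real (Suc m))"
proof (cases m)
  case (Suc k)
  then show ?thesis using harm_Suc_le[of k] by (simp add: order_trans)
qed (simp add: harm_def)

text \<open>Turns an implicit inequality for a cardinality into a bound that depends only on K and
  \<gamma>, in particular not on the block.\<close>

lemma log_power_bound:
  assumes "\<gamma> < (1::real)"
  obtains M where "\<And>m::nat. real m \<le> K * (1 + ln (real (Suc m))) * real m powr \<gamma> \<Longrightarrow> m \<le> M"
proof -
  have "((\<lambda>x::real. (1 + ln (x + 1)) * x powr (\<gamma> - 1)) \<longlongrightarrow> 0) at_top"
    using assms by real_asymp
  then have "((\<lambda>n. K * ((1 + ln (real n + 1)) * real n powr (\<gamma> - 1))) \<longlongrightarrow> K * 0) sequentially"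
    by (intro tendsto_mult_left filterlim_compose[OF _ filterlim_real_sequentially])
  then have "\<forall>\<^sub>F n in sequentially. K * ((1 + ln (real n + 1)) * real n powr (\<gamma> - 1)) < 1"
    by (rule order_tendstoD) simp
  then obtain M where M: "\<And>m. M \<le> m \<Longrightarrow> K * ((1 + ln (real m + 1)) * real m powr (\<gamma> - 1)) < 1"
    by (auto simp: eventually_sequentially)
  show thesis
  proof (rule that[of M], rule ccontr)
    fix m :: nat
    assume le: "real m \<le> K * (1 + ln (real (Suc m))) * real m powr \<gamma>" and "\<not> m \<le> M"
    then have m: "0 < m" "M \<le> m" by auto
    have "real m * (K * ((1 + ln (real m + 1)) * real m powr (\<gamma> - 1))) < real m * 1"
      using M[OF m(2)] m(1) by (intro mult_strict_left_mono) auto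
    moreover have "real m * real m powr (\<gamma> - 1) = real m powr \<gamma>" using m(1) by (simp add: powr_diff)
    then have "real m * (K * ((1 + ln (real m + 1)) * real m powr (\<gamma> - 1))) = K * (1 + ln (real (Suc m))) * real m powr \<gamma>"
      by (metis Suc_eq_plus1 mult.assoc mult.commute of_nat_Suc add.commute)
    ultimately show False using le by simp
  qed
qed

text \<open>The r-convexity of the p-norm for r \<le> p: taking r-th powers of the coordinates turns
  it into the triangle inequality for the exponent p / r.\<close>

lemma ell_nrm_convex_le:
  assumes p: "1 \<le> p" and n: "0 < n" and r: "1 \<le> r" "invexp p \<le> 1 / r" and A: "finite A"
    and u: "\<And>j. j \<in> A \<Longrightarrow> nrm (ell p n) (u j) \<le> 1"
  shows "nrm (ell p n) (\<lambda>i. (\<Sum>j\<in>A. \<bar>u j i\<bar> powr r) powr (1/r)) \<le> real (card A) powr (1/r)"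
  using p
proof (cases rule: exponent_cases)
  case 1
  have "(\<Sum>j\<in>A. \<bar>u j i\<bar> powr r) powr (1/r) \<le> real (card A) powr (1/r)" if "i < n" for i
  proof -
    have "\<bar>u j i\<bar> \<le> 1" if "j \<in> A" for j using ell_coord_le[OF p n \<open>i < n\<close>, of "u j"] u[OF that] by linarith
    then have "(\<Sum>j\<in>A. \<bar>u j i\<bar> powr r) \<le> (\<Sum>j\<in>A. 1)" using r by (intro sum_mono powr_le1) auto
    then show ?thesis using r by (intro powr_mono2) (auto intro: sum_nonneg)
  qed
  then show ?thesis unfolding 1 nrm_ell_infinity using n by (simp add: Max_lessThan_le_iff)
next
  case (2 s)
  define t where "t = s / r"
  have rs: "r \<le> s" using 2 r by (simp add: field_simps)
  then have t: "1 \<le> t" "1 \<le> ereal t" using r by (auto simp: t_def)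
  interpret T: seminormed "ell (ereal t) n" by (rule seminormed_ell[OF t(2) n])
  define w where "w = (\<lambda>j i. if i < n then \<bar>u j i\<bar> powr r else 0)"
  have w: "w j \<in> vecs (ell (ereal t) n)" for j by (simp add: w_def ell_vecs)
  have wn: "nrm (ell (ereal t) n) (w j) \<le> 1" if "j \<in> A" for j
  proof -
    have "nrm (ell (ereal t) n) (w j) = (\<Sum>i<n. \<bar>u j i\<bar> powr s) powr (r / s)"
      using r rs by (simp add: nrm_ell_real w_def t_def powr_powr)
    also have "\<dots> = (nrm (ell p n) (u j)) powr r" using r rs by (simp add: 2 nrm_ell_real powr_powr)
    also have "\<dots> \<le> 1" using u[OF that] ell_nrm_nonneg[OF p n] r by (intro powr_le1) auto
    finally show ?thesis .
  qed
  have "nrm (ell p n) (\<lambda>i. (\<Sum>j\<in>A. \<bar>u j i\<bar> powr r) powr (1/r)) = (\<Sum>i<n. (\<Sum>j\<in>A. \<bar>u j i\<bar> powr r) powr t) powr (1 / s)"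
    using r rs by (simp add: 2 nrm_ell_real powr_powr t_def)
  also have "\<dots> = (nrm (ell (ereal t) n) (\<Sum>j\<in>A. w j)) powr (1 / r)"
  proof -
    have "(\<Sum>i<n. (\<Sum>j\<in>A. \<bar>u j i\<bar> powr r) powr t) = (\<Sum>i<n. \<bar>(\<Sum>j\<in>A. w j) i\<bar> powr t)"
      by (intro sum.cong) (auto simp: sum_fun_apply w_def sum_nonneg)
    then show ?thesis using r rs by (simp add: nrm_ell_real powr_powr t_def)
  qed
  also have "\<dots> \<le> (real (card A)) powr (1 / r)"
  proof (intro powr_mono2)
    have "nrm (ell (ereal t) n) (\<Sum>j\<in>A. w j) \<le> (\<Sum>j\<in>A. nrm (ell (ereal t) n) (w j))"
      by (rule T.nrm_sum_le[OF w])
    also have "\<dots> \<le> (\<Sum>j\<in>A. 1)" using wn by (rule sum_mono)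
    finally show "nrm (ell (ereal t) n) (\<Sum>j\<in>A. w j) \<le> real (card A)" by simp
    show "0 \<le> nrm (ell (ereal t) n) (\<Sum>j\<in>A. w j)" using w by (intro T.nonneg T.sum_mem)
  qed (use r in auto)
  finally show ?thesis .
qed

text \<open>Signs that differ only at k are paired: the two sums differ by twice \<open>x k\<close>,
  so one of them is at least as large as \<open>x k\<close>.\<close>

lemma (in seminormed) nrm_le_signed_average:
  assumes "finite J" "k \<in> J" "\<And>j. j \<in> J \<Longrightarrow> x j \<in> vecs X"
  shows "2 ^ card J * nrm X (x k) \<le> (\<Sum>S\<in>Pow J. nrm X (\<Sum>j\<in>J. sg S j *\<^sub>R x j))"
proof -
  define J' where "J' = J - {k}"
  have J: "J = insert k J'" "k \<notin> J'" "finite J'" using assms by (auto simp: J'_def)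
  have "2 * nrm X (x k) \<le> nrm X (\<Sum>j\<in>J. sg S j *\<^sub>R x j) + nrm X (\<Sum>j\<in>J. sg (insert k S) j *\<^sub>R x j)" if "S \<in> Pow J'" for S
  proof -
    define v where "v = (\<Sum>j\<in>J'. sg S j *\<^sub>R x j)"
    have v: "v \<in> vecs X" unfolding v_def using assms J by (intro sum_mem scale_mem) auto
    have xk: "x k \<in> vecs X" using assms by simp
    have kS: "k \<notin> S" using that J by auto
    have 1: "(\<Sum>j\<in>J. sg S j *\<^sub>R x j) = v - x k" unfolding v_def J(1) using J(2,3) kS by (simp add: sg_def)
    have "(\<Sum>j\<in>J'. sg (insert k S) j *\<^sub>R x j) = v"
      unfolding v_def by (intro sum.cong) (use J(2) in \<open>auto simp: sg_def\<close>)
    then have 2: "(\<Sum>j\<in>J. sg (insert k S) j *\<^sub>R x j) = v + x k" unfolding J(1) using J(2,3) by (simp add: sg_def)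
    have "nrm X (2 *\<^sub>R x k) = nrm X ((v + x k) - (v - x k))" by (simp add: scaleR_2)
    also have "\<dots> \<le> nrm X (v + x k) + nrm X (v - x k)" using v xk by (intro triangle_diff) auto
    finally show ?thesis unfolding 1 2 using xk by simp
  qed
  then have "(\<Sum>S\<in>Pow J'. 2 * nrm X (x k)) \<le> (\<Sum>S\<in>Pow J'. nrm X (\<Sum>j\<in>J. sg S j *\<^sub>R x j) + nrm X (\<Sum>j\<in>J. sg (insert k S) j *\<^sub>R x j))"
    by (rule sum_mono)
  also have "\<dots> = (\<Sum>S\<in>Pow (insert k J'). nrm X (\<Sum>j\<in>J. sg S j *\<^sub>R x j))"
    by (rule sum_Pow_insert[OF J(3,2), symmetric])
  finally show ?thesis using J by (simp add: card_Pow)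
qed

locale l1_greedy_basis = greedy_basis "ell_sum 1 (\<lambda>n. ell p (Suc n))" e C for p :: ereal and e C +
  assumes p: "1 \<le> p"
begin

abbreviation X1 where "X1 \<equiv> ell_sum 1 (\<lambda>n. ell p (Suc n))"

lemma summable_blocks: "x \<in> vecs X1 \<Longrightarrow> summable (\<lambda>n. nrm (ell p (Suc n)) (x n))"
  using ell_nrm_nonneg[OF p] by (simp add: ell_sum_vecs)

lemma nrm_eq_suminf: "x \<in> vecs X1 \<Longrightarrow> nrm X1 x = (\<Sum>n. nrm (ell p (Suc n)) (x n))"
  using suminf_nonneg[OF summable_blocks[of x]] ell_nrm_nonneg[OF p] by (simp add: ell_sum_nrm)

sublocale block_greedy_basis X1 e C p
proof
  show "1 \<le> p" by (rule p)
  fix n u assume u: "u \<in> vecs (ell p (Suc n))"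
  have mem: "single n u m \<in> vecs (ell p (Suc m))" for m by (rule single_mem_blocks[OF p u])
  have nn: "0 \<le> nrm (ell p (Suc n)) u" by (rule ell_nrm_nonneg[OF p]) simp
  have "(\<Sum>m<N. nrm (ell p (Suc m)) (single n u m) powr 1) \<le> nrm (ell p (Suc n)) u powr 1" for N
  proof -
    have "(\<Sum>m<N. nrm (ell p (Suc m)) (single n u m) powr 1) = (\<Sum>m<N. if m = n then nrm (ell p (Suc n)) u else 0)"
    proof (rule sum.cong)
      fix m show "nrm (ell p (Suc m)) (single n u m) powr 1 = (if m = n then nrm (ell p (Suc n)) u else 0)"
        using block_single_zero[OF p, of m n u] nn by (cases "m = n") auto
    qed simp
    also have "\<dots> \<le> nrm (ell p (Suc n)) u powr 1" using nn by simp
    finally show ?thesis .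
  qed
  from ell_sum_boundI[OF zero_less_one mem nn this]
  show "single n u \<in> vecs X1" "nrm X1 (single n u) \<le> nrm (ell p (Suc n)) u" .
next
  fix x n assume x: "x \<in> vecs X1"
  then show "x n \<in> vecs (ell p (Suc n))" by (simp add: ell_sum_vecs)
  show "nrm (ell p (Suc n)) (x n) \<le> nrm X1 x"
    by (rule ell_sum_coord_le[OF zero_less_one x seminormed_ell[OF p]]) simp
qed

section \<open>Gliding humps for the l1-norm and weak l1-estimates\<close>

lemma nrm_split: "x \<in> vecs X1 \<Longrightarrow> nrm X1 x = (\<Sum>n<N. bn n (x n)) + (\<Sum>n. bn (n + N) (x (n + N)))"
  using suminf_split_initial_segment[OF summable_blocks, of x N] by (simp add: nrm_eq_suminf)

lemma head_le: "x \<in> vecs X1 \<Longrightarrow> (\<Sum>n<N. bn n (x n)) \<le> nrm X1 x"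
  unfolding nrm_eq_suminf by (rule sum_le_suminf[OF summable_blocks]) (auto intro: ell_Suc_nrm_nonneg[OF p])

lemma summable_tail: "x \<in> vecs X1 \<Longrightarrow> summable (\<lambda>n. bn (n + N) (x (n + N)))"
  by (rule summable_ignore_initial_segment[OF summable_blocks])

lemma tail_small:
  assumes "x \<in> vecs X1" "0 < \<epsilon>"
  obtains N where "(\<Sum>n. bn (n + N) (x (n + N))) < \<epsilon>"
proof -
  obtain N where "norm (\<Sum>n. bn (n + N) (x (n + N))) < \<epsilon>"
    using suminf_exist_split[OF assms(2) summable_blocks[OF assms(1)]] by blast
  then show thesis by (intro that[of N]) simp
qed

text \<open>The l1-counterpart of a gliding hump: the norm is additive up to the head of d and the
  tail of v, each of which is lost twice.\<close>

lemma nrm_add_ge: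
  assumes v: "v \<in> vecs X1" and d: "d \<in> vecs X1"
    and "(\<Sum>n<N. bn n (d n)) \<le> \<epsilon>" "(\<Sum>n. bn (n + N) (v (n + N))) \<le> \<epsilon>"
  shows "nrm X1 v + nrm X1 d - 4 * \<epsilon> \<le> nrm X1 (v + d)"
proof -
  have tri: "bn n (x n) - bn n (y n) \<le> bn n ((x + y) n)" if "x \<in> vecs X1" "y \<in> vecs X1" for x y n
  proof -
    interpret B: seminormed "ell p (Suc n)" by (rule seminormed_ell[OF p]) simp
    show ?thesis using B.reverse_triangle[OF block_mem[OF that(1), of n] block_mem[OF that(2), of n]] by simp
  qed
  have vd: "v + d \<in> vecs X1" using v d by auto
  have tri2: "bn n (d n) - bn n (v n) \<le> bn n ((v + d) n)" for n
    using tri[OF d v, of n] by (simp only: add.commute)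
  have "(\<Sum>n<N. bn n (v n)) - (\<Sum>n<N. bn n (d n)) \<le> (\<Sum>n<N. bn n ((v + d) n))"
    unfolding sum_subtractf[symmetric] using tri[OF v d] by (rule sum_mono)
  moreover have "(\<Sum>n. bn (n + N) (d (n + N))) - (\<Sum>n. bn (n + N) (v (n + N))) \<le> (\<Sum>n. bn (n + N) ((v + d) (n + N)))"
    unfolding suminf_diff[OF summable_tail[OF d] summable_tail[OF v]]
    by (rule suminf_le[OF tri2 summable_diff[OF summable_tail[OF d] summable_tail[OF v]] summable_tail[OF vd]])
  ultimately show ?thesis
    using nrm_split[OF v, of N] nrm_split[OF d, of N] nrm_split[OF vd, of N] assms(3,4) by linarith
qed

text \<open>Separation of the basis vectors: one factor C comes from suppression, \<open>C^2\<close>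
  from comparing the norms of basis vectors.\<close>

definition \<delta> where "\<delta> = nrm X1 (e 0) / C ^ 3"

lemma \<delta>_pos: "0 < \<delta>"
  using nrm_e_pos[of 0] C_ge_1 by (simp add: \<delta>_def)

lemma nrm_diff_ge:
  assumes "j \<noteq> k" shows "\<delta> \<le> nrm X1 (e j - e k)"
proof -
  have "nrm X1 (e j) \<le> C * nrm X1 (e j - e k)"
    using suppression[of "{j, k}" "{j}" "\<lambda>i. if i = j then 1 else -1"] assms by auto
  then have "C\<^sup>2 * nrm X1 (e j) \<le> C\<^sup>2 * (C * nrm X1 (e j - e k))" by (intro mult_left_mono) auto
  then have "nrm X1 (e 0) \<le> C\<^sup>2 * (C * nrm X1 (e j - e k))" using nrm_e_le[of 0 j] by linarith
  then show ?thesis using C_ge_1 by (simp add: \<delta>_def field_simps eval_nat_numeral)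
qed

lemma exists_large_signed_sum:
  "\<exists>A s. finite A \<and> card A = 2 * m \<and> (\<forall>i. \<bar>s i :: real\<bar> = 1) \<and>
    real m * (\<delta> / 2) \<le> nrm X1 (\<Sum>i\<in>A. s i *\<^sub>R e i)"
proof (induction m)
  case 0
  show ?case by (intro exI[of _ "{}"] exI[of _ "\<lambda>_. 1"]) (simp only: sum.empty nrm_zero, simp)
next
  case (Suc m)
  then obtain A s where A: "finite A" "card A = 2 * m" "\<forall>i. \<bar>s i :: real\<bar> = 1"
    "real m * (\<delta> / 2) \<le> nrm X1 (\<Sum>i\<in>A. s i *\<^sub>R e i)" by blast
  define v where "v = (\<Sum>i\<in>A. s i *\<^sub>R e i)"
  have v: "v \<in> vecs X1" unfolding v_def by (intro combination_mem range_e)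
  \<comment> \<open>A new difference has norm at least \<delta>, and \<open>nrm_add_ge\<close> loses
    four times \<delta> / 8, which leaves the gain \<delta> / 2.\<close>
  have d8: "0 < \<delta> / 8" using \<delta>_pos by simp
  obtain N where N: "(\<Sum>n. bn (n + N) (v (n + N))) < \<delta> / 8" using tail_small[OF v d8] .
  \<comment> \<open>There are N blocks before N, each with at most N coordinates, so the head of the
    difference has norm at most \<delta> / 8.\<close>
  define \<eta> where "\<eta> = \<delta> / 8 / ((real N + 1) * (real N + 1))"
  have \<eta>: "0 < \<eta>" using d8 by (simp add: \<eta>_def)
  obtain j k where jk: "j \<noteq> k" "j \<notin> A" "k \<notin> A"
    "\<And>n i. n < N \<Longrightarrow> i \<le> n \<Longrightarrow> \<bar>e j n i - e k n i\<bar> \<le> \<eta>"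
    using close_pair[OF \<eta> A(1), of N] by blast
  have d: "e j - e k \<in> vecs X1" by auto
  have "(\<Sum>n<N. bn n ((e j - e k) n)) \<le> (\<Sum>n<N. (real N + 1) * \<eta>)"
  proof (rule sum_mono)
    fix n assume n: "n \<in> {..<N}"
    have "bn n ((e j - e k) n) \<le> real (Suc n) * \<eta>"
      using jk(4)[of n] n by (intro bn_le_of_coords) simp
    also have "\<dots> \<le> (real N + 1) * \<eta>" using n \<eta> by (intro mult_right_mono) auto
    finally show "bn n ((e j - e k) n) \<le> (real N + 1) * \<eta>" .
  qed
  also have "\<dots> = real N * ((real N + 1) * \<eta>)" by simp
  also have "\<dots> \<le> (real N + 1) * ((real N + 1) * \<eta>)" using \<eta> by (intro mult_right_mono) auto
  also have "\<dots> = \<delta> / 8"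
  proof -
    have "a * (a * (\<delta> / 8 / (a * a))) = \<delta> / 8" if "a \<noteq> 0" for a using that by simp
    moreover have "real N + 1 \<noteq> 0" by linarith
    ultimately show ?thesis unfolding \<eta>_def by blast
  qed
  finally have "nrm X1 v + nrm X1 (e j - e k) - 4 * (\<delta> / 8) \<le> nrm X1 (v + (e j - e k))"
    using N by (intro nrm_add_ge[OF v d]) auto
  then have "real (Suc m) * (\<delta> / 2) \<le> nrm X1 (v + (e j - e k))"
    using nrm_diff_ge[OF jk(1)] A(4) unfolding v_def[symmetric] by (simp add: algebra_simps)
  moreover have "v + (e j - e k) = (\<Sum>i\<in>insert j (insert k A). (s(j := 1, k := -1)) i *\<^sub>R e i)"
    unfolding v_def using sum_extend_pair[OF A(1) jk(2,3,1), of s e] by simp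
  moreover have "card (insert j (insert k A)) = 2 * Suc m" using A jk by simp
  moreover have "\<forall>i. \<bar>(s(j := 1, k := -1)) i\<bar> = 1" using A(3) by simp
  ultimately show ?case using A(1)
    by (intro exI[of _ "insert j (insert k A)"] exI[of _ "s(j := 1, k := -1)"]) (simp only: finite_insert simp_thms)
qed

text \<open>The first term accounts for the pairs of \<open>exists_large_signed_sum\<close>, the
  second for the index left over when the cardinality is odd.\<close>

definition weak_const where "weak_const = 4 * C\<^sup>2 / \<delta> + C\<^sup>2 / nrm X1 (e 0)"

lemma weak_const_pos: "0 < weak_const"
  using \<delta>_pos C_ge_1 nrm_e_pos[of 0] by (simp add: weak_const_def add_pos_pos)

lemma weak_l1_lower_bound_1:
  assumes "finite A" "\<And>i. i \<in> A \<Longrightarrow> 1 \<le> \<bar>a i\<bar>"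
  shows "real (card A) \<le> weak_const * nrm X1 (\<Sum>i\<in>A. a i *\<^sub>R e i)"
proof (cases "A = {}")
  case True
  then show ?thesis by (simp only: sum.empty nrm_zero, simp)
next
  case False
  define R where "R = nrm X1 (\<Sum>i\<in>A. a i *\<^sub>R e i)"
  have c: "1 \<le> card A" using False assms(1) by (simp add: Suc_le_eq card_gt_0_iff)
  define m where "m = card A div 2"
  obtain B s where B: "finite B" "card B = 2 * m" "\<forall>i. \<bar>s i :: real\<bar> = 1"
    "real m * (\<delta> / 2) \<le> nrm X1 (\<Sum>i\<in>B. s i *\<^sub>R e i)"
    using exists_large_signed_sum[of m] by blast
  have "nrm X1 (\<Sum>i\<in>B. s i *\<^sub>R e i) \<le> C\<^sup>2 * R"
    unfolding R_def using B assms by (intro democratic) (auto simp: m_def)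
  then have "real m * (\<delta> / 2) \<le> C\<^sup>2 * R" using B(4) by linarith
  then have 1: "2 * real m \<le> 4 * C\<^sup>2 / \<delta> * R" using \<delta>_pos by (simp add: field_simps)
  have "nrm X1 (\<Sum>i\<in>{0}. 1 *\<^sub>R e i) \<le> C\<^sup>2 * R"
    unfolding R_def using assms c by (intro democratic) auto
  then have 2: "1 \<le> C\<^sup>2 / nrm X1 (e 0) * R" using nrm_e_pos[of 0] by (simp add: field_simps)
  have "real (card A) \<le> 2 * real m + 1" unfolding m_def by linarith
  also have "\<dots> \<le> weak_const * R" using 1 2 by (simp add: weak_const_def algebra_simps)
  finally show ?thesis by (simp only: R_def)
qed

lemma weak_l1_lower_bound:
  assumes "finite A" "0 < t" "\<And>i. i \<in> A \<Longrightarrow> t \<le> \<bar>a i\<bar>"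
  shows "real (card A) * t \<le> weak_const * nrm X1 (\<Sum>i\<in>A. a i *\<^sub>R e i)"
proof -
  have m: "(\<Sum>i\<in>A. a i *\<^sub>R e i) \<in> vecs X1" by (intro combination_mem range_e)
  have "real (card A) \<le> weak_const * nrm X1 (\<Sum>i\<in>A. (a i / t) *\<^sub>R e i)"
    using assms by (intro weak_l1_lower_bound_1) (auto simp: abs_divide)
  also have "(\<Sum>i\<in>A. (a i / t) *\<^sub>R e i) = (1 / t) *\<^sub>R (\<Sum>i\<in>A. a i *\<^sub>R e i)"
    by (simp add: scaleR_sum_right)
  also have "weak_const * nrm X1 \<dots> = weak_const * nrm X1 (\<Sum>i\<in>A. a i *\<^sub>R e i) / t"
    unfolding scale[OF m] using assms(2) by simp
  finally show ?thesis using assms(2) by (simp add: field_simps)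
qed

text \<open>The lower bound for level sets puts the coefficients of x in weak l1, and summing a weak
  l1-sequence costs a harmonic number.\<close>

lemma sum_biorth_le_log:
  assumes "finite A" "x \<in> vecs X1"
  shows "(\<Sum>j\<in>A. \<bar>f j x\<bar>) \<le> weak_const * C * nrm X1 x * (1 + ln (real (Suc (card A))))"
proof -
  have R: "0 \<le> weak_const * C * nrm X1 x" using weak_const_pos C_ge_1 assms by simp
  have "(\<Sum>j\<in>A. \<bar>f j x\<bar>) \<le> (weak_const * C * nrm X1 x) * harm (card A)"
  proof (rule sum_le_harm[OF assms(1) _ _ R])
    fix B t assume B: "B \<subseteq> A" "\<And>i. i \<in> B \<Longrightarrow> t \<le> \<bar>f i x\<bar>" "0 < t"
    then have fB: "finite B" using assms(1) finite_subset by blast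
    have "real (card B) * t \<le> weak_const * nrm X1 (\<Sum>i\<in>B. f i x *\<^sub>R e i)"
      by (rule weak_l1_lower_bound[OF fB B(3,2)])
    also have "\<dots> \<le> weak_const * (C * nrm X1 x)"
      using projection_bound[OF fB assms(2)] weak_const_pos by (intro mult_left_mono) auto
    finally show "real (card B) * t \<le> weak_const * C * nrm X1 x" by (simp add: mult_ac)
  qed auto
  also have "\<dots> \<le> weak_const * C * nrm X1 x * (1 + ln (real (Suc (card A))))"
    using R harm_le_ln_Suc by (intro mult_left_mono) auto
  finally show ?thesis .
qed

end

section \<open>Counting the basis vectors that live on one block\<close>

context l1_greedy_basis
begin

definition \<kappa> where "\<kappa> = C\<^sup>2 * nrm X1 (e 0)"

lemma \<kappa>_pos: "0 < \<kappa>"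
  using C_ge_1 nrm_e_pos[of 0] by (simp add: \<kappa>_def)

lemma nrm_e_le_\<kappa>: "nrm X1 (e j) \<le> \<kappa>"
  unfolding \<kappa>_def by (rule nrm_e_le)

text \<open>The basis vectors for which the \<open>n\<close>-th block carries a fair share of \<open>f j (e j) = 1\<close>.\<close>

definition heavy where "heavy n = {j. bn n (e j n) < 2 * \<kappa> * \<bar>f j (single n (e j n))\<bar>}"

text \<open>For fixed signs S the weighted sum is attained at a vector x that is b with suitable
  signs. It is a signed sum of basis coefficients of \<open>single n x\<close>, which is logarithmic
  by \<open>sum_biorth_le_log\<close>.\<close>

lemma heavy_square_function:
  assumes A: "finite A" and b: "\<And>i. i \<le> n \<Longrightarrow> 0 \<le> b i"
  shows "(\<Sum>i\<le>n. b i * sqrt (\<Sum>j\<in>A. (f j (single n (unit_vec i)))\<^sup>2))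
    \<le> sqrt 3 * (weak_const * C * bn n b * (1 + ln (real (Suc (card A)))))"
proof (rule square_function_le[OF A])
  show "0 \<le> b i" if "i \<in> {..n}" for i using b that by simp
  fix S
  define t where "t = (\<lambda>i. \<Sum>j\<in>A. sg S j * f j (single n (unit_vec i)))"
  define x where "x = (\<lambda>i. if i \<le> n then b i * sgn (t i) else 0)"
  have x: "x \<in> vecs (ell p (Suc n))" by (simp add: x_def ell_vecs)
  have "(\<Sum>i\<le>n. b i * \<bar>t i\<bar>) = (\<Sum>i\<le>n. x i * t i)"
    by (intro sum.cong) (auto simp: x_def abs_sgn mult_ac)
  also have "\<dots> = (\<Sum>j\<in>A. sg S j * (\<Sum>i\<le>n. x i * f j (single n (unit_vec i))))"
    unfolding t_def sum_distrib_left by (subst sum.swap) (simp add: mult_ac)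
  also have "\<dots> = (\<Sum>j\<in>A. sg S j * f j (single n x))" by (simp only: biorth_single[OF x])
  also have "\<dots> \<le> (\<Sum>j\<in>A. \<bar>f j (single n x)\<bar>)" by (intro sum_mono) (auto simp: sg_def)
  also have "\<dots> \<le> weak_const * C * nrm X1 (single n x) * (1 + ln (real (Suc (card A))))"
    by (rule sum_biorth_le_log[OF A single_mem[OF x]])
  also have "\<dots> \<le> weak_const * C * bn n b * (1 + ln (real (Suc (card A))))"
  proof (intro mult_right_mono mult_left_mono)
    have "bn n x \<le> bn n b" using b by (intro ell_nrm_mono[OF p]) (auto simp: x_def abs_mult sgn_real_def)
    then show "nrm X1 (single n x) \<le> bn n b" using single_le[OF x] by linarith
  qed (use weak_const_pos C_ge_1 in auto)
  finally show "(\<Sum>i\<le>n. b i * \<bar>\<Sum>j\<in>A. sg S j * f j (single n (unit_vec i))\<bar>)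
      \<le> weak_const * C * bn n b * (1 + ln (real (Suc (card A))))" unfolding t_def .
qed

lemma heavy_card_le:
  assumes r: "1 \<le> r" "r \<le> 2" "invexp p \<le> 1 / r" and A: "finite A" "A \<subseteq> heavy n"
  shows "real (card A) \<le> 2 * \<kappa> * sqrt 3 * weak_const * C * (1 + ln (real (Suc (card A)))) * real (card A) powr (1 / r)"
proof -
  define u where "u = (\<lambda>j. (1 / bn n (e j n)) *\<^sub>R e j n)"
  \<comment> \<open>Pairing the \<open>u j\<close> with the functionals \<open>f j\<close> on the \<open>n\<close>-th block gives at least
    \<open>card A / (2 * \<kappa>)\<close>, whereas the bound through \<open>b\<close> is of smaller order.\<close>
  define b where "b = (\<lambda>i. (\<Sum>j\<in>A. \<bar>u j i\<bar> powr r) powr (1/r))"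
  have emem: "e j n \<in> vecs (ell p (Suc n))" for j by (rule block_mem) auto
  have umem: "u j \<in> vecs (ell p (Suc n))" for j using emem[of j] by (simp add: u_def ell_vecs)
  have pos: "0 < bn n (e j n)" if "j \<in> A" for j
  proof (rule ccontr)
    assume "\<not> 0 < bn n (e j n)"
    then have "bn n (e j n) = 0" using ell_Suc_nrm_nonneg[OF p, of n "e j n"] by linarith
    then show False using biorth_single_le[OF emem, of j j] A(2) that \<kappa>_pos by (auto simp: heavy_def)
  qed
  have u1: "bn n (u j) \<le> 1" if "j \<in> A" for j
    using pos[OF that] by (simp add: u_def ell_nrm_scale[OF p])
  have uf: "1 / (2 * \<kappa>) \<le> \<bar>f j (single n (u j))\<bar>" if "j \<in> A" for j
  proof -
    have "f j (single n (u j)) = (1 / bn n (e j n)) * f j (single n (e j n))"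
      unfolding u_def single_scale by (rule biorth_scale[OF single_mem[OF emem]])
    moreover have "bn n (e j n) < 2 * \<kappa> * \<bar>f j (single n (e j n))\<bar>" using A(2) that by (auto simp: heavy_def)
    ultimately have "bn n (e j n) * 1 < bn n (e j n) * (2 * \<kappa> * \<bar>f j (single n (u j))\<bar>)"
      using pos[OF that] by (simp add: abs_mult)
    then have "1 < 2 * \<kappa> * \<bar>f j (single n (u j))\<bar>" using pos[OF that] by (simp only: mult_less_cancel_left_pos)
    then show ?thesis using \<kappa>_pos by (simp add: field_simps)
  qed
  \<comment> \<open>The power 1 / r comes from r-convexity of the block norm.\<close>
  have bn_b: "bn n b \<le> real (card A) powr (1 / r)"
    unfolding b_def using r u1 by (intro ell_nrm_convex_le[OF p]) (auto simp: A)
  have "real (card A) / (2 * \<kappa>) = (\<Sum>j\<in>A. 1 / (2 * \<kappa>))" by simp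
  also have "\<dots> \<le> (\<Sum>j\<in>A. \<Sum>i\<le>n. \<bar>u j i\<bar> * \<bar>f j (single n (unit_vec i))\<bar>)"
  proof (rule sum_mono)
    fix j assume j: "j \<in> A"
    have "1 / (2 * \<kappa>) \<le> \<bar>\<Sum>i\<le>n. u j i * f j (single n (unit_vec i))\<bar>"
      using uf[OF j] unfolding biorth_single[OF umem] .
    also have "\<dots> \<le> (\<Sum>i\<le>n. \<bar>u j i * f j (single n (unit_vec i))\<bar>)" by (rule sum_abs)
    finally show "1 / (2 * \<kappa>) \<le> (\<Sum>i\<le>n. \<bar>u j i\<bar> * \<bar>f j (single n (unit_vec i))\<bar>)" by (simp add: abs_mult)
  qed
  also have "\<dots> = (\<Sum>i\<le>n. \<Sum>j\<in>A. \<bar>u j i\<bar> * \<bar>f j (single n (unit_vec i))\<bar>)" by (rule sum.swap)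
  also have "\<dots> \<le> (\<Sum>i\<le>n. b i * sqrt (\<Sum>j\<in>A. (f j (single n (unit_vec i)))\<^sup>2))"
  proof (rule sum_mono)
    fix i
    have "(\<Sum>j\<in>A. \<bar>u j i\<bar> * \<bar>f j (single n (unit_vec i))\<bar>)
        \<le> sqrt (\<Sum>j\<in>A. \<bar>u j i\<bar>\<^sup>2) * sqrt (\<Sum>j\<in>A. \<bar>f j (single n (unit_vec i))\<bar>\<^sup>2)"
      by (rule sum_mult_le_sqrt)
    also have "\<dots> \<le> b i * sqrt (\<Sum>j\<in>A. (f j (single n (unit_vec i)))\<^sup>2)"
    proof (intro mult_mono)
      \<comment> \<open>Here r \<le> 2 enters: the 2-norm is at most the r-norm.\<close>
      have "(\<Sum>j\<in>A. \<bar>u j i\<bar> powr 2) powr (1/2) \<le> b i"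
        unfolding b_def using r A by (intro sum_powr_mono_exponent) auto
      then show "sqrt (\<Sum>j\<in>A. \<bar>u j i\<bar>\<^sup>2) \<le> b i" by (simp add: powr_half_sqrt sum_nonneg)
    qed (auto simp: b_def intro: sum_nonneg)
    finally show "(\<Sum>j\<in>A. \<bar>u j i\<bar> * \<bar>f j (single n (unit_vec i))\<bar>)
        \<le> b i * sqrt (\<Sum>j\<in>A. (f j (single n (unit_vec i)))\<^sup>2)" .
  qed
  also have "\<dots> \<le> sqrt 3 * (weak_const * C * bn n b * (1 + ln (real (Suc (card A)))))"
    by (rule heavy_square_function[OF A(1)]) (simp add: b_def)
  also have "\<dots> \<le> sqrt 3 * (weak_const * C * real (card A) powr (1 / r) * (1 + ln (real (Suc (card A)))))"
    using bn_b weak_const_pos C_ge_1 by (intro mult_left_mono mult_right_mono) auto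
  finally show ?thesis using \<kappa>_pos by (simp add: field_simps)
qed

lemma heavy_bounded:
  assumes "invexp p < 1"
  obtains M :: nat where "\<And>A n. finite A \<Longrightarrow> A \<subseteq> heavy n \<Longrightarrow> card A \<le> M"
proof -
  \<comment> \<open>The choice is r = min 2 p, which exceeds 1 because p does.\<close>
  obtain r where r: "1 < r" "r \<le> 2" "invexp p \<le> 1 / r"
  proof (cases "invexp p \<le> 1/2")
    case True then show ?thesis using that[of 2] by simp
  next
    case False
    then show ?thesis using that[of "1 / invexp p"] assms by (simp add: field_simps)
  qed
  then have "1 / r < 1" by simp
  then obtain M where M: "\<And>m::nat. real m \<le> 2 * \<kappa> * sqrt 3 * weak_const * C * (1 + ln (real (Suc m))) * real m powr (1/r) \<Longrightarrow> m \<le> M"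
    using log_power_bound[of "1/r" "2 * \<kappa> * sqrt 3 * weak_const * C"] by blast
  show thesis
    using heavy_card_le[OF _ r(2,3)] r(1) by (intro that[of M] M) auto
qed

text \<open>Of \<open>f j (e j) = 1\<close> the blocks from N on account for less than 1/4 and the
  light blocks for at most 1/2. The heavy blocks must supply the remaining 1/4, and
  \<open>coef_const\<close> converts this into mass of \<open>e j\<close>.\<close>

lemma heavy_mass:
  "\<forall>\<^sub>F N in sequentially. 1 / (4 * coef_const) \<le> (\<Sum>n | n < N \<and> j \<in> heavy n. bn n (e j n))"
proof -
  have emem: "e j n \<in> vecs (ell p (Suc n))" for n by (rule block_mem) auto
  have "0 < 1 / (4 * coef_const)" using coef_const_pos by simp
  then obtain N0 where N0: "(\<Sum>n. bn (n + N0) (e j (n + N0))) < 1 / (4 * coef_const)" using tail_small[OF e_mem] by blast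
  show ?thesis
  proof (rule eventually_sequentiallyI[of N0])
    fix N assume N: "N0 \<le> N"
    define y where "y = e j - (\<Sum>n<N. single n (e j n))"
    have hm: "(\<Sum>n<N. single n (e j n)) \<in> vecs X1" using emem by (intro sum_mem single_mem)
    have y: "y \<in> vecs X1" unfolding y_def using hm by auto
    have hval: "(\<Sum>n<N. single n (e j n)) m = (if m < N then e j m else 0)" for m
    proof -
      have "(\<Sum>n<N. single n (e j n)) m = (\<Sum>n<N. single n (e j n) m)" by (rule sum_fun_apply)
      also have "\<dots> = (\<Sum>n<N. if n = m then e j m else 0)"
        by (rule sum.cong) (auto simp: single_def)
      also have "\<dots> = (if m < N then e j m else 0)" unfolding sum.delta[OF finite_lessThan] by simp
      finally show ?thesis .
    qed
    have ym: "bn m (y m) = (if m < N then 0 else bn m (e j m))" for m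
      using seminormed.nrm_zero[OF seminormed_ell[OF p, of "Suc m"]] by (simp add: y_def hval)
    have "nrm X1 y = (\<Sum>n. bn (n + N0) (y (n + N0)))"
      unfolding nrm_split[OF y, of N0] using N by (simp add: ym)
    also have "\<dots> \<le> (\<Sum>n. bn (n + N0) (e j (n + N0)))"
      by (rule suminf_le[OF _ summable_tail[OF y] summable_tail[OF e_mem]]) (simp add: ym ell_Suc_nrm_nonneg[OF p])
    finally have "nrm X1 y < 1 / (4 * coef_const)" using N0 by linarith
    then have "coef_const * nrm X1 y < 1/4" using coef_const_pos by (simp add: field_simps)
    then have fy: "\<bar>f j y\<bar> < 1/4" using biorth_le[OF y, of j] by linarith
    have "f j (e j) = f j (y + (\<Sum>n<N. single n (e j n)))" by (simp add: y_def)
    also have "\<dots> = f j y + (\<Sum>n<N. f j (single n (e j n)))"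
      unfolding biorth_add[OF y hm] using emem by (subst biorth_sum) (auto intro: single_mem)
    finally have fe: "f j (e j) = f j y + (\<Sum>n<N. f j (single n (e j n)))" .
    have fe1: "f j (e j) = 1" using biorth_finite_sum[of "{j}" j "\<lambda>_. 1"] by simp
    let ?H = "{n. n < N \<and> j \<in> heavy n}" and ?L = "{n. n < N \<and> j \<notin> heavy n}"
    have "{..<N} = ?H \<union> ?L" by auto
    then have "(\<Sum>n<N. f j (single n (e j n))) = (\<Sum>n\<in>?H \<union> ?L. f j (single n (e j n)))" by simp
    also have "\<dots> = (\<Sum>n\<in>?H. f j (single n (e j n))) + (\<Sum>n\<in>?L. f j (single n (e j n)))"
      by (intro sum.union_disjoint) auto
    also have "\<dots> \<le> (\<Sum>n\<in>?H. coef_const * bn n (e j n)) + (\<Sum>n\<in>?L. bn n (e j n) / (2 * \<kappa>))"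
    proof (intro add_mono sum_mono)
      fix n show "f j (single n (e j n)) \<le> coef_const * bn n (e j n)" using biorth_single_le[OF emem, of j n] by linarith
      assume "n \<in> ?L"
      then have "2 * \<kappa> * \<bar>f j (single n (e j n))\<bar> \<le> bn n (e j n)" by (simp add: heavy_def)
      then have "\<bar>f j (single n (e j n))\<bar> \<le> bn n (e j n) / (2 * \<kappa>)" using \<kappa>_pos by (simp add: field_simps)
      then show "f j (single n (e j n)) \<le> bn n (e j n) / (2 * \<kappa>)" by linarith
    qed
    \<comment> \<open>The factor 2 * \<kappa> in \<open>heavy\<close> is chosen for this: the total
      mass of \<open>e j\<close> is at most \<kappa>.\<close>
    also have "(\<Sum>n\<in>?L. bn n (e j n) / (2 * \<kappa>)) \<le> 1/2"
    proof -
      have "(\<Sum>n\<in>?L. bn n (e j n)) \<le> (\<Sum>n<N. bn n (e j n))"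
        by (intro sum_mono2) (auto intro: ell_Suc_nrm_nonneg[OF p])
      also have "\<dots> \<le> \<kappa>" using head_le[OF e_mem, of j N] nrm_e_le_\<kappa>[of j] by linarith
      finally show ?thesis using \<kappa>_pos by (simp add: sum_divide_distrib[symmetric] field_simps)
    qed
    finally have "1/4 \<le> coef_const * (\<Sum>n\<in>?H. bn n (e j n))"
      using fe fe1 fy by (simp add: sum_distrib_left)
    then show "1 / (4 * coef_const) \<le> (\<Sum>n\<in>?H. bn n (e j n))" using coef_const_pos by (simp add: field_simps)
  qed
qed

text \<open>Every \<open>e j\<close> has a fixed mass on its heavy blocks. In one block at most M
  indices are heavy, and each of their terms is dominated by the sign average of the block norm of
  the whole sum. Adding up the blocks gives the l1-norm, and \<open>sign_change\<close> removes the
  signs.\<close>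

lemma l1_lower_bound:
  assumes M: "\<And>A n. finite A \<Longrightarrow> A \<subseteq> heavy n \<Longrightarrow> card A \<le> M" and J: "finite J"
  shows "(\<Sum>j\<in>J. \<bar>a j\<bar>) \<le> 8 * coef_const * C * real M * nrm X1 (\<Sum>j\<in>J. a j *\<^sub>R e j)"
proof -
  let ?R = "nrm X1 (\<Sum>j\<in>J. a j *\<^sub>R e j)"
  have "\<forall>\<^sub>F N in sequentially. \<forall>j\<in>J. 1 / (4 * coef_const) \<le> (\<Sum>n | n < N \<and> j \<in> heavy n. bn n (e j n))"
    using heavy_mass J by (simp add: eventually_ball_finite_distrib)
  then obtain N where N: "\<And>j. j \<in> J \<Longrightarrow> 1 / (4 * coef_const) \<le> (\<Sum>n | n < N \<and> j \<in> heavy n. bn n (e j n))"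
    by (auto simp: eventually_sequentially)
  define W where "W = (\<lambda>S. \<Sum>j\<in>J. (sg S j * a j) *\<^sub>R e j)"
  have W: "W S \<in> vecs X1" for S unfolding W_def by (intro combination_mem range_e)
  have Wn: "nrm X1 (W S) \<le> 2 * C * ?R" for S
    unfolding W_def by (rule sign_change[OF J]) (auto simp: sg_def)
  have block: "2 ^ card J * (\<Sum>j\<in>J \<inter> heavy n. \<bar>a j\<bar> * bn n (e j n)) \<le> real M * (\<Sum>S\<in>Pow J. bn n (W S n))" for n
  proof -
    interpret B: seminormed "ell p (Suc n)" by (rule seminormed_ell[OF p]) simp
    have emem: "e j n \<in> vecs (ell p (Suc n))" for j by (rule block_mem) auto
    let ?V = "\<Sum>S\<in>Pow J. bn n (W S n)"
    have one: "2 ^ card J * (\<bar>a k\<bar> * bn n (e k n)) \<le> ?V" if "k \<in> J" for k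
    proof -
      have "2 ^ card J * bn n (a k *\<^sub>R e k n) \<le> (\<Sum>S\<in>Pow J. bn n (\<Sum>j\<in>J. sg S j *\<^sub>R (a j *\<^sub>R e j n)))"
        using J that emem by (intro B.nrm_le_signed_average B.scale_mem)
      also have "\<dots> = ?V"
      proof (rule sum.cong[OF refl])
        fix S have "W S n = (\<Sum>j\<in>J. sg S j *\<^sub>R (a j *\<^sub>R e j n))"
          unfolding W_def by (subst sum_fun_apply, rule sum.cong) simp_all
        then show "bn n (\<Sum>j\<in>J. sg S j *\<^sub>R (a j *\<^sub>R e j n)) = bn n (W S n)" by (simp only:)
      qed
      finally show ?thesis using B.scale[OF emem] by simp
    qed
    have "2 ^ card J * (\<Sum>j\<in>J \<inter> heavy n. \<bar>a j\<bar> * bn n (e j n)) = (\<Sum>j\<in>J \<inter> heavy n. 2 ^ card J * (\<bar>a j\<bar> * bn n (e j n)))"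
      by (simp add: sum_distrib_left)
    also have "\<dots> \<le> (\<Sum>j\<in>J \<inter> heavy n. ?V)" using one by (intro sum_mono) auto
    also have "\<dots> = real (card (J \<inter> heavy n)) * ?V" by simp
    also have "\<dots> \<le> real M * ?V"
      using M[of "J \<inter> heavy n" n] J by (intro mult_right_mono sum_nonneg) (auto intro: ell_Suc_nrm_nonneg[OF p])
    finally show ?thesis .
  qed
  have "2 ^ card J * (\<Sum>j\<in>J. \<bar>a j\<bar> * (1 / (4 * coef_const)))
      \<le> 2 ^ card J * (\<Sum>j\<in>J. \<bar>a j\<bar> * (\<Sum>n | n < N \<and> j \<in> heavy n. bn n (e j n)))"
    using N by (intro mult_left_mono sum_mono) auto
  also have "\<dots> = (\<Sum>n<N. 2 ^ card J * (\<Sum>j\<in>J \<inter> heavy n. \<bar>a j\<bar> * bn n (e j n)))"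
  proof -
    have "(\<Sum>j\<in>J. \<bar>a j\<bar> * (\<Sum>n | n < N \<and> j \<in> heavy n. bn n (e j n)))
        = (\<Sum>j\<in>J. \<Sum>n<N. if j \<in> heavy n then \<bar>a j\<bar> * bn n (e j n) else 0)"
      unfolding sum_distrib_left by (intro sum.cong refl sum.mono_neutral_cong_left) auto
    also have "\<dots> = (\<Sum>n<N. \<Sum>j\<in>J. if j \<in> heavy n then \<bar>a j\<bar> * bn n (e j n) else 0)" by (rule sum.swap)
    also have "\<dots> = (\<Sum>n<N. \<Sum>j\<in>J \<inter> heavy n. \<bar>a j\<bar> * bn n (e j n))"
      using J by (intro sum.cong refl sum.mono_neutral_cong_right) auto
    finally show ?thesis by (simp add: sum_distrib_left)
  qed
  also have "\<dots> \<le> (\<Sum>n<N. real M * (\<Sum>S\<in>Pow J. bn n (W S n)))"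
    using block by (rule sum_mono)
  also have "\<dots> = real M * (\<Sum>S\<in>Pow J. \<Sum>n<N. bn n (W S n))"
    unfolding sum_distrib_left[symmetric] by (subst sum.swap) simp
  also have "\<dots> \<le> real M * (\<Sum>S\<in>Pow J. 2 * C * ?R)"
    using order_trans[OF head_le[OF W] Wn] by (intro mult_left_mono sum_mono) auto
  also have "\<dots> = 2 ^ card J * (real M * (2 * C * ?R))" using J by (simp add: card_Pow)
  finally have "(\<Sum>j\<in>J. \<bar>a j\<bar> * (1 / (4 * coef_const))) \<le> real M * (2 * C * ?R)" by simp
  then have "(\<Sum>j\<in>J. \<bar>a j\<bar>) / (4 * coef_const) \<le> real M * (2 * C * ?R)" by (simp add: sum_divide_distrib)
  then show ?thesis using coef_const_pos by (simp add: field_simps)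
qed

lemma exponent_one: "p = 1"
proof (rule ccontr)
  assume "p \<noteq> 1"
  then have th: "invexp p < 1" using p by (cases p) (auto simp: one_ereal_def)
  obtain M where M: "\<And>A n. finite A \<Longrightarrow> A \<subseteq> heavy n \<Longrightarrow> card A \<le> M" using heavy_bounded[OF th] by blast
  define K where "K = 8 * coef_const * C * real M"
  have K: "0 \<le> K" using coef_const_pos C_ge_1 by (simp add: K_def)
  \<comment> \<open>This is max (1/p) (1/2). Compared with the c0 case the roles are exchanged: the
    functionals now have summable values, and the basis vectors contribute their Euclidean
    norm.\<close>
  define \<gamma> where "\<gamma> = invexp p + max 0 (1/2 - invexp p)"
  have "\<gamma> < 1" using th by (auto simp: \<gamma>_def max_def)
  then obtain n where n: "sqrt 3 * (K * C) * \<kappa> * real (Suc n) powr \<gamma> < real (Suc n)" by (rule powr_unbounded)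
  have \<alpha>: "(\<Sum>j<J. \<bar>\<Sum>i\<le>n. sg S i * f j (single n (unit_vec i))\<bar>) \<le> K * (C * real (Suc n) powr invexp p)" for S J
  proof -
    define x where "x = (\<lambda>i. if i \<le> n then sg S i else 0)"
    have x: "x \<in> vecs (ell p (Suc n))" by (simp add: x_def ell_vecs)
    have "(\<Sum>i\<le>n. sg S i * f j (single n (unit_vec i))) = f j (single n x)" for j
      unfolding biorth_single[OF x] by (intro sum.cong) (auto simp: x_def)
    then have "(\<Sum>j<J. \<bar>\<Sum>i\<le>n. sg S i * f j (single n (unit_vec i))\<bar>) = (\<Sum>j<J. \<bar>f j (single n x)\<bar>)" by simp
    also have "\<dots> \<le> K * nrm X1 (\<Sum>j<J. f j (single n x) *\<^sub>R e j)"
      unfolding K_def by (rule l1_lower_bound[OF M]) auto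
    also have "\<dots> \<le> K * (C * nrm X1 (single n x))"
      by (intro mult_left_mono projection_bound single_mem x K) auto
    also have "\<dots> \<le> K * (C * real (Suc n) powr invexp p)"
    proof (intro mult_left_mono K)
      have "bn n x \<le> real (Suc n) powr invexp p"
        by (intro ell_nrm_le_bound[OF p]) (auto simp: x_def)
      then show "nrm X1 (single n x) \<le> real (Suc n) powr invexp p" using single_le[OF x] by linarith
    qed (use C_ge_1 in auto)
    finally show ?thesis .
  qed
  have \<beta>: "sqrt (\<Sum>i\<le>n. (e j n i)\<^sup>2) \<le> real (Suc n) powr (max 0 (1/2 - invexp p)) * \<kappa>" for j
  proof -
    have "sqrt (\<Sum>i<Suc n. (e j n i)\<^sup>2) \<le> real (Suc n) powr (max 0 (1/2 - invexp p)) * bn n (e j n)"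
      by (rule l2_le_ell_nrm[OF p]) simp
    also have "\<dots> \<le> real (Suc n) powr (max 0 (1/2 - invexp p)) * \<kappa>"
      using order_trans[OF block_le[OF e_mem] nrm_e_le_\<kappa>] by (intro mult_left_mono) auto
    finally show ?thesis by (simp only: lessThan_Suc_atMost)
  qed
  have "real (Suc n) \<le> sqrt 3 * (K * (C * real (Suc n) powr invexp p)) * (real (Suc n) powr (max 0 (1/2 - invexp p)) * \<kappa>)"
    using \<kappa>_pos by (intro dim_le_trace trace_le \<alpha> \<beta>) auto
  also have "\<dots> = sqrt 3 * (K * C) * \<kappa> * real (Suc n) powr \<gamma>" by (simp add: \<gamma>_def powr_add mult_ac)
  finally show False using n by linarith
qed

end

lemma l1_sum_no_greedy_basis:
  assumes "1 < p"
  shows "\<not> has_greedy_basis (ell_sum 1 (\<lambda>n. ell p (Suc n)))"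
proof
  assume "has_greedy_basis (ell_sum 1 (\<lambda>n. ell p (Suc n)))"
  then obtain e C where g: "greedy_with C (ell_sum 1 (\<lambda>n. ell p (Suc n))) e" unfolding has_greedy_basis_def by blast
  have p: "1 \<le> p" using assms by simp
  interpret l1_greedy_basis p e "max C 1"
    unfolding l1_greedy_basis_def l1_greedy_basis_axioms_def
    using greedy_basisI[OF seminormed_ell_sum[OF order_refl seminormed_ell[OF p]] g] p by simp
  show False using exponent_one assms by simp
qed

section \<open>Complemented subspaces and isomorphisms\<close>

text \<open>Linearity is asked on the whole ambient space, estimates only on \<open>vecs X\<close>:
  the maps below are given by formulas that are linear everywhere.\<close>

definition bounded_map :: "'a::real_vector nspace \<Rightarrow> 'b::real_vector nspace \<Rightarrow> ('a \<Rightarrow> 'b) \<Rightarrow> bool" where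
  "bounded_map X Y T \<longleftrightarrow> linear T \<and> (\<forall>x\<in>vecs X. T x \<in> vecs Y) \<and>
     (\<exists>K>0. \<forall>x\<in>vecs X. nrm Y (T x) \<le> K * nrm X x)"

definition complemented :: "'a::real_vector nspace \<Rightarrow> 'b::real_vector nspace \<Rightarrow> bool" where
  "complemented X Y \<longleftrightarrow> (\<exists>J P. bounded_map X Y J \<and> bounded_map Y X P \<and> (\<forall>x\<in>vecs X. P (J x) = x))"

definition isomorphic :: "'a::real_vector nspace \<Rightarrow> 'b::real_vector nspace \<Rightarrow> bool" where
  "isomorphic X Y \<longleftrightarrow> (\<exists>T S. bounded_map X Y T \<and> bounded_map Y X S \<and>
     (\<forall>x\<in>vecs X. S (T x) = x) \<and> (\<forall>y\<in>vecs Y. T (S y) = y))"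

lemma bounded_map_linear: "bounded_map X Y T \<Longrightarrow> linear T"
  unfolding bounded_map_def by blast

lemma bounded_map_mem: "bounded_map X Y T \<Longrightarrow> x \<in> vecs X \<Longrightarrow> T x \<in> vecs Y"
  unfolding bounded_map_def by blast

lemma bounded_map_bound:
  assumes "bounded_map X Y T"
  obtains K where "0 < K" "\<And>x. x \<in> vecs X \<Longrightarrow> nrm Y (T x) \<le> K * nrm X x"
  using assms unfolding bounded_map_def by blast

lemma bounded_mapI:
  assumes "linear T" "\<And>x. x \<in> vecs X \<Longrightarrow> T x \<in> vecs Y" "\<And>x. x \<in> vecs X \<Longrightarrow> nrm Y (T x) \<le> K * nrm X x"
    and "seminormed X"
  shows "bounded_map X Y T"
  unfolding bounded_map_def
proof (intro conjI exI[of _ "max K 1"] ballI)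
  fix x assume x: "x \<in> vecs X"
  have "K * nrm X x \<le> max K 1 * nrm X x" using seminormed.nonneg[OF assms(4) x] by (intro mult_right_mono) auto
  then show "nrm Y (T x) \<le> max K 1 * nrm X x" using assms(3)[OF x] by linarith
qed (use assms in auto)

lemma bounded_map_compose:
  assumes T: "bounded_map X Y T" and S: "bounded_map Y Z S"
  shows "bounded_map X Z (\<lambda>x. S (T x))"
proof -
  obtain K where K: "0 < K" "\<And>x. x \<in> vecs X \<Longrightarrow> nrm Y (T x) \<le> K * nrm X x" using bounded_map_bound[OF T] by blast
  obtain L where L: "0 < L" "\<And>y. y \<in> vecs Y \<Longrightarrow> nrm Z (S y) \<le> L * nrm Y y" using bounded_map_bound[OF S] by blast
  have "linear (\<lambda>x. S (T x))"
    using linear_compose[OF bounded_map_linear[OF T] bounded_map_linear[OF S]] by (simp add: comp_def)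
  moreover have "nrm Z (S (T x)) \<le> (L * K) * nrm X x" if "x \<in> vecs X" for x
  proof -
    have "nrm Z (S (T x)) \<le> L * nrm Y (T x)" by (rule L(2)[OF bounded_map_mem[OF T that]])
    also have "\<dots> \<le> L * (K * nrm X x)" using K(2)[OF that] L(1) by (intro mult_left_mono) auto
    finally show ?thesis by (simp add: mult_ac)
  qed
  ultimately show ?thesis unfolding bounded_map_def
    using bounded_map_mem[OF S bounded_map_mem[OF T]] mult_pos_pos[OF L(1) K(1)] by blast
qed

lemma bounded_map_add:
  assumes T: "bounded_map X Y T" and S: "bounded_map X Y S" and Y: "seminormed Y"
  shows "bounded_map X Y (\<lambda>x. T x + S x)"
proof -
  obtain K where K: "0 < K" "\<And>x. x \<in> vecs X \<Longrightarrow> nrm Y (T x) \<le> K * nrm X x" using bounded_map_bound[OF T] by blast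
  obtain L where L: "0 < L" "\<And>x. x \<in> vecs X \<Longrightarrow> nrm Y (S x) \<le> L * nrm X x" using bounded_map_bound[OF S] by blast
  note m = bounded_map_mem[OF T] bounded_map_mem[OF S]
  have "nrm Y (T x + S x) \<le> (K + L) * nrm X x" if "x \<in> vecs X" for x
    using seminormed.triangle[OF Y m(1)[OF that] m(2)[OF that]] K(2)[OF that] L(2)[OF that] by (simp add: distrib_right)
  then show ?thesis unfolding bounded_map_def
    using linear_compose_add[OF bounded_map_linear[OF T] bounded_map_linear[OF S]] K(1) L(1)
      seminormed.add_mem[OF Y m] add_pos_pos[OF K(1) L(1)] by blast
qed

lemma bounded_map_minus:
  assumes T: "bounded_map X Y T" and Y: "seminormed Y"
  shows "bounded_map X Y (\<lambda>x. - T x)"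
proof -
  obtain K where K: "0 < K" "\<And>x. x \<in> vecs X \<Longrightarrow> nrm Y (T x) \<le> K * nrm X x" using bounded_map_bound[OF T] by blast
  have "nrm Y (- T x) \<le> K * nrm X x" if "x \<in> vecs X" for x
    using seminormed.nrm_minus[OF Y bounded_map_mem[OF T that]] K(2)[OF that] by simp
  then show ?thesis unfolding bounded_map_def
    using linear_compose_neg[OF bounded_map_linear[OF T]] K(1) seminormed.minus_mem[OF Y bounded_map_mem[OF T]] by blast
qed

lemma bounded_map_diff:
  assumes "bounded_map X Y T" "bounded_map X Y S" "seminormed Y"
  shows "bounded_map X Y (\<lambda>x. T x - S x)"
  using bounded_map_add[OF assms(1) bounded_map_minus[OF assms(2,3)] assms(3)] by simp

lemma bounded_map_id: "bounded_map X X (\<lambda>x. x)"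
  unfolding bounded_map_def using linear_id by (auto simp: id_def intro!: exI[of _ 1])

lemma complemented_refl: "complemented X X"
  unfolding complemented_def using bounded_map_id[of X] by blast

lemma complemented_trans:
  assumes "complemented X Y" "complemented Y Z"
  shows "complemented X Z"
proof -
  obtain J P where 1: "bounded_map X Y J" "bounded_map Y X P" "\<And>x. x \<in> vecs X \<Longrightarrow> P (J x) = x"
    using assms(1) unfolding complemented_def by blast
  obtain J' P' where 2: "bounded_map Y Z J'" "bounded_map Z Y P'" "\<And>x. x \<in> vecs Y \<Longrightarrow> P' (J' x) = x"
    using assms(2) unfolding complemented_def by blast
  show ?thesis unfolding complemented_def
  proof (intro exI conjI ballI)
    show "bounded_map X Z (\<lambda>x. J' (J x))" "bounded_map Z X (\<lambda>z. P (P' z))"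
      using 1 2 by (blast intro: bounded_map_compose)+
    fix x assume "x \<in> vecs X"
    then show "P (P' (J' (J x))) = x" using 1(3) 2(3)[OF bounded_map_mem[OF 1(1)]] by simp
  qed
qed

lemma isomorphic_sym: "isomorphic X Y \<Longrightarrow> isomorphic Y X"
  unfolding isomorphic_def by blast

lemma isomorphic_trans:
  assumes "isomorphic X Y" "isomorphic Y Z"
  shows "isomorphic X Z"
proof -
  obtain T S where 1: "bounded_map X Y T" "bounded_map Y X S" "\<And>x. x \<in> vecs X \<Longrightarrow> S (T x) = x" "\<And>y. y \<in> vecs Y \<Longrightarrow> T (S y) = y"
    using assms(1) unfolding isomorphic_def by blast
  obtain T' S' where 2: "bounded_map Y Z T'" "bounded_map Z Y S'" "\<And>x. x \<in> vecs Y \<Longrightarrow> S' (T' x) = x" "\<And>y. y \<in> vecs Z \<Longrightarrow> T' (S' y) = y"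
    using assms(2) unfolding isomorphic_def by blast
  show ?thesis unfolding isomorphic_def
  proof (intro exI conjI ballI)
    show "bounded_map X Z (\<lambda>x. T' (T x))" "bounded_map Z X (\<lambda>z. S (S' z))"
      using 1 2 by (blast intro: bounded_map_compose)+
    show "S (S' (T' (T x))) = x" if "x \<in> vecs X" for x using 1(3) 2(3)[OF bounded_map_mem[OF 1(1)]] that by simp
    show "T' (T (S (S' z))) = z" if "z \<in> vecs Z" for z using 2(4) 1(4)[OF bounded_map_mem[OF 2(2)]] that by simp
  qed
qed

lemma expands_bounded_map:
  assumes T: "bounded_map X Y T" and X: "seminormed X" and Y: "seminormed Y"
    and e: "range e \<subseteq> vecs X" and x: "x \<in> vecs X" and ex: "expands X e a x"
  shows "expands Y (\<lambda>i. T (e i)) a (T x)"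
proof -
  interpret X: seminormed X by fact
  interpret Y: seminormed Y by fact
  obtain K where K: "0 < K" "\<And>x. x \<in> vecs X \<Longrightarrow> nrm Y (T x) \<le> K * nrm X x" using bounded_map_bound[OF T] by blast
  note lin = bounded_map_linear[OF T]
  let ?r = "\<lambda>n. x - (\<Sum>i<n. a i *\<^sub>R e i)"
  have eq: "T x - (\<Sum>i<n. a i *\<^sub>R T (e i)) = T (?r n)" for n
    by (simp only: linear_diff[OF lin] linear_sum[OF lin] linear_scale[OF lin])
  have r: "?r n \<in> vecs X" for n using e x by (intro X.diff_mem X.sum_mem X.scale_mem) auto
  show ?thesis unfolding expands_def eq
  proof (rule tendsto_sandwich[of "\<lambda>_. 0"])
    show "(\<lambda>n. K * nrm X (?r n)) \<longlonglongrightarrow> 0"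
      using tendsto_mult_right_zero[OF ex[unfolded expands_def]] .
    show "\<forall>\<^sub>F n in sequentially. 0 \<le> nrm Y (T (?r n))"
      using Y.nonneg[OF bounded_map_mem[OF T r]] by (intro always_eventually) blast
    show "\<forall>\<^sub>F n in sequentially. nrm Y (T (?r n)) \<le> K * nrm X (?r n)"
      using K(2)[OF r] by (intro always_eventually) blast
  qed simp
qed

text \<open>The coefficients of x in the image basis are those of \<open>S x\<close> in the original
  one, so greedy sets coincide; norms and best errors change by constant factors.\<close>

lemma has_greedy_basis_isomorphic:
  assumes Y: "seminormed Y" and X: "seminormed X" and iso: "isomorphic Y X" and gr: "has_greedy_basis Y"
  shows "has_greedy_basis X"
proof -
  interpret X: seminormed X by fact
  interpret Y: seminormed Y by fact
  obtain T S where T: "bounded_map Y X T" and S: "bounded_map X Y S"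
    and ST: "\<And>y. y \<in> vecs Y \<Longrightarrow> S (T y) = y" and TS: "\<And>x. x \<in> vecs X \<Longrightarrow> T (S x) = x"
    using iso unfolding isomorphic_def by blast
  obtain e C where g: "greedy_with C Y e" using gr unfolding has_greedy_basis_def by blast
  obtain K where K: "0 < K" "\<And>x. x \<in> vecs Y \<Longrightarrow> nrm X (T x) \<le> K * nrm Y x" using bounded_map_bound[OF T] by blast
  obtain L where L: "0 < L" "\<And>x. x \<in> vecs X \<Longrightarrow> nrm Y (S x) \<le> L * nrm X x" using bounded_map_bound[OF S] by blast
  note linT = bounded_map_linear[OF T] and linS = bounded_map_linear[OF S]
  have sb: "schauder_basis Y e" using g unfolding greedy_with_def by blast
  have e: "range e \<subseteq> vecs Y" using sb unfolding schauder_basis_def by blast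
  then have ei: "e i \<in> vecs Y" for i by auto
  define e' where "e' = (\<lambda>i. T (e i))"
  have e': "range e' \<subseteq> vecs X" using bounded_map_mem[OF T ei] by (auto simp: e'_def)
  have Se': "(\<lambda>i. S (e' i)) = e" using ST ei by (simp add: e'_def)
  have ex: "expands X e' a x \<longleftrightarrow> expands Y e a (S x)" if x: "x \<in> vecs X" for a x
  proof
    assume "expands X e' a x"
    from expands_bounded_map[OF S X Y e' x this] show "expands Y e a (S x)" by (simp only: Se')
  next
    assume "expands Y e a (S x)"
    from expands_bounded_map[OF T Y X e bounded_map_mem[OF S x] this] show "expands X e' a x"
      by (simp only: e'_def TS[OF x])
  qed
  have bi: "biorth X e' i x = biorth Y e i (S x)" if "x \<in> vecs X" for i x
    unfolding biorth_def by (simp only: ex[OF that])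
  have schauder: "schauder_basis X e'"
    unfolding schauder_basis_def
  proof (intro conjI ballI e')
    fix x assume x: "x \<in> vecs X"
    have "\<exists>!a. expands Y e a (S x)" using sb bounded_map_mem[OF S x] unfolding schauder_basis_def by blast
    then show "\<exists>!a. expands X e' a x" by (simp only: ex[OF x])
  qed
  have combo: "x - (\<Sum>i\<in>A. a i *\<^sub>R e' i) = T (S x - (\<Sum>i\<in>A. a i *\<^sub>R e i))" if "x \<in> vecs X" for x a A
    by (simp only: e'_def linear_diff[OF linT] linear_sum[OF linT] linear_scale[OF linT] TS[OF that])
  have combo': "S x - (\<Sum>i\<in>A. a i *\<^sub>R e i) = S (x - (\<Sum>i\<in>A. a i *\<^sub>R e' i))" for x a A
    unfolding linear_diff[OF linS] linear_sum[OF linS] linear_scale[OF linS] Se'[symmetric] ..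
  have best: "best_error Y e n (S x) \<le> L * best_error X e' n x" if x: "x \<in> vecs X" for n x
  proof -
    let ?B = "{nrm X (x - (\<Sum>i\<in>A. a i *\<^sub>R e' i)) | a A. finite A \<and> card A \<le> n}"
    have "best_error Y e n (S x) / L \<le> Inf ?B"
    proof (rule cInf_greatest)
      have "nrm X (x - (\<Sum>i\<in>{}. 0 *\<^sub>R e' i)) \<in> ?B"
        by (intro CollectI exI[of _ "{}"] exI[of _ "\<lambda>_. 0"] conjI refl) auto
      then show "?B \<noteq> {}" by blast
      fix b assume "b \<in> ?B"
      then obtain a A where b: "b = nrm X (x - (\<Sum>i\<in>A. a i *\<^sub>R e' i))" and A: "finite A" "card A \<le> n" by blast
      have mem: "x - (\<Sum>i\<in>A. a i *\<^sub>R e' i) \<in> vecs X" using e' x by (intro X.diff_mem X.sum_mem X.scale_mem) auto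
      have "best_error Y e n (S x) \<le> nrm Y (S x - (\<Sum>i\<in>A. a i *\<^sub>R e i))"
        by (rule Y.best_error_le[OF e bounded_map_mem[OF S x] A])
      also have "\<dots> \<le> L * b" unfolding b combo' by (rule L(2)[OF mem])
      finally show "best_error Y e n (S x) / L \<le> b" using L(1) by (simp add: field_simps)
    qed
    then show ?thesis using L(1) by (simp add: best_error_def[of X] field_simps)
  qed
  \<comment> \<open>The sign of C is not given, and \<open>max C 0\<close> keeps the estimates
    monotone.\<close>
  have "greedy_with (K * (max C 0 * L)) X e'"
    unfolding greedy_with_def
  proof (intro conjI schauder ballI allI impI)
    fix x n A assume x: "x \<in> vecs X" and n: "1 \<le> (n::nat)" and A: "greedy_set X e' n x A"
    have Sx: "S x \<in> vecs Y" by (rule bounded_map_mem[OF S x])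
    have "greedy_set Y e n (S x) A" using A unfolding greedy_set_def bi[OF x] .
    then have le: "nrm Y (S x - greedy_approx Y e A (S x)) \<le> C * best_error Y e n (S x)"
      using g Sx n unfolding greedy_with_def by blast
    have mem: "S x - greedy_approx Y e A (S x) \<in> vecs Y"
      unfolding greedy_approx_def using ei Sx by (intro Y.diff_mem Y.sum_mem Y.scale_mem)
    have be: "0 \<le> best_error Y e n (S x)" by (rule Y.best_error_nonneg[OF e Sx])
    have "x - greedy_approx X e' A x = T (S x - greedy_approx Y e A (S x))"
      unfolding greedy_approx_def bi[OF x] by (rule combo[OF x])
    then have "nrm X (x - greedy_approx X e' A x) \<le> K * nrm Y (S x - greedy_approx Y e A (S x))"
      using K(2)[OF mem] by (simp only:)
    also have "\<dots> \<le> K * (max C 0 * best_error Y e n (S x))"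
      using K(1) le mult_right_mono[OF max.cobounded1[of C 0] be] by (intro mult_left_mono) linarith+
    also have "\<dots> \<le> K * (max C 0 * (L * best_error X e' n x))"
      using K(1) best[OF x] by (intro mult_left_mono) auto
    finally show "nrm X (x - greedy_approx X e' A x) \<le> K * (max C 0 * L) * best_error X e' n x" by (simp only: mult_ac)
  qed
  then show ?thesis unfolding has_greedy_basis_def by blast
qed

lemma linear_funI:
  fixes T :: "'a::real_vector \<Rightarrow> 'b \<Rightarrow> 'c::real_vector"
  assumes "\<And>x y k. T (x + y) k = T x k + T y k" "\<And>c x k. T (c *\<^sub>R x) k = c *\<^sub>R T x k"
  shows "linear T"
  by (rule linearI) (auto simp: fun_eq_iff assms)

section \<open>Maps on the q-sum of copies of one space\<close>

context
  fixes q :: real and Z :: "'a::real_vector nspace"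
  assumes q: "1 \<le> q" and Z: "seminormed Z"
begin

interpretation Z: seminormed Z by (rule Z)

abbreviation (input) LZ where "LZ \<equiv> ell_sum q (\<lambda>_::nat. Z)"

lemma LZ: "seminormed LZ"
  by (rule seminormed_ell_sum[OF q Z])

lemma LZ_nonneg: "v \<in> vecs LZ \<Longrightarrow> 0 \<le> nrm Z (v n)"
  using Z.nonneg by (simp add: ell_sum_vecs)

lemma LZ_mem: "v \<in> vecs LZ \<Longrightarrow> v n \<in> vecs Z"
  by (simp add: ell_sum_vecs)

lemma bounded_map_coordinatewise:
  assumes S: "bounded_map Z Z S"
  shows "bounded_map LZ LZ (\<lambda>v n. S (v n))"
proof -
  note lin = bounded_map_linear[OF S]
  obtain K where K: "0 < K" "\<And>x. x \<in> vecs Z \<Longrightarrow> nrm Z (S x) \<le> K * nrm Z x" using bounded_map_bound[OF S] by blast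
  have *: "(\<lambda>n. S (v n)) \<in> vecs LZ \<and> nrm LZ (\<lambda>n. S (v n)) \<le> K * nrm LZ v" if v: "v \<in> vecs LZ" for v
  proof -
    have "(\<Sum>n<N. nrm Z (S (v n)) powr q) \<le> (K * nrm LZ v) powr q" for N
    proof -
      have "(\<Sum>n<N. nrm Z (S (v n)) powr q) \<le> (\<Sum>n<N. (K * nrm Z (v n)) powr q)"
        using q K(2)[OF LZ_mem[OF v]] Z.nonneg[OF bounded_map_mem[OF S LZ_mem[OF v]]]
        by (intro sum_mono powr_mono2) auto
      also have "\<dots> = K powr q * (\<Sum>n<N. nrm Z (v n) powr q)"
        using K(1) LZ_nonneg[OF v] by (simp add: powr_mult sum_distrib_left)
      also have "\<dots> \<le> K powr q * nrm LZ v powr q"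
        using q v by (intro mult_left_mono ell_sum_finite_le) auto
      also have "\<dots> = (K * nrm LZ v) powr q" using K(1) ell_sum_nrm_nonneg by (simp add: powr_mult)
      finally show ?thesis .
    qed
    moreover have "0 \<le> K * nrm LZ v" using K(1) by (simp add: ell_sum_nrm_nonneg)
    ultimately show ?thesis
      using ell_sum_boundI[of q "\<lambda>n. S (v n)" "\<lambda>_. Z" "K * nrm LZ v"] q bounded_map_mem[OF S LZ_mem[OF v]] by simp
  qed
  show ?thesis
    by (rule bounded_mapI[where K=K, OF linear_funI _ _ LZ])
      (use * in \<open>auto simp: linear_add[OF lin] linear_scale[OF lin]\<close>)
qed

lemma bounded_map_pull:
  assumes r: "inj r"
  shows "bounded_map LZ LZ (\<lambda>v n. v (r n))"
proof -
  have *: "(\<lambda>n. v (r n)) \<in> vecs LZ \<and> nrm LZ (\<lambda>n. v (r n)) \<le> 1 * nrm LZ v" if v: "v \<in> vecs LZ" for v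
  proof -
    have "(\<Sum>n<N. nrm Z (v (r n)) powr q) \<le> (1 * nrm LZ v) powr q" for N
    proof -
      have "(\<Sum>n<N. nrm Z (v (r n)) powr q) = (\<Sum>m\<in>r ` {..<N}. nrm Z (v m) powr q)"
        using r by (subst sum.reindex) (auto intro: inj_on_subset)
      also have "\<dots> \<le> nrm LZ v powr q" using q v by (intro ell_sum_finite_le) auto
      finally show ?thesis by simp
    qed
    then show ?thesis
      using ell_sum_boundI[of q "\<lambda>n. v (r n)" "\<lambda>_. Z" "1 * nrm LZ v"] q LZ_mem[OF v] by (simp add: ell_sum_nrm_nonneg)
  qed
  show ?thesis
    by (rule bounded_mapI[where K=1, OF linear_funI _ _ LZ]) (use * in auto)
qed

lemma bounded_map_push:
  assumes r: "inj r"
  shows "bounded_map LZ LZ (\<lambda>v n. if n \<in> range r then v (inv r n) else 0)"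
proof -
  let ?P = "\<lambda>v n. if n \<in> range r then v (inv r n) else 0"
  have *: "?P v \<in> vecs LZ \<and> nrm LZ (?P v) \<le> 1 * nrm LZ v" if v: "v \<in> vecs LZ" for v
  proof -
    have "(\<Sum>n<N. nrm Z (?P v n) powr q) \<le> (1 * nrm LZ v) powr q" for N
    proof -
      have "(\<Sum>n<N. nrm Z (?P v n) powr q) = (\<Sum>n\<in>{..<N} \<inter> range r. nrm Z (v (inv r n)) powr q)"
        by (intro sum.mono_neutral_cong_right) auto
      also have "\<dots> = (\<Sum>m\<in>inv r ` ({..<N} \<inter> range r). nrm Z (v m) powr q)"
        by (subst sum.reindex) (auto simp: inj_on_def inv_into_injective)
      also have "\<dots> \<le> nrm LZ v powr q" using q v by (intro ell_sum_finite_le) auto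
      finally show ?thesis by simp
    qed
    then show ?thesis
      using ell_sum_boundI[of q "?P v" "\<lambda>_. Z" "1 * nrm LZ v"] q LZ_mem[OF v] by (simp add: ell_sum_nrm_nonneg)
  qed
  show ?thesis
    by (rule bounded_mapI[where K=1, OF linear_funI _ _ LZ]) (use * in auto)
qed

lemma bounded_map_coordinate: "bounded_map LZ Z (\<lambda>v. v n)"
proof (rule bounded_mapI[where K=1, OF _ _ _ LZ])
  show "linear (\<lambda>v. v n :: 'a)" by (rule linearI) auto
  show "nrm Z (v n) \<le> 1 * nrm LZ v" if "v \<in> vecs LZ" for v
    using ell_sum_coord_le[OF _ that Z, of n] q by simp
qed (rule LZ_mem)

lemma bounded_map_first: "bounded_map Z LZ (\<lambda>z (n::nat). if n = 0 then z else 0)"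
proof -
  have *: "(\<lambda>n::nat. if n = 0 then z else 0) \<in> vecs LZ \<and> nrm LZ (\<lambda>n::nat. if n = 0 then z else 0) \<le> 1 * nrm Z z" if z: "z \<in> vecs Z" for z
  proof -
    have "(\<Sum>n<N. nrm Z (if n = 0 then z else 0) powr q) \<le> (1 * nrm Z z) powr q" for N :: nat
    proof -
      have "(\<Sum>n<N. nrm Z (if n = 0 then z else 0) powr q) = (\<Sum>n<N. if n = 0 then nrm Z z powr q else 0)"
        by (intro sum.cong) auto
      also have "\<dots> \<le> nrm Z z powr q" by (subst sum.delta) auto
      finally show ?thesis by simp
    qed
    then show ?thesis
      using ell_sum_boundI[of q "\<lambda>n. if n = 0 then z else 0" "\<lambda>_. Z" "1 * nrm Z z"] q z Z.nonneg[OF z] by simp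
  qed
  show ?thesis
    by (rule bounded_mapI[where K=1, OF linear_funI _ _ Z]) (use * in auto)
qed

end

text \<open>Pelczynski's decomposition method, with the isomorphism
  \<open>Y \<cong> Y \<oplus> \<ell>\<^sub>q(Z) \<cong> \<ell>\<^sub>q(Z)\<close> written out. The first step splits the copy of \<open>\<ell>\<^sub>q(Z)\<close>
  inside \<open>Y\<close> into its even and odd terms, the second sends \<open>(y, z\<^sub>0, z\<^sub>1, \<dots>)\<close> to
  \<open>(J y + Q z\<^sub>0, J (P z\<^sub>0) + Q z\<^sub>1, \<dots>)\<close> where \<open>Q = 1 - J P\<close>.\<close>

lemma pelczynski_decomposition:
  fixes Y :: "'b::real_vector nspace" and Z :: "'a::real_vector nspace"
  assumes q: "1 \<le> q" and Y: "seminormed Y" and Z: "seminormed Z"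
    and YZ: "complemented Y Z" and ZY: "complemented (ell_sum q (\<lambda>_::nat. Z)) Y"
  shows "isomorphic Y (ell_sum q (\<lambda>_::nat. Z))"
proof -
  let ?L = "ell_sum q (\<lambda>_::nat. Z)"
  have L: "seminormed ?L" by (rule LZ[OF q Z])
  obtain J P where J: "bounded_map Y Z J" and P: "bounded_map Z Y P" and PJ: "\<And>y. y \<in> vecs Y \<Longrightarrow> P (J y) = y"
    using YZ unfolding complemented_def by blast
  obtain J' P' where J': "bounded_map ?L Y J'" and P': "bounded_map Y ?L P'" and PJ': "\<And>v. v \<in> vecs ?L \<Longrightarrow> P' (J' v) = v"
    using ZY unfolding complemented_def by blast
  note lJ = linear_add[OF bounded_map_linear[OF J]] linear_diff[OF bounded_map_linear[OF J]] linear_0[OF bounded_map_linear[OF J]]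
  note lP = linear_add[OF bounded_map_linear[OF P]] linear_diff[OF bounded_map_linear[OF P]] linear_0[OF bounded_map_linear[OF P]]
  note lJ' = linear_add[OF bounded_map_linear[OF J']] linear_diff[OF bounded_map_linear[OF J']]
  note lP' = linear_add[OF bounded_map_linear[OF P']] linear_diff[OF bounded_map_linear[OF P']]
  define JP where "JP = (\<lambda>z. J (P z))"
  define Q where "Q = (\<lambda>z. z - JP z)"
  define ev where "ev = (\<lambda>(v::nat \<Rightarrow> 'a) n. v (2 * n))"
  define od where "od = (\<lambda>(v::nat \<Rightarrow> 'a) n. v (2 * n + 1))"
  define mg where "mg = (\<lambda>(v::nat \<Rightarrow> 'a) w n. if even n then v (n div 2) else w (n div 2))"
  define first where "first = (\<lambda>(z::'a) (n::nat). if n = 0 then z else 0)"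
  define sh where "sh = (\<lambda>(v::nat \<Rightarrow> 'a) n. case n of 0 \<Rightarrow> 0 | Suc k \<Rightarrow> v k)"
  have inj2: "inj (\<lambda>n::nat. 2 * n)" "inj (\<lambda>n::nat. 2 * n + 1)" "inj Suc" by (auto simp: inj_on_def)
  have JPb: "bounded_map Z Z JP" unfolding JP_def by (rule bounded_map_compose[OF P J])
  have Qb: "bounded_map Z Z Q" unfolding Q_def by (rule bounded_map_diff[OF bounded_map_id JPb Z])
  have evb: "bounded_map ?L ?L ev" unfolding ev_def by (rule bounded_map_pull[OF q Z inj2(1)])
  have odb: "bounded_map ?L ?L od" unfolding od_def by (rule bounded_map_pull[OF q Z inj2(2)])
  have shb: "bounded_map ?L ?L sh"
  proof -
    have "sh = (\<lambda>v n. if n \<in> range Suc then v (inv Suc n) else 0)"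
      by (auto simp: sh_def fun_eq_iff inv_f_f[OF inj2(3)] split: nat.split)
    then show ?thesis using bounded_map_push[OF q Z inj2(3)] by (simp only:)
  qed
  have mgb: "bounded_map X ?L (\<lambda>x. mg (F x) (G x))"
    if F: "bounded_map X ?L F" and G: "bounded_map X ?L G" for F G and X :: "'c::real_vector nspace"
  proof -
    let ?p = "\<lambda>r (v::nat \<Rightarrow> 'a) n. if n \<in> range r then v (inv r n) else 0"
    have rg: "n \<in> range (\<lambda>n::nat. 2 * n) \<longleftrightarrow> even n" "n \<in> range (\<lambda>n::nat. 2 * n + 1) \<longleftrightarrow> odd n" for n
      unfolding image_iff by (auto elim: evenE oddE)
    have i: "inv (\<lambda>n::nat. 2 * n) n = n div 2" if "even n" for n
      using that by (intro inv_f_eq[OF inj2(1)]) auto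
    have j: "inv (\<lambda>n::nat. 2 * n + 1) n = n div 2" if "odd n" for n
      using that by (intro inv_f_eq[OF inj2(2)]) auto
    have "mg (F x) (G x) = ?p (\<lambda>n. 2 * n) (F x) + ?p (\<lambda>n. 2 * n + 1) (G x)" for x
      unfolding rg by (auto simp: mg_def fun_eq_iff i j simp del: One_nat_def)
    moreover have "bounded_map X ?L (\<lambda>x. ?p (\<lambda>n. 2 * n) (F x) + ?p (\<lambda>n. 2 * n + 1) (G x))"
      by (intro bounded_map_add L bounded_map_compose[OF F bounded_map_push[OF q Z inj2(1)]]
          bounded_map_compose[OF G bounded_map_push[OF q Z inj2(2)]])
    ultimately show ?thesis by (simp only:)
  qed
  \<comment> \<open>\<open>y - J' (P' y)\<close> is the part of y outside the copy of the q-sum. The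
    even terms of \<open>P' y\<close> refill that copy, the odd terms serve as z.\<close>
  define T where "T = (\<lambda>y. first (J (y - J' (P' y) + J' (ev (P' y)))) + (\<lambda>n. Q (od (P' y) n)) + sh (\<lambda>n. JP (od (P' y) n)))"
  \<comment> \<open>The inverse reads y off as P (v 0), z n as Q (v n) + JP (v (Suc n)), and merges
    both back into one sequence.\<close>
  define yc where "yc = (\<lambda>v::nat \<Rightarrow> 'a. P (v 0))"
  define zc where "zc = (\<lambda>v::nat \<Rightarrow> 'a. (\<lambda>n. Q (v n)) + (\<lambda>n. JP (v (Suc n))))"
  define S where "S = (\<lambda>v. yc v - J' (P' (yc v)) + J' (mg (P' (yc v)) (zc v)))"
  have Tb: "bounded_map Y ?L T"
    unfolding T_def first_def
    by (intro bounded_map_add L Y bounded_map_compose[OF _ bounded_map_first[OF q Z]]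
        bounded_map_compose[OF _ J] bounded_map_diff bounded_map_id
        bounded_map_compose[OF P' J'] bounded_map_compose[OF bounded_map_compose[OF P' evb] J']
        bounded_map_compose[OF bounded_map_compose[OF P' odb] bounded_map_coordinatewise[OF q Z Qb]]
        bounded_map_compose[OF bounded_map_compose[OF bounded_map_compose[OF P' odb] bounded_map_coordinatewise[OF q Z JPb]] shb])
  have ycb: "bounded_map ?L Y yc" unfolding yc_def by (rule bounded_map_compose[OF bounded_map_coordinate[OF q Z] P])
  have zcb: "bounded_map ?L ?L zc" unfolding zc_def
    by (intro bounded_map_add L bounded_map_coordinatewise[OF q Z Qb]
        bounded_map_compose[OF bounded_map_pull[OF q Z inj2(3)] bounded_map_coordinatewise[OF q Z JPb]])
  have Sb: "bounded_map ?L Y S" unfolding S_def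
    by (intro bounded_map_add bounded_map_diff Y ycb bounded_map_compose[OF _ J']
        mgb bounded_map_compose[OF ycb P'] zcb)
  have memP: "P z \<in> vecs Y" if "z \<in> vecs Z" for z by (rule bounded_map_mem[OF P that])
  have PJP: "P (JP z) = P z" if "z \<in> vecs Z" for z unfolding JP_def by (rule PJ[OF memP[OF that]])
  have PQ: "P (Q z) = 0" if "z \<in> vecs Z" for z unfolding Q_def by (simp add: lP PJP[OF that])
  have JPQ: "JP (Q z) = 0" if "z \<in> vecs Z" for z unfolding JP_def by (simp add: PQ[OF that] lJ)
  have QQ: "Q (Q z) = Q z" if "z \<in> vecs Z" for z using JPQ[OF that] by (simp add: Q_def)
  have JPJP: "JP (JP z) = JP z" if "z \<in> vecs Z" for z using PJP[OF that] by (simp add: JP_def)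
  have QJP: "Q (JP z) = 0" if "z \<in> vecs Z" for z by (simp add: Q_def JPJP[OF that])
  have JPJ: "JP (J y) = J y" if "y \<in> vecs Y" for y by (simp add: JP_def PJ[OF that])
  have QJ: "Q (J y) = 0" if "y \<in> vecs Y" for y by (simp add: Q_def JPJ[OF that])
  have JP_add: "JP (a + b) = JP a + JP b" for a b by (simp add: JP_def lP lJ)
  have Q_add: "Q (a + b) = Q a + Q b" for a b by (simp add: Q_def JP_add)
  have QJPsum: "Q z + JP z = z" for z by (simp add: Q_def)
  show ?thesis unfolding isomorphic_def
  proof (intro exI[of _ T] exI[of _ S] conjI Tb Sb ballI)
    fix y assume y: "y \<in> vecs Y"
    define w where "w = P' y"
    have w: "w \<in> vecs ?L" unfolding w_def by (rule bounded_map_mem[OF P' y])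
    have evw: "ev w \<in> vecs ?L" by (rule bounded_map_mem[OF evb w])
    have zm: "od w n \<in> vecs Z" for n using bounded_map_mem[OF odb w] by (rule LZ_mem[OF q Z])
    define y1 where "y1 = y - J' w + J' (ev w)"
    have y1: "y1 \<in> vecs Y" unfolding y1_def
      by (intro seminormed.add_mem[OF Y] seminormed.diff_mem[OF Y] y bounded_map_mem[OF J'] w evw)
    have T0: "T y 0 = J y1 + Q (od w 0)" by (simp add: T_def first_def sh_def y1_def w_def)
    have TS: "T y (Suc n) = Q (od w (Suc n)) + JP (od w n)" for n by (simp add: T_def first_def sh_def w_def)
    have yc: "yc (T y) = y1" unfolding yc_def T0 by (simp add: lP PJ[OF y1] PQ[OF zm])
    have zc: "zc (T y) = od w"
    proof
      fix n show "zc (T y) n = od w n"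
        by (cases n) (simp_all add: zc_def T0 TS Q_add JP_add QQ[OF zm] QJ[OF y1] QJP[OF zm] JPQ[OF zm] JPJP[OF zm] QJPsum)
    qed
    have P'y1: "P' y1 = ev w" unfolding y1_def by (simp add: lP' PJ'[OF w] PJ'[OF evw] w_def[symmetric])
    have mg: "mg (ev w) (od w) = w"
      by (auto simp: mg_def ev_def od_def fun_eq_iff)
    show "S (T y) = y" unfolding S_def yc zc P'y1 mg by (simp add: y1_def)
  next
    fix v assume v: "v \<in> vecs ?L"
    define y1 where "y1 = yc v"
    define z where "z = zc v"
    have y1: "y1 \<in> vecs Y" unfolding y1_def by (rule bounded_map_mem[OF ycb v])
    have z: "z \<in> vecs ?L" unfolding z_def by (rule bounded_map_mem[OF zcb v])
    define u where "u = mg (P' y1) z"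
    have u: "u \<in> vecs ?L" unfolding u_def y1_def z_def by (rule bounded_map_mem[OF mgb[OF bounded_map_compose[OF ycb P'] zcb] v])
    have Py1: "P' y1 \<in> vecs ?L" by (rule bounded_map_mem[OF P' y1])
    have Sv: "S v = y1 - J' (P' y1) + J' u" by (simp only: S_def y1_def z_def u_def)
    have PS: "P' (S v) = u" unfolding Sv by (simp add: lP' PJ'[OF Py1] PJ'[OF u])
    have evu: "ev u = P' y1" by (auto simp: ev_def u_def mg_def)
    have odu: "od u = z" by (auto simp: od_def u_def mg_def)
    have vm: "v n \<in> vecs Z" for n using v by (rule LZ_mem[OF q Z])
    have y1': "S v - J' u + J' (P' y1) = y1" by (simp add: Sv)
    show "T (S v) = v"
    proof
      fix n show "T (S v) n = v n"
      proof (cases n)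
        case 0
        have "T (S v) 0 = J y1 + Q (z 0)" unfolding T_def PS evu odu y1' by (simp add: first_def sh_def)
        also have "\<dots> = JP (v 0) + Q (v 0)"
          by (simp add: y1_def yc_def z_def zc_def Q_add QQ[OF vm] QJP[OF vm]) (simp add: JP_def)
        finally show ?thesis using 0 by (simp add: Q_def)
      next
        case (Suc k)
        have "T (S v) (Suc k) = Q (z (Suc k)) + JP (z k)" unfolding T_def PS evu odu y1' by (simp add: first_def sh_def)
        also have "\<dots> = Q (v (Suc k)) + JP (v (Suc k))"
          by (simp add: z_def zc_def Q_add JP_add QQ[OF vm] QJP[OF vm] JPQ[OF vm] JPJP[OF vm])
        finally show ?thesis using Suc by (simp add: Q_def)
      qed
    qed
  qed
qed

section \<open>Averages over dyadic blocks\<close>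

text \<open>The conditional expectation onto the dyadic blocks of length 2^l; \<omega> div 2^l is
  the number of the block that contains \<omega>.\<close>

definition block_avg :: "nat \<Rightarrow> (nat \<Rightarrow> real) \<Rightarrow> nat \<Rightarrow> real" where
  "block_avg l g \<omega> = (\<Sum>i<2^l. g (\<omega> div 2^l * 2^l + i)) / 2^l"

lemma sum_blocks: "(\<Sum>\<omega><B * L. F \<omega>) = (\<Sum>b<B. \<Sum>i<L. F (b * L + i))" for F :: "nat \<Rightarrow> real"
proof -
  have "(\<Sum>b<B. \<Sum>i<L. F (b * L + i)) = (\<Sum>b<B. sum F {b * L..<b * L + L})"
  proof (rule sum.cong[OF refl])
    fix b
    show "(\<Sum>i<L. F (b * L + i)) = sum F {b * L..<b * L + L}"
      using sum.shift_bounds_nat_ivl[of F 0 "b * L" L] by (simp add: atLeast0LessThan add.commute)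
  qed
  also have "\<dots> = sum F {..<B * L}" by (rule sum.nat_group)
  finally show ?thesis by simp
qed

lemma div_block: "i < L \<Longrightarrow> (b * L + i) div L = b" for b :: nat
  by simp

text \<open>A range of length M * 2^n consists of whole blocks at every level l \<le> n. The
  averaging inequalities run over such ranges so that no block is cut off.\<close>

lemma sum_blocks_level:
  fixes F :: "nat \<Rightarrow> real"
  assumes "l \<le> n"
  shows "(\<Sum>\<omega><M * 2^n. F \<omega>) = (\<Sum>b<M * 2^(n-l). \<Sum>i<2^l. F (b * 2^l + i))"
proof -
  have "M * 2^n = M * 2^(n-l) * (2::nat)^l" using assms by (simp add: power_add[symmetric])
  then show ?thesis by (simp only: sum_blocks)
qed

lemma block_avg_self_adjoint:
  assumes "l \<le> n"
  shows "(\<Sum>\<omega><M * 2^n. block_avg l g \<omega> * h \<omega>) = (\<Sum>\<omega><M * 2^n. g \<omega> * block_avg l h \<omega>)"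
  unfolding sum_blocks_level[OF assms]
proof (rule sum.cong[OF refl])
  fix b
  have "(\<Sum>i<2^l. block_avg l g (b * 2^l + i) * h (b * 2^l + i))
      = (\<Sum>i<2^l. (\<Sum>j<2^l. g (b * 2^l + j)) / 2^l * h (b * 2^l + i))"
    by (intro sum.cong) (auto simp: block_avg_def div_block)
  also have "\<dots> = (\<Sum>i<2^l. g (b * 2^l + i) * ((\<Sum>j<2^l. h (b * 2^l + j)) / 2^l))"
    unfolding sum_distrib_left[symmetric] sum_distrib_right[symmetric] by simp
  also have "\<dots> = (\<Sum>i<2^l. g (b * 2^l + i) * block_avg l h (b * 2^l + i))"
    by (intro sum.cong) (auto simp: block_avg_def div_block)
  finally show "(\<Sum>i<2^l. block_avg l g (b * 2^l + i) * h (b * 2^l + i)) = (\<Sum>i<2^l. g (b * 2^l + i) * block_avg l h (b * 2^l + i))" .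
qed

definition block_const :: "nat \<Rightarrow> (nat \<Rightarrow> real) \<Rightarrow> bool" where
  "block_const l h \<longleftrightarrow> (\<forall>\<omega> \<omega>'. \<omega> div 2^l = \<omega>' div 2^l \<longrightarrow> h \<omega> = h \<omega>')"

lemma block_avg_const:
  assumes "block_const l h" shows "block_avg l h \<omega> = h \<omega>"
proof -
  have "h (\<omega> div 2^l * 2^l + i) = h \<omega>" if "i < 2^l" for i
    using assms that div_block[OF that, of "\<omega> div 2^l"] unfolding block_const_def by metis
  then show ?thesis by (simp add: block_avg_def)
qed

lemma block_const_avg: "l \<le> k \<Longrightarrow> block_const l (block_avg k g)"
proof -
  assume "l \<le> k"
  then have "\<omega> div 2^k = \<omega> div 2^l div 2^(k-l)" for \<omega> :: nat
    by (simp add: div_mult2_eq[symmetric] power_add[symmetric])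
  then show ?thesis unfolding block_const_def block_avg_def by simp
qed

lemma block_avg_nonneg: "(\<And>\<omega>. 0 \<le> g \<omega>) \<Longrightarrow> 0 \<le> block_avg l g \<omega>"
  unfolding block_avg_def by (intro divide_nonneg_nonneg sum_nonneg) auto

lemma block_avg_powr_le:
  assumes "1 \<le> s"
  shows "\<bar>block_avg l g \<omega>\<bar> powr s \<le> block_avg l (\<lambda>\<omega>. \<bar>g \<omega>\<bar> powr s) \<omega>"
proof -
  let ?b = "\<omega> div 2^l * 2^l" and ?L = "2^l :: real"
  have "\<bar>block_avg l g \<omega>\<bar> powr s \<le> ((\<Sum>i<2^l. \<bar>g (?b + i)\<bar>) / ?L) powr s"
    unfolding block_avg_def using assms by (intro powr_mono2) (auto intro!: divide_right_mono simp: abs_divide)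
  also have "\<dots> = (\<Sum>i<2^l. \<bar>g (?b + i)\<bar>) powr s / ?L powr s" by (simp add: powr_divide sum_nonneg)
  also have "\<dots> \<le> (?L powr (s - 1) * (\<Sum>i<2^l. \<bar>g (?b + i)\<bar> powr s)) / ?L powr s"
    using powr_sum_le[of "{..<2^l}" s "\<lambda>i. \<bar>g (?b + i)\<bar>"] assms by (intro divide_right_mono) auto
  also have "\<dots> = block_avg l (\<lambda>\<omega>. \<bar>g \<omega>\<bar> powr s) \<omega>"
    by (simp add: block_avg_def powr_diff)
  finally show ?thesis .
qed

text \<open>The tangent inequality at x. Obtained from Young's inequality instead of a derivative,
  it covers y = 0 as well.\<close>

lemma powr_diff_le:
  assumes "1 \<le> (r::real)" "0 \<le> y" "y \<le> x"
  shows "x powr r - y powr r \<le> r * x powr (r - 1) * (x - y)"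
proof (cases "r = 1 \<or> x = 0")
  case True then show ?thesis using assms by (cases "x = 0") auto
next
  case False
  then have r: "1 < r" and x: "0 < x" using assms by auto
  have "y * x powr (r - 1) \<le> y powr r / r + (x powr (r - 1)) powr (r / (r - 1)) / (r / (r - 1))"
    using r assms by (intro Youngs_inequality) (auto simp: field_simps)
  then have "r * (y * x powr (r - 1)) \<le> r * (y powr r / r + x powr r / (r / (r - 1)))"
    using r by (intro mult_left_mono) (auto simp: powr_powr)
  also have "\<dots> = y powr r + (r - 1) * x powr r" using r by (simp add: field_simps)
  finally have "x powr r - y powr r \<le> r * x powr r - r * (y * x powr (r - 1))" by (simp add: algebra_simps)
  also have "\<dots> = r * x powr (r - 1) * (x - y)"
  proof -
    have "x powr r = x powr (r - 1) * x" using x by (simp add: powr_diff)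
    then show ?thesis by (simp add: algebra_simps)
  qed
  finally show ?thesis .
qed

text \<open>Adding the averages from the coarsest level on makes the
  partial sums \<open>A l\<close> constant on the blocks of level \<open>l\<close>.\<close>

lemma dual_doob:
  fixes f :: "nat \<Rightarrow> nat \<Rightarrow> real"
  assumes r: "1 \<le> r" and f: "\<And>l \<omega>. 0 \<le> f l \<omega>"
  shows "(\<Sum>\<omega><M * 2^n. (\<Sum>l\<le>n. block_avg l (f l) \<omega>) powr r) \<le> r powr r * (\<Sum>\<omega><M * 2^n. (\<Sum>l\<le>n. f l \<omega>) powr r)"
proof -
  define A where "A = (\<lambda>l \<omega>. \<Sum>k\<in>{l..n}. block_avg k (f k) \<omega>)"
  define F where "F = (\<lambda>\<omega>. \<Sum>l\<le>n. f l \<omega>)"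
  have avg: "0 \<le> block_avg k (f k) \<omega>" for k \<omega> using f by (intro block_avg_nonneg)
  have A0: "0 \<le> A l \<omega>" for l \<omega> unfolding A_def using avg by (intro sum_nonneg)
  have A_step: "A l \<omega> = block_avg l (f l) \<omega> + A (Suc l) \<omega>" if "l \<le> n" for l \<omega>
    unfolding A_def using that by (simp add: sum.atLeast_Suc_atMost)
  have A_le: "A l \<omega> \<le> A 0 \<omega>" for l \<omega> unfolding A_def using avg by (intro sum_mono2) auto
  have Abc: "block_const l (\<lambda>\<omega>. A l \<omega> powr (r - 1))" for l
    unfolding block_const_def
  proof (intro allI impI)
    fix \<omega> \<omega>' :: nat assume eq: "\<omega> div 2^l = \<omega>' div 2^l"
    have "block_avg k (f k) \<omega> = block_avg k (f k) \<omega>'" if "l \<le> k" for k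
      using block_const_avg[OF that, unfolded block_const_def, rule_format, OF eq] .
    then have "A l \<omega> = A l \<omega>'" unfolding A_def by (intro sum.cong) simp_all
    then show "A l \<omega> powr (r - 1) = A l \<omega>' powr (r - 1)" by simp
  qed
  have F0: "0 \<le> F \<omega>" for \<omega> unfolding F_def using f by (intro sum_nonneg)
  define T where "T = (\<Sum>\<omega><M * 2^n. A 0 \<omega> powr r)"
  define G where "G = (\<Sum>\<omega><M * 2^n. F \<omega> powr r)"
  have "T = (\<Sum>\<omega><M * 2^n. \<Sum>l\<le>n. A l \<omega> powr r - A (Suc l) \<omega> powr r)"
    unfolding T_def
  proof (rule sum.cong[OF refl])
    fix \<omega>
    have "A (Suc n) \<omega> = 0" by (simp add: A_def)
    then show "A 0 \<omega> powr r = (\<Sum>l\<le>n. A l \<omega> powr r - A (Suc l) \<omega> powr r)"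
      unfolding sum_telescope[of "\<lambda>l. A l \<omega> powr r"] by simp
  qed
  also have "\<dots> \<le> (\<Sum>\<omega><M * 2^n. \<Sum>l\<le>n. r * (A l \<omega> powr (r - 1) * block_avg l (f l) \<omega>))"
  proof (intro sum_mono)
    fix \<omega> l assume "l \<in> {..n}"
    then have "A l \<omega> - A (Suc l) \<omega> = block_avg l (f l) \<omega>" using A_step[of l \<omega>] by simp
    then show "A l \<omega> powr r - A (Suc l) \<omega> powr r \<le> r * (A l \<omega> powr (r - 1) * block_avg l (f l) \<omega>)"
      using powr_diff_le[OF r A0, of "Suc l" \<omega> "A l \<omega>"] avg[of l \<omega>] by (simp add: mult_ac)
  qed
  also have "\<dots> = r * (\<Sum>l\<le>n. \<Sum>\<omega><M * 2^n. block_avg l (f l) \<omega> * A l \<omega> powr (r - 1))"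
    by (subst sum.swap) (simp add: sum_distrib_left mult_ac)
  \<comment> \<open>The average moves over to \<open>A l \<omega> powr (r - 1)\<close>, which is
    constant on the blocks of level l, and so disappears.\<close>
  also have "\<dots> = r * (\<Sum>l\<le>n. \<Sum>\<omega><M * 2^n. f l \<omega> * A l \<omega> powr (r - 1))"
  proof -
    have "(\<Sum>\<omega><M * 2^n. block_avg l (f l) \<omega> * A l \<omega> powr (r - 1)) = (\<Sum>\<omega><M * 2^n. f l \<omega> * A l \<omega> powr (r - 1))"
      if "l \<in> {..n}" for l
      using block_avg_self_adjoint[of l n "f l" "\<lambda>\<omega>. A l \<omega> powr (r - 1)" M] that
      by (simp add: block_avg_const[OF Abc])
    then show ?thesis by (rule arg_cong[where f="\<lambda>z. r * z", OF sum.cong[OF refl]])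
  qed
  also have "\<dots> \<le> r * (\<Sum>l\<le>n. \<Sum>\<omega><M * 2^n. f l \<omega> * A 0 \<omega> powr (r - 1))"
    using r f A_le A0 by (intro mult_left_mono sum_mono powr_mono2) auto
  also have "\<dots> = r * (\<Sum>\<omega><M * 2^n. F \<omega> * A 0 \<omega> powr (r - 1))"
    unfolding F_def by (subst sum.swap) (simp add: sum_distrib_right)
  finally have T_le: "T \<le> r * (\<Sum>\<omega><M * 2^n. F \<omega> * A 0 \<omega> powr (r - 1))" .
  have "T \<le> r powr r * G"
  proof (cases "r = 1")
    case True
    have "(\<Sum>\<omega><M * 2^n. F \<omega> * A 0 \<omega> powr 0) \<le> (\<Sum>\<omega><M * 2^n. F \<omega>)"
      using F0 by (intro sum_mono) auto
    then show ?thesis using T_le True F0 by (simp add: G_def)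
  next
    case False
    then have r1: "1 < r" using r by simp
    have T0: "0 \<le> T" unfolding T_def by (intro sum_nonneg) auto
    have G0: "0 \<le> G" unfolding G_def by (intro sum_nonneg) auto
    \<comment> \<open>Hoelder's inequality brings T back with the power 1 - 1/r, which is below 1
      and can be divided out.\<close>
    have "(\<Sum>\<omega><M * 2^n. F \<omega> * A 0 \<omega> powr (r - 1))
        \<le> (\<Sum>\<omega><M * 2^n. F \<omega> powr r) powr (1/r) * (\<Sum>\<omega><M * 2^n. (A 0 \<omega> powr (r - 1)) powr (r / (r - 1))) powr (1 / (r / (r - 1)))"
      using r1 F0 by (intro holder_sum) (auto simp: field_simps)
    also have "(\<Sum>\<omega><M * 2^n. (A 0 \<omega> powr (r - 1)) powr (r / (r - 1))) = T"
      using r1 by (simp add: powr_powr T_def)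
    also have "1 / (r / (r - 1)) = 1 - 1 / r" using r1 by (simp add: field_simps)
    finally have "T \<le> r * (G powr (1/r) * T powr (1 - 1/r))"
      using T_le r1 by (simp add: G_def) (meson mult_left_mono order_trans less_imp_le zero_less_one less_trans)
    show ?thesis
    proof (cases "T = 0")
      case True then show ?thesis using G0 by simp
    next
      case False
      then have "0 < T" using T0 by simp
      then have "T powr (1 - 1/r) * T powr (1/r) \<le> T powr (1 - 1/r) * (r * G powr (1/r))"
        using \<open>T \<le> r * (G powr (1/r) * T powr (1 - 1/r))\<close> by (simp add: powr_add[symmetric] mult_ac)
      then have "T powr (1/r) \<le> r * G powr (1/r)" by (rule mult_left_le_imp_le) (use \<open>0 < T\<close> in simp)
      then have "(T powr (1/r)) powr r \<le> (r * G powr (1/r)) powr r" using r1 by (intro powr_mono2) auto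
      then show ?thesis using r1 T0 G0 by (simp add: powr_powr powr_mult)
    qed
  qed
  then show ?thesis unfolding T_def G_def F_def A_def by (simp add: atMost_atLeast0)
qed

text \<open>Jensen's inequality moves the power s inside the averages, and \<open>dual_doob\<close>
  applies with exponent q / s \<ge> 1.\<close>

lemma stein_le:
  assumes s: "1 \<le> s" "s \<le> q"
  shows "(\<Sum>\<omega><M * 2^n. nrm (ell (ereal s) (Suc n)) (\<lambda>l. block_avg l (v l) \<omega>) powr q)
    \<le> (q/s) powr (q/s) * (\<Sum>\<omega><M * 2^n. nrm (ell (ereal s) (Suc n)) (\<lambda>l. v l \<omega>) powr q)"
proof -
  have nq: "nrm (ell (ereal s) (Suc n)) x powr q = (\<Sum>l\<le>n. \<bar>x l\<bar> powr s) powr (q/s)" for x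
    by (simp add: nrm_ell_real powr_powr lessThan_Suc_atMost)
  have "(\<Sum>\<omega><M * 2^n. nrm (ell (ereal s) (Suc n)) (\<lambda>l. block_avg l (v l) \<omega>) powr q)
      \<le> (\<Sum>\<omega><M * 2^n. (\<Sum>l\<le>n. block_avg l (\<lambda>\<omega>. \<bar>v l \<omega>\<bar> powr s) \<omega>) powr (q/s))"
    unfolding nq using s by (intro sum_mono powr_mono2 block_avg_powr_le sum_nonneg) auto
  also have "\<dots> \<le> (q/s) powr (q/s) * (\<Sum>\<omega><M * 2^n. (\<Sum>l\<le>n. \<bar>v l \<omega>\<bar> powr s) powr (q/s))"
    using s by (intro dual_doob) auto
  finally show ?thesis unfolding nq .
qed

text \<open>The second exponent is real, which leaves out p = 1; that case has p \<le> q and falls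
  under \<open>stein_le\<close>.\<close>

definition conjugate_exponents :: "ereal \<Rightarrow> real \<Rightarrow> bool" where
  "conjugate_exponents p s \<longleftrightarrow> p = \<infinity> \<and> s = 1 \<or> (\<exists>t>1. p = ereal t \<and> s = t / (t - 1))"

lemma conjugate_exponents_ge_1: "conjugate_exponents p s \<Longrightarrow> 1 \<le> p \<and> 1 \<le> s"
  by (auto simp: conjugate_exponents_def one_ereal_def)

lemma ell_holder:
  assumes "conjugate_exponents p s" "0 < n"
  shows "(\<Sum>i<n. x i * y i) \<le> nrm (ell p n) x * nrm (ell (ereal s) n) y"
  using assms(1) unfolding conjugate_exponents_def
proof (elim disjE exE conjE)
  assume p: "p = \<infinity>" "s = 1"
  have "(\<Sum>i<n. x i * y i) \<le> (\<Sum>i<n. nrm (ell p n) x * \<bar>y i\<bar>)"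
  proof (rule sum_mono)
    fix i assume "i \<in> {..<n}"
    then have "\<bar>x i\<bar> \<le> nrm (ell p n) x" using assms(2) p by (intro ell_coord_le) auto
    then have "\<bar>x i\<bar> * \<bar>y i\<bar> \<le> nrm (ell p n) x * \<bar>y i\<bar>" by (intro mult_right_mono) auto
    then show "x i * y i \<le> nrm (ell p n) x * \<bar>y i\<bar>" using abs_ge_self[of "x i * y i"] by (simp add: abs_mult)
  qed
  then show ?thesis using p by (simp add: nrm_ell_real sum_distrib_left sum_nonneg)
next
  fix t assume t: "1 < t" "p = ereal t" "s = t / (t - 1)"
  have "(\<Sum>i<n. x i * y i) \<le> (\<Sum>i<n. \<bar>x i\<bar> * \<bar>y i\<bar>)"
    by (intro sum_mono) (simp flip: abs_mult)
  also have "\<dots> \<le> (\<Sum>i<n. \<bar>x i\<bar> powr t) powr (1/t) * (\<Sum>i<n. \<bar>y i\<bar> powr s) powr (1/s)"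
  proof -
    have "1 < t / (t - 1)" "1 / t + 1 / (t / (t - 1)) = 1" using t(1) by (simp_all add: field_simps)
    then show ?thesis unfolding t(3) using t(1) by (intro holder_sum) auto
  qed
  finally show ?thesis using t by (simp add: nrm_ell_real)
qed

text \<open>Equality in Hoelder's inequality: a signed unit vector at a largest coordinate if p =
  \<infinity>, otherwise the signs of x times (|x| / N)^(t - 1) with N the norm of x.\<close>

lemma ell_norming:
  assumes "conjugate_exponents p s" "0 < n"
  obtains w where "(\<Sum>i<n. x i * w i) = nrm (ell p n) x" "nrm (ell (ereal s) n) w \<le> 1"
  using assms(1) unfolding conjugate_exponents_def
proof (elim disjE exE conjE)
  assume p: "p = \<infinity>" "s = 1"
  have "Max ((\<lambda>i. \<bar>x i\<bar>) ` {..<n}) \<in> (\<lambda>i. \<bar>x i\<bar>) ` {..<n}"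
    using assms(2) by (intro Max_in) (auto simp: lessThan_empty_iff bot_nat_def)
  then obtain k where k: "k < n" "nrm (ell p n) x = \<bar>x k\<bar>" by (auto simp: p nrm_ell_infinity)
  define w where "w = (\<lambda>i. if i = k then sgn (x k) else 0)"
  have "(\<Sum>i<n. x i * w i) = (\<Sum>i<n. if i = k then x k * sgn (x k) else 0)"
    by (intro sum.cong) (auto simp: w_def)
  also have "\<dots> = \<bar>x k\<bar>" using k(1) by (simp add: abs_sgn)
  finally have 1: "(\<Sum>i<n. x i * w i) = nrm (ell p n) x" using k(2) by simp
  have "(\<Sum>i<n. \<bar>w i\<bar>) = (\<Sum>i<n. if i = k then \<bar>sgn (x k)\<bar> else 0)"
    by (intro sum.cong) (auto simp: w_def)
  also have "\<dots> \<le> 1" using k(1) by (simp add: sgn_real_def)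
  finally have "nrm (ell (ereal s) n) w \<le> 1" by (simp add: p nrm_ell_real sum_nonneg)
  with 1 show thesis by (rule that)
next
  fix t assume t: "1 < t" "p = ereal t" "s = t / (t - 1)"
  define N where "N = nrm (ell p n) x"
  have N0: "0 \<le> N" unfolding N_def using t assms(2) by (intro ell_nrm_nonneg) (auto simp: one_ereal_def)
  have Nt: "N powr t = (\<Sum>i<n. \<bar>x i\<bar> powr t)" using t by (simp add: N_def nrm_ell_real powr_powr sum_nonneg)
  show thesis
  proof (cases "N = 0")
    case True
    then show thesis using that[of "\<lambda>_. 0"] t by (simp add: N_def nrm_ell_real)
  next
    case False
    then have N: "0 < N" using N0 by simp
    define w where "w = (\<lambda>i. sgn (x i) * (\<bar>x i\<bar> / N) powr (t - 1))"
    have "(\<Sum>i<n. x i * w i) = (\<Sum>i<n. \<bar>x i\<bar> powr t / N powr (t - 1))"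
    proof (rule sum.cong[OF refl])
      fix i
      have "x i * w i = \<bar>x i\<bar> * \<bar>x i\<bar> powr (t - 1) / N powr (t - 1)"
        using N by (simp add: w_def powr_divide abs_sgn mult_ac)
      also have "\<bar>x i\<bar> * \<bar>x i\<bar> powr (t - 1) = \<bar>x i\<bar> powr t" by (cases "x i = 0") (simp_all add: powr_diff)
      finally show "x i * w i = \<bar>x i\<bar> powr t / N powr (t - 1)" .
    qed
    also have "\<dots> = N powr t / N powr (t - 1)" by (simp add: Nt sum_divide_distrib)
    also have "\<dots> = N" using N by (simp add: powr_diff)
    finally have 1: "(\<Sum>i<n. x i * w i) = nrm (ell p n) x" by (simp add: N_def)
    have "(\<Sum>i<n. \<bar>w i\<bar> powr s) \<le> (\<Sum>i<n. (\<bar>x i\<bar> / N) powr t)"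
    proof (rule sum_mono)
      fix i
      have "\<bar>w i\<bar> \<le> (\<bar>x i\<bar> / N) powr (t - 1)" by (simp add: w_def abs_mult sgn_real_def)
      then have "\<bar>w i\<bar> powr s \<le> ((\<bar>x i\<bar> / N) powr (t - 1)) powr s" using t by (intro powr_mono2) auto
      then show "\<bar>w i\<bar> powr s \<le> (\<bar>x i\<bar> / N) powr t" using t by (simp add: powr_powr)
    qed
    also have "\<dots> = N powr t / N powr t" unfolding Nt using N by (simp add: powr_divide sum_divide_distrib[symmetric] Nt)
    also have "\<dots> = 1" using N by simp
    finally have "nrm (ell (ereal s) n) w \<le> 1" using t by (simp add: nrm_ell_real powr_le1 sum_nonneg)
    with 1 show thesis by (rule that)
  qed
qed

text \<open>The averages are self-adjoint, so the estimate \<open>stein_le\<close> for s and q' = q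
  / (q - 1) passes to the conjugate pair p, q. This is where q > 1 is essential: q' has to be
  finite.\<close>

lemma stein_dual:
  assumes ps: "conjugate_exponents p s" and q: "1 < q" and s: "s \<le> q / (q - 1)"
  shows "\<exists>C. \<forall>M n v. (\<Sum>\<omega><M * 2^n. nrm (ell p (Suc n)) (\<lambda>l. block_avg l (v l) \<omega>) powr q)
    \<le> C * (\<Sum>\<omega><M * 2^n. nrm (ell p (Suc n)) (\<lambda>l. v l \<omega>) powr q)"
proof -
  define q' where "q' = q / (q - 1)"
  have q': "1 < q'" "1 / q + 1 / q' = 1" "(q - 1) * q' = q" using q by (auto simp: q'_def field_simps)
  have p: "1 \<le> p" "1 \<le> s" using conjugate_exponents_ge_1[OF ps] by auto
  define D where "D = (q'/s) powr (q'/s)"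
  have D: "0 \<le> D" by (simp add: D_def)
  show ?thesis
  proof (intro exI allI)
    fix M n v
    define u where "u = (\<lambda>\<omega> l. block_avg l (v l) \<omega>)"
    define N where "N = (\<lambda>\<omega>. nrm (ell p (Suc n)) (u \<omega>))"
    have N0: "0 \<le> N \<omega>" for \<omega> unfolding N_def by (rule ell_nrm_nonneg[OF p(1)]) simp
    have V0: "0 \<le> nrm (ell p (Suc n)) x" for x by (rule ell_nrm_nonneg[OF p(1)]) simp
    have s1: "1 \<le> ereal s" using p(2) by (simp add: one_ereal_def)
    have S0: "0 \<le> nrm (ell (ereal s) (Suc n)) x" for x by (rule ell_nrm_nonneg[OF s1]) simp
    have "\<exists>w. (\<Sum>i<Suc n. u \<omega> i * w i) = N \<omega> \<and> nrm (ell (ereal s) (Suc n)) w \<le> 1" for \<omega>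
      unfolding N_def by (rule ell_norming[OF ps, of "Suc n" "u \<omega>"]) auto
    then obtain w where w: "\<And>\<omega>. (\<Sum>i<Suc n. u \<omega> i * w \<omega> i) = N \<omega>" "\<And>\<omega>. nrm (ell (ereal s) (Suc n)) (w \<omega>) \<le> 1"
      by metis
    \<comment> \<open>The norming element of the mixed norm: at each \<omega> its pairing with u is
      N^q, and its norm to the power q' is at most N^q.\<close>
    define g where "g = (\<lambda>l \<omega>. N \<omega> powr (q - 1) * w \<omega> l)"
    define T where "T = (\<Sum>\<omega><M * 2^n. N \<omega> powr q)"
    define G where "G = (\<Sum>\<omega><M * 2^n. nrm (ell p (Suc n)) (\<lambda>l. v l \<omega>) powr q)"
    have T0: "0 \<le> T" and G0: "0 \<le> G" unfolding T_def G_def by (intro sum_nonneg; simp)+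
    have gn: "nrm (ell (ereal s) (Suc n)) (\<lambda>l. g l \<omega>) powr q' \<le> N \<omega> powr q" for \<omega>
    proof -
      have "nrm (ell (ereal s) (Suc n)) (\<lambda>l. g l \<omega>) = nrm (ell (ereal s) (Suc n)) (N \<omega> powr (q - 1) *\<^sub>R w \<omega>)"
        by (simp add: g_def scaleR_fun_def)
      also have "\<dots> = N \<omega> powr (q - 1) * nrm (ell (ereal s) (Suc n)) (w \<omega>)"
        by (subst ell_nrm_scale[OF s1]) auto
      also have "\<dots> \<le> N \<omega> powr (q - 1)" using w(2)[of \<omega>] by (simp add: mult_left_le)
      finally have "nrm (ell (ereal s) (Suc n)) (\<lambda>l. g l \<omega>) powr q' \<le> (N \<omega> powr (q - 1)) powr q'"
        using q' S0 by (intro powr_mono2) auto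
      then show ?thesis using q' by (simp add: powr_powr)
    qed
    have "T = (\<Sum>\<omega><M * 2^n. \<Sum>l\<le>n. u \<omega> l * g l \<omega>)"
      unfolding T_def
    proof (rule sum.cong[OF refl])
      fix \<omega>
      have "(\<Sum>l\<le>n. u \<omega> l * g l \<omega>) = N \<omega> powr (q - 1) * (\<Sum>i<Suc n. u \<omega> i * w \<omega> i)"
        by (simp add: g_def sum_distrib_left lessThan_Suc_atMost mult_ac)
      also have "\<dots> = N \<omega> powr q" unfolding w(1) using N0[of \<omega>] by (cases "N \<omega> = 0") (simp_all add: powr_diff)
      finally show "N \<omega> powr q = (\<Sum>l\<le>n. u \<omega> l * g l \<omega>)" by simp
    qed
    also have "\<dots> = (\<Sum>l\<le>n. \<Sum>\<omega><M * 2^n. block_avg l (v l) \<omega> * g l \<omega>)"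
      unfolding u_def by (rule sum.swap)
    also have "\<dots> = (\<Sum>l\<le>n. \<Sum>\<omega><M * 2^n. v l \<omega> * block_avg l (g l) \<omega>)"
      by (intro sum.cong refl block_avg_self_adjoint) auto
    also have "\<dots> = (\<Sum>\<omega><M * 2^n. \<Sum>l<Suc n. v l \<omega> * block_avg l (g l) \<omega>)"
      unfolding lessThan_Suc_atMost by (rule sum.swap)
    also have "\<dots> \<le> (\<Sum>\<omega><M * 2^n. nrm (ell p (Suc n)) (\<lambda>l. v l \<omega>) * nrm (ell (ereal s) (Suc n)) (\<lambda>l. block_avg l (g l) \<omega>))"
      by (intro sum_mono ell_holder[OF ps]) simp
    also have "\<dots> \<le> G powr (1/q) * (\<Sum>\<omega><M * 2^n. nrm (ell (ereal s) (Suc n)) (\<lambda>l. block_avg l (g l) \<omega>) powr q') powr (1/q')"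
      unfolding G_def using q q' V0 S0 by (intro holder_sum) auto
    also have "\<dots> \<le> G powr (1/q) * (D * T) powr (1/q')"
    proof (intro mult_left_mono powr_mono2)
      have "(\<Sum>\<omega><M * 2^n. nrm (ell (ereal s) (Suc n)) (\<lambda>l. block_avg l (g l) \<omega>) powr q')
          \<le> D * (\<Sum>\<omega><M * 2^n. nrm (ell (ereal s) (Suc n)) (\<lambda>l. g l \<omega>) powr q')"
        unfolding D_def using p(2) s by (intro stein_le) (auto simp: q'_def)
      also have "\<dots> \<le> D * T" unfolding T_def using gn D by (intro mult_left_mono sum_mono) auto
      finally show "(\<Sum>\<omega><M * 2^n. nrm (ell (ereal s) (Suc n)) (\<lambda>l. block_avg l (g l) \<omega>) powr q') \<le> D * T" .
    qed (use q' in \<open>auto intro: sum_nonneg\<close>)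
    finally have T_le: "T \<le> G powr (1/q) * (D powr (1/q') * T powr (1/q'))" using D T0 by (simp add: powr_mult)
    have "T \<le> D powr (q/q') * G"
    proof (cases "T = 0")
      case True then show ?thesis using G0 by simp
    next
      case False
      then have Tpos: "0 < T" using T0 by simp
      have "T powr (1/q') * T powr (1/q) = T powr (1/q + 1/q')" by (simp add: powr_add mult.commute)
      also have "\<dots> = T" using Tpos q'(2) by simp
      finally have "T powr (1/q') * T powr (1/q) \<le> T powr (1/q') * (D powr (1/q') * G powr (1/q))"
        using T_le by (simp add: mult_ac)
      then have "T powr (1/q) \<le> D powr (1/q') * G powr (1/q)"
        by (rule mult_left_le_imp_le) (use Tpos in simp)
      then have "(T powr (1/q)) powr q \<le> (D powr (1/q') * G powr (1/q)) powr q" using q by (intro powr_mono2) auto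
      then show ?thesis using q q' T0 G0 by (simp add: powr_powr powr_mult)
    qed
    then show "(\<Sum>\<omega><M * 2^n. nrm (ell p (Suc n)) (\<lambda>l. block_avg l (v l) \<omega>) powr q)
      \<le> D powr (q/q') * (\<Sum>\<omega><M * 2^n. nrm (ell p (Suc n)) (\<lambda>l. v l \<omega>) powr q)"
      unfolding T_def G_def N_def u_def .
  qed
qed

lemma stein_inequality:
  assumes p: "1 \<le> p" and q: "1 < q"
  obtains C where "0 < C" "\<And>M n v. (\<Sum>\<omega><M * 2^n. nrm (ell p (Suc n)) (\<lambda>l. block_avg l (v l) \<omega>) powr q)
    \<le> C * (\<Sum>\<omega><M * 2^n. nrm (ell p (Suc n)) (\<lambda>l. v l \<omega>) powr q)"
proof -
  have "\<exists>C. \<forall>M n v. (\<Sum>\<omega><M * 2^n. nrm (ell p (Suc n)) (\<lambda>l. block_avg l (v l) \<omega>) powr q)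
    \<le> C * (\<Sum>\<omega><M * 2^n. nrm (ell p (Suc n)) (\<lambda>l. v l \<omega>) powr q)"
    using p
  proof (cases rule: exponent_cases)
    case 1
    have "conjugate_exponents p 1" by (simp add: 1 conjugate_exponents_def)
    then show ?thesis using q by (intro stein_dual[where s=1]) (auto simp: field_simps)
  next
    case (2 t)
    \<comment> \<open>For t \<le> q the direct estimate applies; for t > q the conjugate exponents
      are in the opposite order, as duality requires.\<close>
    show ?thesis
    proof (cases "t \<le> q")
      case True
      then show ?thesis unfolding 2 using stein_le[OF 2(1) True] by blast
    next
      case False
      then have "conjugate_exponents p (t / (t - 1))" using 2 q by (auto simp: conjugate_exponents_def)
      moreover have "t / (t - 1) \<le> q / (q - 1)" using False q by (simp add: field_simps)
      ultimately show ?thesis using q by (intro stein_dual)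
    qed
  qed
  then obtain C where C: "\<And>M n v. (\<Sum>\<omega><M * 2^n. nrm (ell p (Suc n)) (\<lambda>l. block_avg l (v l) \<omega>) powr q)
    \<le> C * (\<Sum>\<omega><M * 2^n. nrm (ell p (Suc n)) (\<lambda>l. v l \<omega>) powr q)" by blast
  show thesis
  proof (rule that[of "max C 1"])
    fix M n :: nat and v :: "nat \<Rightarrow> nat \<Rightarrow> real"
    have "C * (\<Sum>\<omega><M * 2^n. nrm (ell p (Suc n)) (\<lambda>l. v l \<omega>) powr q) \<le> max C 1 * (\<Sum>\<omega><M * 2^n. nrm (ell p (Suc n)) (\<lambda>l. v l \<omega>) powr q)"
      by (intro mult_right_mono sum_nonneg) auto
    then show "(\<Sum>\<omega><M * 2^n. nrm (ell p (Suc n)) (\<lambda>l. block_avg l (v l) \<omega>) powr q)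
      \<le> max C 1 * (\<Sum>\<omega><M * 2^n. nrm (ell p (Suc n)) (\<lambda>l. v l \<omega>) powr q)"
      using C[where M=M and n=n and v=v] by linarith
  qed simp
qed

section \<open>The dyadic space\<close>

text \<open>With n - l stored in place of the line number n every triple is admissible, so the basis
  is indexed by all natural numbers.\<close>

definition code :: "nat \<Rightarrow> nat \<Rightarrow> nat \<Rightarrow> nat" where
  "code l d j = prod_encode (prod_encode (l, d), j)"

definition level :: "nat \<Rightarrow> nat" where "level k = fst (prod_decode (fst (prod_decode k)))"
definition colevel :: "nat \<Rightarrow> nat" where "colevel k = snd (prod_decode (fst (prod_decode k)))"
definition position :: "nat \<Rightarrow> nat" where "position k = snd (prod_decode k)"

lemma code_simps [simp]:
  "level (code l d j) = l" "colevel (code l d j) = d" "position (code l d j) = j"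
  "code (level k) (colevel k) (position k) = k"
  by (simp_all add: code_def level_def colevel_def position_def)

text \<open>A coordinate \<open>k\<close> stands for a dyadic block of length \<open>2 ^ level k\<close>, the block number
  \<open>position k\<close>, in the copy of the line with number \<open>n = level k + colevel k\<close>. A point of these
  lines is coded as \<open>prod_encode (\<omega>, n)\<close>.\<close>

definition spread :: "real \<Rightarrow> (nat \<Rightarrow> real) \<Rightarrow> nat \<Rightarrow> nat \<Rightarrow> real" where
  "spread q a m l = (let (\<omega>, n) = prod_decode m in
     if l \<le> n then 2 powr (- real l / q) * a (code l (n - l) (\<omega> div 2^l)) else 0)"

lemma spread_encode: "spread q a (prod_encode (\<omega>, n)) l =
    (if l \<le> n then 2 powr (- real l / q) * a (code l (n - l) (\<omega> div 2^l)) else 0)"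
  by (simp add: spread_def)

lemma linear_spread: "linear (spread q)"
proof (rule linearI)
  show "spread q (a + b) = spread q a + spread q b" for a b
    by (intro ext) (simp add: spread_def split: prod.split, simp add: algebra_simps)
  show "spread q (c *\<^sub>R a) = c *\<^sub>R spread q a" for c a
    by (intro ext) (simp add: spread_def split: prod.split)
qed

text \<open>Functions on the lines, with values in \<open>ell p (Suc n)\<close> on line n: each
  block size occurs once for every point \<omega>, hence infinitely often.\<close>

definition paired_sum :: "ereal \<Rightarrow> real \<Rightarrow> (nat \<Rightarrow> nat \<Rightarrow> real) nspace" where
  "paired_sum p q = ell_sum q (\<lambda>m. ell p (Suc (snd (prod_decode m))))"

text \<open>The block-constant functions in \<open>paired_sum\<close>, given by their coefficients;
  \<open>spread\<close> is the inclusion.\<close>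

definition dyadic_space :: "ereal \<Rightarrow> real \<Rightarrow> (nat \<Rightarrow> real) nspace" where
  "dyadic_space p q = \<lparr>vecs = {a. spread q a \<in> vecs (paired_sum p q)}, nrm = (\<lambda>a. nrm (paired_sum p q) (spread q a))\<rparr>"

lemma dyadic_space_vecs: "a \<in> vecs (dyadic_space p q) \<longleftrightarrow> spread q a \<in> vecs (paired_sum p q)"
  by (simp add: dyadic_space_def)

lemma dyadic_space_nrm: "nrm (dyadic_space p q) a = nrm (paired_sum p q) (spread q a)"
  by (simp add: dyadic_space_def)

text \<open>Both components of a pair are at most its code, so the pairs with code below M lie in
  the region on the right.\<close>

lemma sum_decode_le:
  fixes g :: "nat \<Rightarrow> nat \<Rightarrow> real"
  assumes "\<And>\<omega> n. 0 \<le> g \<omega> n" "\<And>n. M \<le> W n"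
  shows "(\<Sum>m<M. g (fst (prod_decode m)) (snd (prod_decode m))) \<le> (\<Sum>n<M. \<Sum>\<omega><W n. g \<omega> n)"
proof -
  let ?S = "SIGMA n:{..<M}. {..<W n}" and ?h = "\<lambda>m. (snd (prod_decode m), fst (prod_decode m))"
  have inj: "inj_on ?h {..<M}"
    by (rule inj_onI) (metis Pair_inject prod.collapse prod_decode_inverse)
  have sub: "?h ` {..<M} \<subseteq> ?S"
  proof
    fix z assume "z \<in> ?h ` {..<M}"
    then obtain m where m: "m < M" "z = ?h m" by auto
    have "fst (prod_decode m) \<le> m" "snd (prod_decode m) \<le> m"
      using le_prod_encode_1[of "fst (prod_decode m)" "snd (prod_decode m)"]
        le_prod_encode_2[of "snd (prod_decode m)" "fst (prod_decode m)"] by simp_all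
    then show "z \<in> ?S" using m assms(2)[of "snd (prod_decode m)"] by auto
  qed
  have "(\<Sum>m<M. g (fst (prod_decode m)) (snd (prod_decode m))) = (\<Sum>(n, \<omega>)\<in>?h ` {..<M}. g \<omega> n)"
    unfolding sum.reindex[OF inj] by simp
  also have "\<dots> \<le> (\<Sum>(n, \<omega>)\<in>?S. g \<omega> n)"
    using sub assms(1) by (intro sum_mono2) auto
  also have "\<dots> = (\<Sum>n<M. \<Sum>\<omega><W n. g \<omega> n)" by (subst sum.Sigma) auto
  finally show ?thesis .
qed

lemma sum_encode_le:
  fixes G :: "nat \<Rightarrow> real"
  assumes "\<And>I. finite I \<Longrightarrow> sum G I \<le> K"
  shows "(\<Sum>n<N. \<Sum>\<omega><W n. G (prod_encode (\<omega>, n))) \<le> K"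
proof -
  let ?S = "SIGMA n:{..<N}. {..<W n}" and ?h = "\<lambda>(n, \<omega>). prod_encode (\<omega>, n)"
  have inj: "inj_on ?h ?S" by (auto simp: inj_on_def)
  have "(\<Sum>n<N. \<Sum>\<omega><W n. G (prod_encode (\<omega>, n))) = (\<Sum>z\<in>?S. G (?h z))"
    by (subst sum.Sigma) (auto intro!: sum.cong)
  also have "\<dots> = sum G (?h ` ?S)" by (subst sum.reindex[OF inj]) simp
  also have "\<dots> \<le> K" by (rule assms) auto
  finally show ?thesis .
qed

context
  fixes p :: ereal and q :: real
  assumes p: "1 \<le> p" and q: "1 < q"
begin

abbreviation (input) XS where "XS \<equiv> ell_sum q (\<lambda>n. ell p (Suc n))"

lemma seminormed_XS: "seminormed XS"
  using q by (intro seminormed_ell_sum seminormed_ell p) auto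

lemma seminormed_paired_sum: "seminormed (paired_sum p q)"
  unfolding paired_sum_def using q by (intro seminormed_ell_sum seminormed_ell p) auto

lemma seminormed_dyadic_space: "seminormed (dyadic_space p q)"
proof -
  interpret P: seminormed "paired_sum p q" by (rule seminormed_paired_sum)
  note lin = linear_add[OF linear_spread] linear_scale[OF linear_spread] linear_0[OF linear_spread]
  show ?thesis
    by unfold_locales (simp_all only: dyadic_space_vecs dyadic_space_nrm lin P.zero_mem P.add_mem P.scale_mem P.nonneg P.triangle P.scale)
qed

text \<open>The estimate is asked over ranges M * 2^n, where Stein's inequality is available,
  instead of over initial segments of the codes.\<close>

lemma paired_sum_boundI:
  assumes "\<And>\<omega> n l. n < l \<Longrightarrow> v (prod_encode (\<omega>, n)) l = 0" "0 \<le> K"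
    and "\<And>M. (\<Sum>n<M. \<Sum>\<omega><M * 2^n. nrm (ell p (Suc n)) (v (prod_encode (\<omega>, n))) powr q) \<le> K powr q"
  shows "v \<in> vecs (paired_sum p q) \<and> nrm (paired_sum p q) v \<le> K"
proof -
  have "(\<Sum>m<M. nrm (ell p (Suc (snd (prod_decode m)))) (v m) powr q) \<le> K powr q" for M
  proof -
    have "(\<Sum>m<M. nrm (ell p (Suc (snd (prod_decode m)))) (v m) powr q)
        = (\<Sum>m<M. nrm (ell p (Suc (snd (prod_decode m)))) (v (prod_encode (fst (prod_decode m), snd (prod_decode m)))) powr q)"
      by simp
    also have "\<dots> \<le> (\<Sum>n<M. \<Sum>\<omega><M * 2^n. nrm (ell p (Suc n)) (v (prod_encode (\<omega>, n))) powr q)"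
      by (rule sum_decode_le) simp_all
    finally show ?thesis using assms(3)[of M] by linarith
  qed
  moreover have "v m \<in> vecs (ell p (Suc (snd (prod_decode m))))" for m
    using assms(1)[where \<omega>="fst (prod_decode m)" and n="snd (prod_decode m)"] by (simp add: ell_vecs)
  ultimately show ?thesis unfolding paired_sum_def
    using ell_sum_boundI[of q v "\<lambda>m. ell p (Suc (snd (prod_decode m)))" K] q assms(2) by simp
qed

lemma paired_sum_sums_le:
  assumes "v \<in> vecs (paired_sum p q)"
  shows "(\<Sum>n<N. \<Sum>\<omega><W n. nrm (ell p (Suc n)) (v (prod_encode (\<omega>, n))) powr q) \<le> nrm (paired_sum p q) v powr q"
  using sum_encode_le[where G="\<lambda>m. nrm (ell p (Suc (snd (prod_decode m)))) (v m) powr q" and K="nrm (paired_sum p q) v powr q" and N=N and W=W]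
    ell_sum_finite_le[of q v] assms q by (simp add: paired_sum_def)

lemma paired_sum_support:
  assumes "v \<in> vecs (paired_sum p q)" "n < l"
  shows "v (prod_encode (\<omega>, n)) l = 0"
proof -
  have "v (prod_encode (\<omega>, n)) \<in> vecs (ell p (Suc (snd (prod_decode (prod_encode (\<omega>, n))))))"
    using assms(1) unfolding paired_sum_def ell_sum_vecs by blast
  then show ?thesis using assms(2) by (simp add: ell_vecs)
qed

lemma snd_decode_le: "snd (prod_decode m) \<le> m"
  using le_prod_encode_2[of "snd (prod_decode m)" "fst (prod_decode m)"] by simp

text \<open>\<open>snd (prod_decode m) \<le> m\<close>, so the m-th block fits into the m-th block
  of the given space as its first coordinates; truncation is the projection.\<close>

lemma complemented_paired_sum_XS: "complemented (paired_sum p q) XS"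
  unfolding complemented_def
proof (intro exI conjI ballI)
  let ?n = "\<lambda>m. snd (prod_decode m)"
  let ?P = "\<lambda>(x::nat \<Rightarrow> nat \<Rightarrow> real) m l. if l \<le> ?n m then x m l else 0"
  have J: "v \<in> vecs XS \<and> nrm XS v \<le> 1 * nrm (paired_sum p q) v" if v: "v \<in> vecs (paired_sum p q)" for v
  proof -
    have vm: "v m \<in> vecs (ell p (Suc (?n m)))" for m using v unfolding paired_sum_def ell_sum_vecs by blast
    have eq: "nrm (ell p (Suc m)) (v m) = nrm (ell p (Suc (?n m))) (v m)" for m
      using vm[of m] snd_decode_le[of m] by (intro ell_nrm_extend[OF p]) (auto simp: ell_vecs)
    have "v m \<in> vecs (ell p (Suc m))" for m using vm[of m] snd_decode_le[of m] by (simp add: ell_vecs)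
    moreover have "(\<Sum>m<M. nrm (ell p (Suc m)) (v m) powr q) \<le> (1 * nrm (paired_sum p q) v) powr q" for M
      unfolding eq using ell_sum_finite_le[of q v "\<lambda>m. ell p (Suc (?n m))" "{..<M}"] v q by (simp add: paired_sum_def)
    ultimately show ?thesis
      using ell_sum_boundI[of q v "\<lambda>m. ell p (Suc m)" "1 * nrm (paired_sum p q) v"] q
        seminormed.nonneg[OF seminormed_paired_sum v] by simp
  qed
  have P: "?P x \<in> vecs (paired_sum p q) \<and> nrm (paired_sum p q) (?P x) \<le> 1 * nrm XS x" if x: "x \<in> vecs XS" for x
  proof -
    have "(\<Sum>m<M. nrm (ell p (Suc (?n m))) (?P x m) powr q) \<le> (1 * nrm XS x) powr q" for M
    proof -
      have "(\<Sum>m<M. nrm (ell p (Suc (?n m))) (?P x m) powr q) \<le> (\<Sum>m<M. nrm (ell p (Suc m)) (x m) powr q)"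
      proof (intro sum_mono powr_mono2 ell_Suc_nrm_nonneg[OF p])
        fix m
        have "nrm (ell p (Suc (?n m))) (?P x m) = nrm (ell p (Suc (?n m))) (x m)"
          by (intro ell_nrm_cong[OF p]) auto
        also have "\<dots> \<le> nrm (ell p (Suc m)) (x m)" using snd_decode_le[of m] by (intro ell_nrm_mono_dim[OF p]) auto
        finally show "nrm (ell p (Suc (?n m))) (?P x m) \<le> nrm (ell p (Suc m)) (x m)" .
      qed (use q in simp)
      also have "\<dots> \<le> (1 * nrm XS x) powr q"
        using ell_sum_finite_le[of q x "\<lambda>m. ell p (Suc m)" "{..<M}"] x q by simp
      finally show ?thesis .
    qed
    moreover have "?P x m \<in> vecs (ell p (Suc (?n m)))" for m by (simp add: ell_vecs)
    ultimately show ?thesis unfolding paired_sum_def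
      using ell_sum_boundI[of q "?P x" "\<lambda>m. ell p (Suc (?n m))" "1 * nrm XS x"] q
        seminormed.nonneg[OF seminormed_XS x] by simp
  qed
  show "bounded_map (paired_sum p q) XS (\<lambda>v. v)"
    using J by (intro bounded_mapI[where K=1] seminormed_paired_sum linear_id[unfolded id_def]) auto
  show "bounded_map XS (paired_sum p q) ?P"
    using P by (intro bounded_mapI[where K=1] seminormed_XS linear_funI) (auto simp: fun_eq_iff)
  fix v assume v: "v \<in> vecs (paired_sum p q)"
  show "?P v = v"
  proof (intro ext)
    fix m l show "?P v m l = v m l"
      using paired_sum_support[OF v, of "?n m" l "fst (prod_decode m)"] by simp
  qed
qed

text \<open>The n-th block of the k-th copy is placed at the point k of line n.\<close>

lemma complemented_iterated_paired_sum: "complemented (ell_sum q (\<lambda>_::nat. XS)) (paired_sum p q)"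
  unfolding complemented_def
proof (intro exI conjI ballI)
  let ?J = "\<lambda>(v::nat \<Rightarrow> nat \<Rightarrow> nat \<Rightarrow> real) m. v (fst (prod_decode m)) (snd (prod_decode m))"
  let ?P = "\<lambda>(x::nat \<Rightarrow> nat \<Rightarrow> real) k n. x (prod_encode (k, n))"
  let ?L = "ell_sum q (\<lambda>_::nat. XS)"
  have q0: "0 < q" using q by simp
  have L: "seminormed ?L" using q by (intro seminormed_ell_sum seminormed_XS) auto
  have J: "?J v \<in> vecs (paired_sum p q) \<and> nrm (paired_sum p q) (?J v) \<le> 1 * nrm ?L v" if v: "v \<in> vecs ?L" for v
  proof (rule paired_sum_boundI)
    have vk: "v k \<in> vecs XS" for k using v by (simp add: ell_sum_vecs)
    show "?J v (prod_encode (\<omega>, n)) l = 0" if "n < l" for \<omega> n l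
      using vk[of \<omega>] that by (simp add: ell_sum_vecs ell_vecs)
    show "0 \<le> 1 * nrm ?L v" using seminormed.nonneg[OF L v] by simp
    fix M
    define W where "W = M * 2 ^ M"
    have "(\<Sum>n<M. \<Sum>\<omega><M * 2^n. nrm (ell p (Suc n)) (?J v (prod_encode (\<omega>, n))) powr q)
        \<le> (\<Sum>n<M. \<Sum>\<omega><W. nrm (ell p (Suc n)) (v \<omega> n) powr q)"
    proof (rule sum_mono)
      fix n assume "n \<in> {..<M}"
      then have "(2::nat) ^ n \<le> 2 ^ M" by (intro power_increasing) auto
      then show "(\<Sum>\<omega><M * 2^n. nrm (ell p (Suc n)) (?J v (prod_encode (\<omega>, n))) powr q) \<le> (\<Sum>\<omega><W. nrm (ell p (Suc n)) (v \<omega> n) powr q)"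
        unfolding prod_encode_inverse fst_conv snd_conv by (intro sum_mono2) (auto simp: W_def intro: less_le_trans)
    qed
    also have "\<dots> = (\<Sum>\<omega><W. \<Sum>n<M. nrm (ell p (Suc n)) (v \<omega> n) powr q)" by (rule sum.swap)
    also have "\<dots> \<le> (\<Sum>\<omega><W. nrm XS (v \<omega>) powr q)" by (intro sum_mono ell_sum_finite_le q0 vk) simp
    also have "\<dots> \<le> nrm ?L v powr q" by (intro ell_sum_finite_le[OF q0 v]) simp
    finally show "(\<Sum>n<M. \<Sum>\<omega><M * 2^n. nrm (ell p (Suc n)) (?J v (prod_encode (\<omega>, n))) powr q) \<le> (1 * nrm ?L v) powr q" by simp
  qed
  have P: "?P x \<in> vecs ?L \<and> nrm ?L (?P x) \<le> 1 * nrm (paired_sum p q) x" if x: "x \<in> vecs (paired_sum p q)" for x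
  proof -
    let ?K = "nrm (paired_sum p q) x"
    have K: "0 \<le> ?K" by (rule seminormed.nonneg[OF seminormed_paired_sum x])
    have sums: "(\<Sum>n<N. \<Sum>k<W. nrm (ell p (Suc n)) (?P x k n) powr q) \<le> ?K powr q" for N W
      by (rule paired_sum_sums_le[OF x])
    have mem: "?P x k n \<in> vecs (ell p (Suc n))" for k n
      using paired_sum_support[OF x] by (simp add: ell_vecs)
    have one: "(\<Sum>n<N. nrm (ell p (Suc n)) (?P x k n) powr q) \<le> ?K powr q" for k N
    proof -
      have "(\<Sum>n<N. nrm (ell p (Suc n)) (?P x k n) powr q) \<le> (\<Sum>n<N. \<Sum>k<Suc k. nrm (ell p (Suc n)) (?P x k n) powr q)"
        by (intro sum_mono member_le_sum) auto
      then show ?thesis using sums[of "Suc k" N] by linarith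
    qed
    have PX: "?P x k \<in> vecs XS" for k by (rule ell_sum_boundI(1)[OF q0 mem K one])
    have summ: "summable (\<lambda>n. nrm (ell p (Suc n)) (?P x k n) powr q)" for k using PX[of k] unfolding ell_sum_vecs by blast
    have "(\<Sum>k<N. nrm XS (?P x k) powr q) \<le> ?K powr q" for N
    proof -
      have "(\<Sum>k<N. nrm XS (?P x k) powr q) = (\<Sum>k<N. \<Sum>n. nrm (ell p (Suc n)) (?P x k n) powr q)"
        by (intro sum.cong refl ell_sum_nrm_powr q0 PX)
      also have "\<dots> = (\<Sum>n. \<Sum>k<N. nrm (ell p (Suc n)) (?P x k n) powr q)"
        by (rule suminf_sum[OF summ, symmetric])
      also have "\<dots> \<le> ?K powr q" using sums by (intro suminf_le_const summable_sum summ)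
      finally show ?thesis .
    qed
    from ell_sum_boundI[where E="\<lambda>_. XS" and v="?P x", OF q0 PX K this] show ?thesis by simp
  qed
  show "bounded_map ?L (paired_sum p q) ?J"
    using J by (intro bounded_mapI[where K=1] L linear_funI) auto
  show "bounded_map (paired_sum p q) ?L ?P"
    using P by (intro bounded_mapI[where K=1] seminormed_paired_sum linear_funI) (auto simp: fun_eq_iff)
  show "?P (?J v) = v" for v by simp
qed

text \<open>\<open>x n\<close> becomes the function with constant value
  \<open>2 powr (- n / q) * x n\<close> on the first 2^n points of line n. Those points are made up
  of 2^(n - l) blocks of each level l \<le> n, so the function is block-constant. The projection
  averages over these points and rescales.\<close>

lemma complemented_XS_dyadic: "complemented XS (dyadic_space p q)"
  unfolding complemented_def
proof (intro exI conjI ballI)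
  let ?J = "\<lambda>(x::nat \<Rightarrow> nat \<Rightarrow> real) k. if position k < 2 ^ colevel k
    then 2 powr (- real (colevel k) / q) * x (level k + colevel k) (level k) else 0"
  let ?P = "\<lambda>a n l. 2 powr (real n / q) * ((\<Sum>\<omega><2^n. spread q a (prod_encode (\<omega>, n)) l) / 2^n)"
  have q0: "0 < q" using q by simp
  have SJ: "spread q (?J x) (prod_encode (\<omega>, n)) l = (if l \<le> n \<and> \<omega> < 2^n then 2 powr (- real n / q) * x n l else 0)" for x \<omega> n l
  proof (cases "l \<le> n")
    case True
    have e: "(2::nat) ^ n = 2 ^ (n - l) * 2 ^ l" using True by (simp add: power_add[symmetric])
    have iff: "\<omega> div 2^l < 2^(n-l) \<longleftrightarrow> \<omega> < 2^n"
      unfolding e by (rule div_less_iff_less_mult) simp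
    have pw: "2 powr (- real l / q) * 2 powr (- real (n - l) / q) = 2 powr (- real n / q)"
      using True q0 by (simp add: powr_add[symmetric] field_simps)
    then show ?thesis using True by (simp add: spread_encode iff)
  qed (simp add: spread_encode)
  have J: "?J x \<in> vecs (dyadic_space p q) \<and> nrm (dyadic_space p q) (?J x) \<le> 1 * nrm XS x" if x: "x \<in> vecs XS" for x
    unfolding dyadic_space_vecs dyadic_space_nrm
  proof (rule paired_sum_boundI)
    show "spread q (?J x) (prod_encode (\<omega>, n)) l = 0" if "n < l" for \<omega> n l using that by (simp add: spread_encode)
    show "0 \<le> 1 * nrm XS x" using seminormed.nonneg[OF seminormed_XS x] by simp
    fix M
    have xn: "x n \<in> vecs (ell p (Suc n))" for n using x by (simp add: ell_sum_vecs)
    have nn: "nrm (ell p (Suc n)) (spread q (?J x) (prod_encode (\<omega>, n))) powr q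
        = (if \<omega> < 2^n then (1 / 2^n) * nrm (ell p (Suc n)) (x n) powr q else 0)" for n \<omega>
    proof (cases "\<omega> < 2^n")
      case True
      have "spread q (?J x) (prod_encode (\<omega>, n)) = 2 powr (- real n / q) *\<^sub>R x n"
        using True xn[of n] by (auto simp: SJ fun_eq_iff ell_vecs not_le Suc_le_eq)
      then have "nrm (ell p (Suc n)) (spread q (?J x) (prod_encode (\<omega>, n))) = 2 powr (- real n / q) * nrm (ell p (Suc n)) (x n)"
        using ell_nrm_scale[OF p, of "Suc n" "2 powr (- real n / q)" "x n"] by (simp only: zero_less_Suc simp_thms) simp
      then show ?thesis using True q0 ell_Suc_nrm_nonneg[OF p]
        by (simp add: powr_mult powr_powr) (simp add: powr_minus powr_realpow divide_inverse)
    next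
      case False
      then have "spread q (?J x) (prod_encode (\<omega>, n)) = 0" by (intro ext) (simp add: SJ)
      then show ?thesis using False seminormed.nrm_zero[OF seminormed_ell[OF p, of "Suc n"]] by (simp only:) simp
    qed
    have "(\<Sum>n<M. \<Sum>\<omega><M * 2^n. nrm (ell p (Suc n)) (spread q (?J x) (prod_encode (\<omega>, n))) powr q)
        \<le> (\<Sum>n<M. nrm (ell p (Suc n)) (x n) powr q)"
    proof (rule sum_mono)
      fix n
      have "(\<Sum>\<omega><M * 2^n. nrm (ell p (Suc n)) (spread q (?J x) (prod_encode (\<omega>, n))) powr q)
          = (\<Sum>\<omega>\<in>{..<M * 2^n} \<inter> {..<(2::nat)^n}. (1 / 2^n) * nrm (ell p (Suc n)) (x n) powr q)"
        unfolding nn by (intro sum.mono_neutral_cong_right) auto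
      also have "\<dots> \<le> (\<Sum>\<omega><(2::nat)^n. (1 / 2^n) * nrm (ell p (Suc n)) (x n) powr q)"
        by (intro sum_mono2) auto
      also have "\<dots> = nrm (ell p (Suc n)) (x n) powr q" by simp
      finally show "(\<Sum>\<omega><M * 2^n. nrm (ell p (Suc n)) (spread q (?J x) (prod_encode (\<omega>, n))) powr q) \<le> nrm (ell p (Suc n)) (x n) powr q" .
    qed
    also have "\<dots> \<le> nrm XS x powr q" by (intro ell_sum_finite_le[OF q0 x]) simp
    finally show "(\<Sum>n<M. \<Sum>\<omega><M * 2^n. nrm (ell p (Suc n)) (spread q (?J x) (prod_encode (\<omega>, n))) powr q) \<le> (1 * nrm XS x) powr q" by simp
  qed
  have P: "?P a \<in> vecs XS \<and> nrm XS (?P a) \<le> 1 * nrm (dyadic_space p q) a" if a: "a \<in> vecs (dyadic_space p q)" for a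
  proof -
    define v where "v = spread q a"
    have v: "v \<in> vecs (paired_sum p q)" using a by (simp add: v_def dyadic_space_vecs)
    have bound: "nrm (ell p (Suc n)) (?P a n) powr q \<le> (\<Sum>\<omega><2^n. nrm (ell p (Suc n)) (v (prod_encode (\<omega>, n))) powr q)" for n
    proof -
      interpret B: seminormed "ell p (Suc n)" by (rule seminormed_ell[OF p]) simp
      have vm: "v (prod_encode (\<omega>, n)) \<in> vecs (ell p (Suc n))" for \<omega>
        using paired_sum_support[OF v] by (simp add: ell_vecs)
      let ?S = "\<Sum>\<omega><2^n. v (prod_encode (\<omega>, n))" and ?c = "2 powr (real n / q) / 2^n :: real"
      have S: "?S \<in> vecs (ell p (Suc n))" by (intro B.sum_mem vm)
      have eq: "?P a n = ?c *\<^sub>R ?S"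
        by (rule ext) (simp add: sum_fun_apply v_def)
      have "nrm (ell p (Suc n)) (?P a n) = ?c * nrm (ell p (Suc n)) ?S" unfolding eq by (subst B.scale[OF S]) simp
      also have "\<dots> \<le> ?c * (\<Sum>\<omega><2^n. nrm (ell p (Suc n)) (v (prod_encode (\<omega>, n))))"
        by (intro mult_left_mono B.nrm_sum_le vm) simp
      finally have "nrm (ell p (Suc n)) (?P a n) powr q
          \<le> (?c * (\<Sum>\<omega><2^n. nrm (ell p (Suc n)) (v (prod_encode (\<omega>, n))))) powr q"
        using q0 by (intro powr_mono2 ell_Suc_nrm_nonneg[OF p]) auto
      also have "\<dots> = ?c powr q * (\<Sum>\<omega><2^n. nrm (ell p (Suc n)) (v (prod_encode (\<omega>, n)))) powr q"
        using ell_Suc_nrm_nonneg[OF p] by (simp add: powr_mult powr_divide sum_nonneg)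
      also have "\<dots> \<le> ?c powr q * (real (card {..<(2::nat)^n}) powr (q - 1) * (\<Sum>\<omega><2^n. nrm (ell p (Suc n)) (v (prod_encode (\<omega>, n))) powr q))"
        using q ell_Suc_nrm_nonneg[OF p] by (intro mult_left_mono powr_sum_le) auto
      also have "\<dots> = (?c powr q * (2^n) powr (q - 1)) * (\<Sum>\<omega><2^n. nrm (ell p (Suc n)) (v (prod_encode (\<omega>, n))) powr q)"
        by simp
      \<comment> \<open>The first factor is 2^n / 2^(n q), and the second, from Jensen's inequality,
        is 2^(n (q - 1)).\<close>
      also have "?c powr q * (2^n) powr (q - 1) = 1"
      proof -
        have n2: "(2::real)^n = 2 powr real n" by (simp add: powr_realpow)
        show ?thesis unfolding n2 using q0
          by (simp add: powr_divide powr_powr powr_add[symmetric] powr_diff[symmetric] algebra_simps)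
      qed
      finally show ?thesis by simp
    qed
    have K: "0 \<le> nrm (dyadic_space p q) a" by (rule seminormed.nonneg[OF seminormed_dyadic_space a])
    have mem: "?P a n \<in> vecs (ell p (Suc n))" for n by (simp add: ell_vecs spread_encode)
    have "(\<Sum>n<N. nrm (ell p (Suc n)) (?P a n) powr q) \<le> nrm (dyadic_space p q) a powr q" for N
    proof -
      have "(\<Sum>n<N. nrm (ell p (Suc n)) (?P a n) powr q) \<le> (\<Sum>n<N. \<Sum>\<omega><2^n. nrm (ell p (Suc n)) (v (prod_encode (\<omega>, n))) powr q)"
        using bound by (rule sum_mono)
      also have "\<dots> \<le> nrm (dyadic_space p q) a powr q"
        unfolding dyadic_space_nrm v_def[symmetric] by (rule paired_sum_sums_le[OF v])
      finally show ?thesis .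
    qed
    from ell_sum_boundI[OF q0 mem K this] show ?thesis by simp
  qed
  show "bounded_map XS (dyadic_space p q) ?J"
    using J by (intro bounded_mapI[where K=1] seminormed_XS linear_funI) (auto simp: fun_eq_iff algebra_simps)
  have "linear ?P"
  proof (rule linearI)
    show "?P (a + b) = ?P a + ?P b" for a b
      unfolding linear_add[OF linear_spread]
      by (intro ext) (simp add: sum.distrib add_divide_distrib algebra_simps)
    show "?P (c *\<^sub>R a) = c *\<^sub>R ?P a" for c a
      unfolding linear_scale[OF linear_spread]
      by (intro ext) (simp add: sum_distrib_left[symmetric])
  qed
  then show "bounded_map (dyadic_space p q) XS ?P"
    using P by (intro bounded_mapI[where K=1] seminormed_dyadic_space) auto
  fix x assume x: "x \<in> vecs XS"
  show "?P (?J x) = x"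
  proof (intro ext)
    fix n l
    have z: "x n l = 0" if "n < l" using x that by (simp add: ell_sum_vecs ell_vecs)
    have "(\<Sum>\<omega><2^n. spread q (?J x) (prod_encode (\<omega>, n)) l) = (\<Sum>\<omega><(2::nat)^n. if l \<le> n then 2 powr (- real n / q) * x n l else 0)"
      unfolding SJ by (intro sum.cong) auto
    also have "\<dots> = 2^n * (if l \<le> n then 2 powr (- real n / q) * x n l else 0)" by simp
    finally have e: "(\<Sum>\<omega><2^n. spread q (?J x) (prod_encode (\<omega>, n)) l) = 2^n * (if l \<le> n then 2 powr (- real n / q) * x n l else 0)" .
    show "?P (?J x) n l = x n l"
      unfolding e using z by (cases "l \<le> n") (simp_all add: powr_minus)
  qed
qed

text \<open>The projection averages the l-th coordinate over the blocks of level l, and Stein's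
  inequality bounds it uniformly over all lines.\<close>

lemma complemented_dyadic_paired_sum: "complemented (dyadic_space p q) (paired_sum p q)"
  unfolding complemented_def
proof -
  obtain C where C: "0 < C" "\<And>M n v. (\<Sum>\<omega><M * 2^n. nrm (ell p (Suc n)) (\<lambda>l. block_avg l (v l) \<omega>) powr q)
      \<le> C * (\<Sum>\<omega><M * 2^n. nrm (ell p (Suc n)) (\<lambda>l. v l \<omega>) powr q)"
    using stein_inequality[OF p q] by blast
  have q0: "0 < q" using q by simp
  \<comment> \<open>\<open>position k * 2 ^ level k\<close> is the first point of the block k, and
    the power of 2 undoes the weight in \<open>spread\<close>.\<close>
  let ?P = "\<lambda>v k. 2 powr (real (level k) / q) *
    block_avg (level k) (\<lambda>\<omega>. v (prod_encode (\<omega>, level k + colevel k)) (level k)) (position k * 2 ^ level k)"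
  have SP: "spread q (?P v) (prod_encode (\<omega>, n)) l = (if l \<le> n then block_avg l (\<lambda>\<omega>. v (prod_encode (\<omega>, n)) l) \<omega> else 0)"
    for v :: "nat \<Rightarrow> nat \<Rightarrow> real" and \<omega> n l
  proof (cases "l \<le> n")
    case True
    have "2 powr (- real l / q) * 2 powr (real l / q) = (1::real)" by (simp add: powr_add[symmetric])
    then show ?thesis using True by (simp add: spread_encode block_avg_def mult.assoc[symmetric])
  qed (simp add: spread_encode)
  have PS: "?P (spread q a) = a" for a
  proof
    fix k
    have "block_avg (level k) (\<lambda>\<omega>. spread q a (prod_encode (\<omega>, level k + colevel k)) (level k)) (position k * 2 ^ level k)
        = spread q a (prod_encode (position k * 2 ^ level k, level k + colevel k)) (level k)"
      by (rule block_avg_const) (simp add: block_const_def spread_encode)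
    also have "\<dots> = 2 powr (- real (level k) / q) * a k" by (simp add: spread_encode)
    finally show "?P (spread q a) k = a k" by (simp add: powr_minus)
  qed
  have P: "?P v \<in> vecs (dyadic_space p q) \<and> nrm (dyadic_space p q) (?P v) \<le> C powr (1/q) * nrm (paired_sum p q) v"
    if v: "v \<in> vecs (paired_sum p q)" for v
    unfolding dyadic_space_vecs dyadic_space_nrm
  proof (rule paired_sum_boundI)
    let ?N = "nrm (paired_sum p q) v"
    have N: "0 \<le> ?N" by (rule seminormed.nonneg[OF seminormed_paired_sum v])
    then show "0 \<le> C powr (1/q) * ?N" by simp
    show "spread q (?P v) (prod_encode (\<omega>, n)) l = 0" if "n < l" for \<omega> n l using that by (simp add: spread_encode)
    fix M
    have "(\<Sum>n<M. \<Sum>\<omega><M * 2^n. nrm (ell p (Suc n)) (spread q (?P v) (prod_encode (\<omega>, n))) powr q)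
        = (\<Sum>n<M. \<Sum>\<omega><M * 2^n. nrm (ell p (Suc n)) (\<lambda>l. block_avg l (\<lambda>\<omega>. v (prod_encode (\<omega>, n)) l) \<omega>) powr q)"
      by (intro sum.cong refl arg_cong[where f="\<lambda>z. z powr q"] ell_nrm_cong[OF p]) (simp_all only: SP zero_less_Suc less_Suc_eq_le if_True)
    also have "\<dots> \<le> (\<Sum>n<M. C * (\<Sum>\<omega><M * 2^n. nrm (ell p (Suc n)) (v (prod_encode (\<omega>, n))) powr q))"
      by (rule sum_mono) (rule C(2))
    also have "\<dots> = C * (\<Sum>n<M. \<Sum>\<omega><M * 2^n. nrm (ell p (Suc n)) (v (prod_encode (\<omega>, n))) powr q)"
      by (simp add: sum_distrib_left)
    also have "\<dots> \<le> C * ?N powr q" using C(1) paired_sum_sums_le[OF v] by (intro mult_left_mono) auto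
    also have "\<dots> = (C powr (1/q) * ?N) powr q" using C(1) N q0 by (simp add: powr_mult powr_powr)
    finally show "(\<Sum>n<M. \<Sum>\<omega><M * 2^n. nrm (ell p (Suc n)) (spread q (?P v) (prod_encode (\<omega>, n))) powr q) \<le> (C powr (1/q) * ?N) powr q" .
  qed
  have "linear ?P"
  proof (rule linear_funI)
    show "?P (v + w) k = ?P v k + ?P w k" for v w k
      by (simp add: block_avg_def sum.distrib add_divide_distrib algebra_simps)
    show "?P (c *\<^sub>R v) k = c *\<^sub>R ?P v k" for c v k
      by (simp add: block_avg_def sum_distrib_left[symmetric])
  qed
  then have "bounded_map (paired_sum p q) (dyadic_space p q) ?P"
    using P by (intro bounded_mapI[where K="C powr (1/q)"] seminormed_paired_sum) auto
  moreover have "bounded_map (dyadic_space p q) (paired_sum p q) (spread q)"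
    by (intro bounded_mapI[where K=1] linear_spread seminormed_dyadic_space) (simp_all add: dyadic_space_vecs dyadic_space_nrm)
  ultimately show "\<exists>J P. bounded_map (dyadic_space p q) (paired_sum p q) J \<and> bounded_map (paired_sum p q) (dyadic_space p q) P
      \<and> (\<forall>x\<in>vecs (dyadic_space p q). P (J x) = x)"
    using PS by (intro exI[of _ "spread q"] exI[of _ ?P]) simp
qed

text \<open>The decomposition method is used twice: the given space and the dyadic space are both
  isomorphic to the q-sum of copies of the given space.\<close>

lemma isomorphic_XS_dyadic: "isomorphic (dyadic_space p q) XS"
proof -
  have q1: "1 \<le> q" using q by simp
  have LX: "complemented (ell_sum q (\<lambda>_::nat. XS)) XS"
    by (rule complemented_trans[OF complemented_iterated_paired_sum complemented_paired_sum_XS])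
  have "isomorphic XS (ell_sum q (\<lambda>_::nat. XS))"
    by (rule pelczynski_decomposition[OF q1 seminormed_XS seminormed_XS complemented_refl LX])
  moreover have "isomorphic (dyadic_space p q) (ell_sum q (\<lambda>_::nat. XS))"
    by (rule pelczynski_decomposition[OF q1 seminormed_dyadic_space seminormed_XS
        complemented_trans[OF complemented_dyadic_paired_sum complemented_paired_sum_XS]
        complemented_trans[OF LX complemented_XS_dyadic]])
  ultimately show ?thesis using isomorphic_sym isomorphic_trans by blast
qed

end

section \<open>The unit vectors of the dyadic space\<close>

lemma card_block: "card {\<omega>::nat. \<omega> < W \<and> \<omega> div 2^l = j} \<le> 2^l"
  and card_block_eq: "(j + 1) * 2^l \<le> W \<Longrightarrow> card {\<omega>::nat. \<omega> < W \<and> \<omega> div 2^l = j} = 2^l"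
proof -
  have iff: "\<omega> div 2^l = j \<longleftrightarrow> \<omega> \<in> {j * 2^l..<(j + 1) * 2^l}" for \<omega>
    using less_eq_div_iff_mult_less_eq[of "2^l" j \<omega>] div_less_iff_less_mult[of "2^l" \<omega> "j + 1"] by auto
  have "card {\<omega>::nat. \<omega> < W \<and> \<omega> div 2^l = j} \<le> card {j * 2^l..<(j + 1) * 2^l}"
    unfolding iff by (rule card_mono) auto
  then show "card {\<omega>::nat. \<omega> < W \<and> \<omega> div 2^l = j} \<le> 2^l" by simp
  assume "(j + 1) * 2^l \<le> W"
  then have "{\<omega>::nat. \<omega> < W \<and> \<omega> div 2^l = j} = {j * 2^l..<(j + 1) * 2^l}" unfolding iff by auto
  then show "card {\<omega>::nat. \<omega> < W \<and> \<omega> div 2^l = j} = 2^l" by simp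
qed

text \<open>A geometric sum over any set of levels is dominated by its smallest level. It serves
  with the ratio \<open>2 powr (- 1 / q)\<close> for norms and with 1/2 for weights.\<close>

lemma sum_powers_le:
  fixes \<theta> :: real
  assumes "finite L" "\<And>l. l \<in> L \<Longrightarrow> l0 \<le> l" "0 < \<theta>" "\<theta> < 1"
  shows "(\<Sum>l\<in>L. \<theta> ^ l) \<le> \<theta> ^ l0 / (1 - \<theta>)"
proof -
  obtain N where N: "L \<subseteq> {..<N}" using finite_nat_iff_bounded assms(1) by blast
  have "(\<Sum>l\<in>L. \<theta> ^ l) \<le> (\<Sum>l=l0..<l0 + N. \<theta> ^ l)"
    using N assms by (intro sum_mono2) force+
  also have "\<dots> = \<theta> ^ l0 * (\<Sum>i<N. \<theta> ^ i)"
    using sum.shift_bounds_nat_ivl[of "\<lambda>l. \<theta> ^ l" 0 l0 N]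
    by (simp add: atLeast0LessThan add.commute power_add sum_distrib_left mult.commute)
  also have "\<dots> = \<theta> ^ l0 * ((1 - \<theta> ^ N) / (1 - \<theta>))" using assms by (simp add: sum_gp_strict)
  also have "\<dots> \<le> \<theta> ^ l0 * (1 / (1 - \<theta>))"
    using assms by (intro mult_left_mono divide_right_mono) auto
  finally show ?thesis by simp
qed

text \<open>The levels at which the point \<omega> of line n lies in a block of A.\<close>

definition hits :: "nat set \<Rightarrow> nat \<Rightarrow> nat \<Rightarrow> nat set" where
  "hits A \<omega> n = {l. l \<le> n \<and> code l (n - l) (\<omega> div 2^l) \<in> A}"

lemma hits_weight:
  assumes "finite A"
  shows "(\<Sum>l\<in>hits A \<omega> n. (1/2::real) ^ l)
    = (\<Sum>k\<in>A. if n = level k + colevel k \<and> \<omega> div 2 ^ level k = position k then (1/2) ^ level k else 0)"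
proof -
  let ?B = "{k\<in>A. n = level k + colevel k \<and> \<omega> div 2 ^ level k = position k}"
  have "bij_betw level ?B (hits A \<omega> n)"
  proof (rule bij_betwI[where g="\<lambda>l. code l (n - l) (\<omega> div 2^l)"])
    show "code (level k) (n - level k) (\<omega> div 2 ^ level k) = k" if "k \<in> ?B" for k
      using that code_simps(4)[of k] by simp
    then show "level \<in> ?B \<rightarrow> hits A \<omega> n" by (auto simp: hits_def)
  qed (auto simp: hits_def)
  then have "(\<Sum>l\<in>hits A \<omega> n. (1/2::real) ^ l) = (\<Sum>k\<in>?B. (1/2) ^ level k)"
    by (rule sum.reindex_bij_betw[symmetric])
  also have "\<dots> = (\<Sum>k\<in>A. if n = level k + colevel k \<and> \<omega> div 2 ^ level k = position k then (1/2) ^ level k else 0)"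
    using assms by (intro sum.mono_neutral_cong_left) auto
  finally show ?thesis .
qed

lemma sum_hits_single:
  "(\<Sum>n<N. \<Sum>\<omega><W n. if n = level k + colevel k \<and> \<omega> div 2 ^ level k = position k then (1/2::real) ^ level k else 0)
    = (if level k + colevel k < N
       then real (card {\<omega>. \<omega> < W (level k + colevel k) \<and> \<omega> div 2 ^ level k = position k}) * (1/2) ^ level k else 0)"
proof -
  let ?m = "level k + colevel k"
  have "(\<Sum>\<omega><W n. if n = ?m \<and> \<omega> div 2 ^ level k = position k then (1/2::real) ^ level k else 0)
      = (if n = ?m then real (card {\<omega>. \<omega> < W ?m \<and> \<omega> div 2 ^ level k = position k}) * (1/2) ^ level k else 0)" for n
  proof (cases "n = ?m")
    case True
    have "(\<Sum>\<omega><W n. if n = ?m \<and> \<omega> div 2 ^ level k = position k then (1/2::real) ^ level k else 0)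
        = (\<Sum>\<omega>\<in>{\<omega>. \<omega> < W ?m \<and> \<omega> div 2 ^ level k = position k}. (1/2::real) ^ level k)"
      using True by (intro sum.mono_neutral_cong_right) auto
    then show ?thesis using True by simp
  qed simp
  then have "(\<Sum>n<N. \<Sum>\<omega><W n. if n = ?m \<and> \<omega> div 2 ^ level k = position k then (1/2::real) ^ level k else 0)
      = (\<Sum>n<N. if n = ?m then real (card {\<omega>. \<omega> < W ?m \<and> \<omega> div 2 ^ level k = position k}) * (1/2) ^ level k else 0)"
    by (rule sum.cong[OF refl])
  then show ?thesis by simp
qed

text \<open>Counted block by block: a block of level l has 2^l points of weight 2^(-l), hence
  contributes at most 1. In \<open>sum_hits_eq\<close> the range contains all blocks of A and
  equality holds.\<close>

lemma sum_hits_le: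
  assumes "finite A"
  shows "(\<Sum>n<N. \<Sum>\<omega><W n. \<Sum>l\<in>hits A \<omega> n. (1/2::real) ^ l) \<le> real (card A)"
proof -
  have "(\<Sum>n<N. \<Sum>\<omega><W n. \<Sum>l\<in>hits A \<omega> n. (1/2::real) ^ l)
      = (\<Sum>k\<in>A. \<Sum>n<N. \<Sum>\<omega><W n. if n = level k + colevel k \<and> \<omega> div 2 ^ level k = position k then (1/2::real) ^ level k else 0)"
    unfolding hits_weight[OF assms] by (simp only: sum.swap[of _ A])
  also have "\<dots> \<le> (\<Sum>k\<in>A. 1)"
    unfolding sum_hits_single
  proof (rule sum_mono)
    fix k
    have "real (card {\<omega>. \<omega> < W (level k + colevel k) \<and> \<omega> div 2 ^ level k = position k}) \<le> real (2 ^ level k)"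
      by (intro of_nat_mono card_block)
    then show "(if level k + colevel k < N
       then real (card {\<omega>. \<omega> < W (level k + colevel k) \<and> \<omega> div 2 ^ level k = position k}) * (1/2) ^ level k else 0) \<le> (1::real)"
      by (simp add: power_divide divide_le_eq)
  qed
  finally show ?thesis by simp
qed

lemma sum_hits_eq:
  assumes "finite A"
  obtains N W where "(\<Sum>n<N. \<Sum>\<omega><W. \<Sum>l\<in>hits A \<omega> n. (1/2::real) ^ l) = real (card A)"
proof -
  define N where "N = Suc (\<Sum>k\<in>A. level k + colevel k)"
  define W where "W = (\<Sum>k\<in>A. (position k + 1) * 2 ^ level k)"
  have N: "level k + colevel k < N" if "k \<in> A" for k
    unfolding N_def using member_le_sum[OF that, of "\<lambda>k. level k + colevel k"] assms by simp
  have W: "(position k + 1) * 2 ^ level k \<le> W" if "k \<in> A" for k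
    unfolding W_def using member_le_sum[OF that, of "\<lambda>k. (position k + 1) * 2 ^ level k"] assms by simp
  have "(\<Sum>n<N. \<Sum>\<omega><W. \<Sum>l\<in>hits A \<omega> n. (1/2::real) ^ l)
      = (\<Sum>k\<in>A. \<Sum>n<N. \<Sum>\<omega><W. if n = level k + colevel k \<and> \<omega> div 2 ^ level k = position k then (1/2::real) ^ level k else 0)"
    unfolding hits_weight[OF assms] by (simp only: sum.swap[of _ A])
  also have "\<dots> = (\<Sum>k\<in>A. 1)"
    unfolding sum_hits_single[where W="\<lambda>_. W"]
    using N card_block_eq[OF W] by (intro sum.cong) (simp_all add: power_divide)
  finally show thesis by (intro that) simp
qed

section \<open>Unconditionality, democracy and greediness of the unit vectors\<close>

context
  fixes p :: ereal and q :: real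
  assumes p: "1 \<le> p" and q: "1 < q"
begin

abbreviation (input) YS where "YS \<equiv> dyadic_space p q"

interpretation Y: seminormed YS by (rule seminormed_dyadic_space[OF p q])

text \<open>The 1-unconditionality of the unit vectors: \<open>spread\<close> and the block norms
  depend monotonically on the absolute values.\<close>

lemma dyadic_mono:
  assumes b: "b \<in> vecs YS" and ab: "\<And>k. \<bar>a k\<bar> \<le> \<bar>b k\<bar>"
  shows "a \<in> vecs YS" "nrm YS a \<le> nrm YS b"
proof -
  have v: "spread q b \<in> vecs (paired_sum p q)" using b by (simp add: dyadic_space_vecs)
  have "spread q a \<in> vecs (paired_sum p q) \<and> nrm (paired_sum p q) (spread q a) \<le> nrm YS b"
  proof (rule paired_sum_boundI[OF p q])
    show "spread q a (prod_encode (\<omega>, n)) l = 0" if "n < l" for \<omega> n l using that by (simp add: spread_encode)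
    show "0 \<le> nrm YS b" using b by simp
    fix M
    have "(\<Sum>n<M. \<Sum>\<omega><M * 2^n. nrm (ell p (Suc n)) (spread q a (prod_encode (\<omega>, n))) powr q)
        \<le> (\<Sum>n<M. \<Sum>\<omega><M * 2^n. nrm (ell p (Suc n)) (spread q b (prod_encode (\<omega>, n))) powr q)"
      using q ab by (intro sum_mono powr_mono2 ell_Suc_nrm_nonneg[OF p] ell_nrm_mono[OF p]) (auto simp: spread_encode abs_mult)
    also have "\<dots> \<le> nrm YS b powr q" unfolding dyadic_space_nrm by (rule paired_sum_sums_le[OF p q v])
    finally show "(\<Sum>n<M. \<Sum>\<omega><M * 2^n. nrm (ell p (Suc n)) (spread q a (prod_encode (\<omega>, n))) powr q) \<le> nrm YS b powr q" .
  qed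
  then show "a \<in> vecs YS" "nrm YS a \<le> nrm YS b" by (simp_all add: dyadic_space_vecs dyadic_space_nrm)
qed

text \<open>The factor by which the weight decreases from one level to the next; its q-th power 1/2
  compensates for the doubled length of the blocks.\<close>

definition ratio where "ratio = 2 powr (- 1 / q)"

lemma ratio: "0 < ratio" "ratio < 1"
  using q by (simp_all add: ratio_def powr_less_one)

lemma ratio_power: "2 powr (- real l / q) = ratio ^ l" "(ratio ^ l) powr q = (1/2) ^ l"
proof -
  have "ratio ^ l = ratio powr real l" using ratio by (simp add: powr_realpow)
  also have "\<dots> = 2 powr (- real l / q)" by (simp add: ratio_def powr_powr)
  finally show e: "2 powr (- real l / q) = ratio ^ l" ..
  have "(ratio ^ l) powr q = 2 powr (- real l)" unfolding e[symmetric] using q by (simp add: powr_powr)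
  also have "\<dots> = (1/2) ^ l" by (simp add: powr_minus powr_realpow power_one_over inverse_eq_divide)
  finally show "(ratio ^ l) powr q = (1/2) ^ l" .
qed

text \<open>The q-th power of the sum of the geometric series of \<open>ratio\<close>.\<close>

definition upper where "upper = 1 / (1 - ratio) powr q"

lemma upper_pos: "0 < upper"
  using ratio by (simp add: upper_def)

definition ind :: "nat set \<Rightarrow> nat \<Rightarrow> real" where "ind A k = (if k \<in> A then 1 else 0)"

text \<open>Let l0 be the smallest level hit at the point. Geometric decay makes the block norm
  comparable to \<open>ratio ^ l0\<close> and the weight of all hits comparable to (1/2)^l0, its
  q-th power.\<close>

lemma block_ind_bounds:
  shows "nrm (ell p (Suc n)) (spread q (ind A) (prod_encode (\<omega>, n))) powr q \<le> upper * (\<Sum>l\<in>hits A \<omega> n. (1/2) ^ l)"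
    and "(\<Sum>l\<in>hits A \<omega> n. (1/2) ^ l) \<le> 2 * nrm (ell p (Suc n)) (spread q (ind A) (prod_encode (\<omega>, n))) powr q"
proof -
  let ?w = "spread q (ind A) (prod_encode (\<omega>, n))" and ?L = "hits A \<omega> n"
  have fin: "finite ?L" by (simp add: hits_def)
  have w: "?w l = (if l \<in> ?L then ratio ^ l else 0)" for l
    unfolding spread_encode ratio_power by (simp add: hits_def ind_def)
  have N0: "0 \<le> nrm (ell p (Suc n)) ?w" by (rule ell_Suc_nrm_nonneg[OF p])
  have "nrm (ell p (Suc n)) ?w powr q \<le> upper * (\<Sum>l\<in>?L. (1/2) ^ l) \<and> (\<Sum>l\<in>?L. (1/2) ^ l) \<le> 2 * nrm (ell p (Suc n)) ?w powr q"
  proof (cases "?L = {}")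
    case True
    then have "nrm (ell p (Suc n)) ?w \<le> 0" using ell_nrm_le_sum[OF p, of "Suc n" ?w] by (simp add: w)
    then have "nrm (ell p (Suc n)) ?w = 0" using N0 by linarith
    then show ?thesis using True by simp
  next
    case False
    define l0 where "l0 = Min ?L"
    have l0: "l0 \<in> ?L" "\<And>l. l \<in> ?L \<Longrightarrow> l0 \<le> l" using fin False by (auto simp: l0_def)
    have l0n: "l0 \<le> n" using l0(1) by (simp add: hits_def)
    \<comment> \<open>All that is used of the p-norm is that it lies between each single coordinate
      and the sum of all of them, so the constants do not depend on p.\<close>
    have "nrm (ell p (Suc n)) ?w \<le> (\<Sum>l<Suc n. \<bar>?w l\<bar>)" by (rule ell_nrm_le_sum[OF p]) simp
    also have "\<dots> = (\<Sum>l\<in>?L. ratio ^ l)"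
      using ratio by (intro sum.mono_neutral_cong_right) (auto simp: w hits_def)
    also have "\<dots> \<le> ratio ^ l0 / (1 - ratio)" by (rule sum_powers_le[OF fin l0(2) ratio])
    finally have "nrm (ell p (Suc n)) ?w powr q \<le> (ratio ^ l0 / (1 - ratio)) powr q"
      using N0 q by (intro powr_mono2) auto
    also have "\<dots> = upper * (1/2) ^ l0" using ratio by (simp add: powr_divide ratio_power upper_def)
    also have "\<dots> \<le> upper * (\<Sum>l\<in>?L. (1/2) ^ l)"
      using upper_pos l0(1) fin by (intro mult_left_mono member_le_sum) auto
    finally have 1: "nrm (ell p (Suc n)) ?w powr q \<le> upper * (\<Sum>l\<in>?L. (1/2) ^ l)" .
    have "ratio ^ l0 \<le> nrm (ell p (Suc n)) ?w"
      using ell_coord_le[OF p, of "Suc n" l0 ?w] l0 l0n ratio by (simp add: w)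
    then have "(ratio ^ l0) powr q \<le> nrm (ell p (Suc n)) ?w powr q" using ratio q by (intro powr_mono2) auto
    then have "(1/2) ^ l0 \<le> nrm (ell p (Suc n)) ?w powr q" by (simp only: ratio_power)
    moreover have "(\<Sum>l\<in>?L. (1/2::real) ^ l) \<le> (1/2) ^ l0 / (1 - 1/2)" by (rule sum_powers_le[OF fin l0(2)]) auto
    ultimately show ?thesis using 1 by simp
  qed
  then show "nrm (ell p (Suc n)) ?w powr q \<le> upper * (\<Sum>l\<in>?L. (1/2) ^ l)"
    "(\<Sum>l\<in>?L. (1/2) ^ l) \<le> 2 * nrm (ell p (Suc n)) ?w powr q" by auto
qed

text \<open>With \<open>ind_lower\<close> this is democracy: m unit vectors always have norm
  comparable to \<open>m powr (1/q)\<close>.\<close>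

lemma ind_upper:
  assumes "finite A"
  shows "ind A \<in> vecs YS" "nrm YS (ind A) \<le> (upper * real (card A)) powr (1/q)"
proof -
  have "spread q (ind A) \<in> vecs (paired_sum p q) \<and> nrm (paired_sum p q) (spread q (ind A)) \<le> (upper * real (card A)) powr (1/q)"
  proof (rule paired_sum_boundI[OF p q])
    show "spread q (ind A) (prod_encode (\<omega>, n)) l = 0" if "n < l" for \<omega> n l using that by (simp add: spread_encode)
    fix M
    have "(\<Sum>n<M. \<Sum>\<omega><M * 2^n. nrm (ell p (Suc n)) (spread q (ind A) (prod_encode (\<omega>, n))) powr q)
        \<le> (\<Sum>n<M. \<Sum>\<omega><M * 2^n. upper * (\<Sum>l\<in>hits A \<omega> n. (1/2) ^ l))"
      by (intro sum_mono block_ind_bounds(1))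
    also have "\<dots> = upper * (\<Sum>n<M. \<Sum>\<omega><M * 2^n. \<Sum>l\<in>hits A \<omega> n. (1/2) ^ l)"
      by (simp only: sum_distrib_left)
    also have "\<dots> \<le> upper * real (card A)"
      using upper_pos by (intro mult_left_mono sum_hits_le assms) auto
    also have "\<dots> = ((upper * real (card A)) powr (1/q)) powr q" using q upper_pos by (simp add: powr_powr)
    finally show "(\<Sum>n<M. \<Sum>\<omega><M * 2^n. nrm (ell p (Suc n)) (spread q (ind A) (prod_encode (\<omega>, n))) powr q)
        \<le> ((upper * real (card A)) powr (1/q)) powr q" .
  qed simp
  then show "ind A \<in> vecs YS" "nrm YS (ind A) \<le> (upper * real (card A)) powr (1/q)"
    by (simp_all add: dyadic_space_vecs dyadic_space_nrm)
qed

lemma ind_lower: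
  assumes "finite A"
  shows "real (card A) powr (1/q) \<le> 2 powr (1/q) * nrm YS (ind A)"
proof -
  have v: "spread q (ind A) \<in> vecs (paired_sum p q)" using ind_upper(1)[OF assms] by (simp add: dyadic_space_vecs)
  obtain N W where NW: "(\<Sum>n<N. \<Sum>\<omega><W. \<Sum>l\<in>hits A \<omega> n. (1/2::real) ^ l) = real (card A)"
    using sum_hits_eq[OF assms] by blast
  have "real (card A) \<le> (\<Sum>n<N. \<Sum>\<omega><W. 2 * nrm (ell p (Suc n)) (spread q (ind A) (prod_encode (\<omega>, n))) powr q)"
    unfolding NW[symmetric] by (intro sum_mono block_ind_bounds(2))
  also have "\<dots> = 2 * (\<Sum>n<N. \<Sum>\<omega><W. nrm (ell p (Suc n)) (spread q (ind A) (prod_encode (\<omega>, n))) powr q)"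
    by (simp only: sum_distrib_left)
  also have "\<dots> \<le> 2 * nrm YS (ind A) powr q"
    unfolding dyadic_space_nrm by (intro mult_left_mono paired_sum_sums_le[OF p q v]) simp
  finally have "real (card A) powr (1/q) \<le> (2 * nrm YS (ind A) powr q) powr (1/q)" using q by (intro powr_mono2) auto
  then show ?thesis using q Y.nonneg[OF ind_upper(1)[OF assms]] by (simp add: powr_mult powr_powr)
qed

lemma unit_vec_ind: "unit_vec k = ind {k}"
  by (auto simp: unit_vec_def ind_def)

lemma unit_vec_mem_dyadic: "unit_vec k \<in> vecs YS"
  unfolding unit_vec_ind by (rule ind_upper(1)) simp

lemma range_unit_vec: "range unit_vec \<subseteq> vecs YS"
  using unit_vec_mem_dyadic by blast

lemma nrm_unit_vec_pos: "0 < nrm YS (unit_vec k)"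
proof -
  have "1 \<le> 2 powr (1/q) * nrm YS (unit_vec k)" using ind_lower[of "{k}"] by (simp add: unit_vec_ind)
  then have "nrm YS (unit_vec k) \<noteq> 0" by auto
  then show ?thesis using Y.nonneg[OF unit_vec_mem_dyadic[of k]] by linarith
qed

lemma sum_unit_vec: "finite A \<Longrightarrow> (\<Sum>i\<in>A. a i *\<^sub>R unit_vec i) k = (if k \<in> A then a k else 0)"
proof -
  assume "finite A"
  have "(\<Sum>i\<in>A. a i *\<^sub>R unit_vec i) k = (\<Sum>i\<in>A. if i = k then a i else 0)"
    unfolding sum_fun_apply by (intro sum.cong) (auto simp: unit_vec_def)
  then show ?thesis using \<open>finite A\<close> by simp
qed

lemma coordinate_le: "x \<in> vecs YS \<Longrightarrow> \<bar>x k\<bar> * nrm YS (unit_vec k) \<le> nrm YS x"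
  using dyadic_mono(2)[of x "x k *\<^sub>R unit_vec k"] Y.scale[OF unit_vec_mem_dyadic, of "x k" k]
  by (simp add: unit_vec_def del: Y.scale)

text \<open>Only finitely many coordinates are seen by the points with code below M. Once they are
  used up, the remainder vanishes at those points and is dominated by a at the others, where a has
  small norm.\<close>

lemma expands_unit_vec:
  assumes a: "a \<in> vecs YS"
  shows "expands YS unit_vec a a"
  unfolding expands_def
proof (rule LIMSEQ_I)
  fix \<epsilon> :: real assume eps: "0 < \<epsilon>"
  let ?n = "\<lambda>m. snd (prod_decode m)"
  let ?v = "spread q a" and ?E = "\<lambda>m. ell p (Suc (snd (prod_decode m)))"
  have v: "?v \<in> vecs (ell_sum q ?E)" using a by (simp add: dyadic_space_vecs paired_sum_def)
  have summ: "summable (\<lambda>m. nrm (?E m) (?v m) powr q)" using v unfolding ell_sum_vecs by blast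
  have "0 < (\<epsilon> / 2) powr q" using eps by simp
  then obtain M where "norm (\<Sum>i. nrm (?E (i + M)) (?v (i + M)) powr q) < (\<epsilon> / 2) powr q"
    using suminf_exist_split[OF _ summ] by blast
  then have tail: "(\<Sum>i. nrm (?E (i + M)) (?v (i + M)) powr q) < (\<epsilon> / 2) powr q" by simp
  define S where "S = (\<Union>m<M. (\<lambda>l. code l (?n m - l) (fst (prod_decode m) div 2^l)) ` {..?n m})"
  have "finite S" by (simp add: S_def)
  then obtain B where B: "S \<subseteq> {..<B}" using finite_nat_iff_bounded by blast
  show "\<exists>no. \<forall>n\<ge>no. norm (nrm YS (a - (\<Sum>i<n. a i *\<^sub>R unit_vec i)) - 0) < \<epsilon>"
  proof (intro exI[of _ B] allI impI)
    fix n assume n: "B \<le> n"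
    define t where "t = a - (\<Sum>i<n. a i *\<^sub>R unit_vec i)"
    have tk: "t k = (if k < n then 0 else a k)" for k by (simp add: t_def sum_unit_vec)
    have t: "t \<in> vecs YS" by (rule dyadic_mono(1)[OF a]) (simp add: tk)
    have le: "nrm (?E m) (spread q t m) powr q \<le> (if m < M then 0 else nrm (?E m) (?v m) powr q)" for m
    proof (cases "m < M")
      case True
      have "spread q t m = 0"
      proof
        fix l
        show "spread q t m l = (0 :: nat \<Rightarrow> real) l"
        proof (cases "l \<le> ?n m")
          case l: True
          then have "code l (?n m - l) (fst (prod_decode m) div 2^l) \<in> S" unfolding S_def using True by auto
          then have "code l (?n m - l) (fst (prod_decode m) div 2^l) < n" using B n by auto
          then show ?thesis using l by (simp add: spread_def split_beta Let_def tk)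
        next
          case False
          then show ?thesis by (simp add: spread_def split_beta Let_def)
        qed
      qed
      then show ?thesis using True seminormed.nrm_zero[OF seminormed_ell[OF p, of "Suc (?n m)"]] by (simp only:) simp
    next
      case False
      have "nrm (?E m) (spread q t m) \<le> nrm (?E m) (?v m)"
        by (intro ell_nrm_mono[OF p]) (simp_all add: spread_def split_beta Let_def tk)
      then show ?thesis using False q ell_Suc_nrm_nonneg[OF p] by (simp add: powr_mono2)
    qed
    have "nrm (ell_sum q ?E) (spread q t) \<le> \<epsilon> / 2"
    proof (rule ell_sum_boundI(2))
      show "0 < q" using q by simp
      show "spread q t m \<in> vecs (?E m)" for m
        using t by (simp add: dyadic_space_vecs paired_sum_def ell_sum_vecs)
      show "0 \<le> \<epsilon> / 2" using eps by simp
      fix N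
      have "(\<Sum>m<N. nrm (?E m) (spread q t m) powr q) \<le> (\<Sum>m<N. if m < M then 0 else nrm (?E m) (?v m) powr q)"
        using le by (rule sum_mono)
      also have "\<dots> \<le> (\<Sum>m<N + M. if m < M then 0 else nrm (?E m) (?v m) powr q)"
        by (intro sum_mono2) auto
      also have "\<dots> = (\<Sum>m\<in>{M..<N + M}. nrm (?E m) (?v m) powr q)"
        by (intro sum.mono_neutral_cong_right) auto
      also have "\<dots> = (\<Sum>i<N. nrm (?E (i + M)) (?v (i + M)) powr q)"
        using sum.shift_bounds_nat_ivl[of "\<lambda>m. nrm (?E m) (?v m) powr q" 0 M N] by (simp add: atLeast0LessThan)
      also have "\<dots> \<le> (\<Sum>i. nrm (?E (i + M)) (?v (i + M)) powr q)"
        by (intro sum_le_suminf summable_ignore_initial_segment[OF summ]) auto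
      also have "\<dots> \<le> (\<epsilon> / 2) powr q" using tail by simp
      finally show "(\<Sum>m<N. nrm (?E m) (spread q t m) powr q) \<le> (\<epsilon> / 2) powr q" .
    qed
    then have "nrm YS t \<le> \<epsilon> / 2" by (simp add: dyadic_space_nrm paired_sum_def)
    then show "norm (nrm YS (a - (\<Sum>i<n. a i *\<^sub>R unit_vec i)) - 0) < \<epsilon>"
      unfolding t_def[symmetric] using eps Y.nonneg[OF t] by simp
  qed
qed

lemma expands_unit_vec_unique:
  assumes a: "a \<in> vecs YS" and b: "expands YS unit_vec b a"
  shows "b = a"
proof
  fix k
  have "(\<lambda>n. nrm YS (a - (\<Sum>i<n. b i *\<^sub>R unit_vec i))) \<longlonglongrightarrow> 0" using b by (simp only: expands_def)
  moreover have "\<exists>N. \<forall>n\<ge>N. \<bar>a k - b k\<bar> * nrm YS (unit_vec k) \<le> nrm YS (a - (\<Sum>i<n. b i *\<^sub>R unit_vec i))"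
  proof (intro exI[of _ "Suc k"] allI impI)
    fix n assume n: "Suc k \<le> n"
    have m: "a - (\<Sum>i<n. b i *\<^sub>R unit_vec i) \<in> vecs YS" by (rule Y.diff_combination_mem[OF range_unit_vec a])
    have "(a - (\<Sum>i<n. b i *\<^sub>R unit_vec i)) k = a k - b k" using n by (simp add: sum_unit_vec)
    then show "\<bar>a k - b k\<bar> * nrm YS (unit_vec k) \<le> nrm YS (a - (\<Sum>i<n. b i *\<^sub>R unit_vec i))"
      using coordinate_le[OF m, of k] by (simp only:)
  qed
  ultimately have "\<bar>a k - b k\<bar> * nrm YS (unit_vec k) \<le> 0" by (rule LIMSEQ_le_const)
  then show "b k = a k" using nrm_unit_vec_pos[of k] by (simp add: mult_le_0_iff)
qed

lemma schauder_unit_vec: "schauder_basis YS unit_vec"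
  unfolding schauder_basis_def
proof (intro conjI ballI range_unit_vec)
  fix x assume x: "x \<in> vecs YS"
  show "\<exists>!a. expands YS unit_vec a x"
    by (rule ex1I, rule expands_unit_vec[OF x], rule expands_unit_vec_unique[OF x])
qed

lemma biorth_unit_vec:
  assumes a: "a \<in> vecs YS"
  shows "biorth YS unit_vec k a = a k"
proof -
  have "(THE b. expands YS unit_vec b a) = a"
    by (rule the_equality, rule expands_unit_vec[OF a], rule expands_unit_vec_unique[OF a])
  then show ?thesis unfolding biorth_def by (simp only:)
qed

lemma restrict_mem: "x \<in> vecs YS \<Longrightarrow> (\<lambda>k. if k \<in> S then x k else 0) \<in> vecs YS"
  by (rule dyadic_mono(1)) auto

text \<open>With t the largest coefficient on D, the chain runs from x on D to t times the indicator
  of D, by democracy to that of E, and from there to x on E, where all coefficients are at least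
  t.\<close>

lemma exchange_le:
  assumes x: "x \<in> vecs YS" and fin: "finite D" "finite E" "card D \<le> card E"
    and le: "\<And>i j. i \<in> E \<Longrightarrow> j \<in> D \<Longrightarrow> \<bar>x j\<bar> \<le> \<bar>x i\<bar>"
  shows "nrm YS (\<lambda>k. if k \<in> D then x k else 0) \<le> (2 * upper) powr (1/q) * nrm YS (\<lambda>k. if k \<in> E then x k else 0)"
proof (cases "D = {}")
  case True
  then have "(\<lambda>k. if k \<in> D then x k else 0) = 0" by (simp add: fun_eq_iff)
  then have "nrm YS (\<lambda>k. if k \<in> D then x k else 0) = 0" by (simp only: Y.nrm_zero)
  then show ?thesis using Y.nonneg[OF restrict_mem[OF x]] by simp
next
  case False
  define t where "t = Max ((\<lambda>j. \<bar>x j\<bar>) ` D)"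
  have tmax: "\<bar>x j\<bar> \<le> t" if "j \<in> D" for j using that fin(1) by (simp add: t_def)
  have "t \<in> (\<lambda>j. \<bar>x j\<bar>) ` D" unfolding t_def using fin(1) False by (intro Max_in) auto
  then obtain j where j: "j \<in> D" "t = \<bar>x j\<bar>" by blast
  have t0: "0 \<le> t" using j by simp
  have "nrm YS (\<lambda>k. if k \<in> D then x k else 0) \<le> nrm YS (t *\<^sub>R ind D)"
    using tmax t0 by (intro dyadic_mono(2) Y.scale_mem ind_upper(1) fin) (auto simp: ind_def)
  also have "\<dots> = t * nrm YS (ind D)" using t0 Y.scale[OF ind_upper(1)[OF fin(1)]] by simp
  also have "\<dots> \<le> t * (upper * real (card D)) powr (1/q)" using t0 by (intro mult_left_mono ind_upper(2) fin)
  also have "\<dots> \<le> t * (upper powr (1/q) * real (card E) powr (1/q))"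
    using t0 upper_pos fin(3) q by (intro mult_left_mono) (auto simp: powr_mult intro!: mult_left_mono powr_mono2)
  also have "\<dots> \<le> t * (upper powr (1/q) * (2 powr (1/q) * nrm YS (ind E)))"
    using t0 by (intro mult_left_mono ind_lower fin) auto
  also have "\<dots> = (2 * upper) powr (1/q) * (t * nrm YS (ind E))"
    using upper_pos by (simp add: powr_mult)
  also have "t * nrm YS (ind E) = nrm YS (t *\<^sub>R ind E)" using t0 Y.scale[OF ind_upper(1)[OF fin(2)]] by simp
  also have "(2 * upper) powr (1/q) * \<dots> \<le> (2 * upper) powr (1/q) * nrm YS (\<lambda>k. if k \<in> E then x k else 0)"
    using le[OF _ j(1)] j(2) by (intro mult_left_mono dyadic_mono(2) restrict_mem x) (auto simp: ind_def)
  finally show ?thesis .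
qed

text \<open>The usual proof that unconditional and democratic bases are greedy. For a competitor z
  on B the remainder splits into the part outside A and B, where z agrees with x (constant 1), and
  the part on B - A, which is exchanged for A - B, where z again agrees with x.\<close>

lemma greedy_unit_vec: "greedy_with (1 + (2 * upper) powr (1/q)) YS unit_vec"
  unfolding greedy_with_def
proof (intro conjI schauder_unit_vec ballI allI impI)
  fix x n A assume x: "x \<in> vecs YS" and "1 \<le> (n::nat)" and g: "greedy_set YS unit_vec n x A"
  let ?D = "1 + (2 * upper) powr (1/q)"
  have A: "finite A" "card A = n" and ge: "\<And>i j. i \<in> A \<Longrightarrow> j \<notin> A \<Longrightarrow> \<bar>x j\<bar> \<le> \<bar>x i\<bar>"
    using g by (auto simp: greedy_set_def biorth_unit_vec[OF x])
  define r where "r = x - greedy_approx YS unit_vec A x"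
  have rk: "r k = (if k \<in> A then 0 else x k)" for k
    by (simp add: r_def greedy_approx_def biorth_unit_vec[OF x] sum_unit_vec[OF A(1)])
  have D: "0 < ?D" using powr_ge_zero[of "2 * upper" "1/q"] by linarith
  have "nrm YS r / ?D \<le> best_error YS unit_vec n x"
    unfolding best_error_def
  proof (rule cInf_greatest)
    have "nrm YS (x - (\<Sum>i\<in>{}. 0 *\<^sub>R unit_vec i)) \<in> {nrm YS (x - (\<Sum>i\<in>B. b i *\<^sub>R unit_vec i)) | b B. finite B \<and> card B \<le> n}"
      by (intro CollectI exI[of _ "{}"] exI[of _ "\<lambda>_. 0"] conjI refl) auto
    then show "{nrm YS (x - (\<Sum>i\<in>B. b i *\<^sub>R unit_vec i)) | b B. finite B \<and> card B \<le> n} \<noteq> {}" by blast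
    fix y assume "y \<in> {nrm YS (x - (\<Sum>i\<in>B. b i *\<^sub>R unit_vec i)) | b B. finite B \<and> card B \<le> n}"
    then obtain b B where y: "y = nrm YS (x - (\<Sum>i\<in>B. b i *\<^sub>R unit_vec i))" and B: "finite B" "card B \<le> n" by blast
    define z where "z = x - (\<Sum>i\<in>B. b i *\<^sub>R unit_vec i)"
    have z: "z \<in> vecs YS" unfolding z_def by (rule Y.diff_combination_mem[OF range_unit_vec x])
    have zk: "k \<notin> B \<Longrightarrow> z k = x k" for k by (simp add: z_def sum_unit_vec[OF B(1)])
    let ?r1 = "\<lambda>k. if k \<in> - (A \<union> B) then x k else 0" and ?r2 = "\<lambda>k. if k \<in> B - A then x k else 0"
    have r12: "r = ?r1 + ?r2" by (auto simp: fun_eq_iff rk)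
    have "nrm YS r \<le> nrm YS ?r1 + nrm YS ?r2" unfolding r12 by (intro Y.triangle restrict_mem x)
    moreover have "nrm YS ?r1 \<le> nrm YS z" by (rule dyadic_mono(2)[OF z]) (auto simp: zk)
    moreover have "nrm YS ?r2 \<le> (2 * upper) powr (1/q) * nrm YS (\<lambda>k. if k \<in> A - B then x k else 0)"
    proof (rule exchange_le[OF x])
      show "card (B - A) \<le> card (A - B)" using A B by (intro card_le_sym_Diff) auto
    qed (use A B ge in auto)
    moreover have "(2 * upper) powr (1/q) * nrm YS (\<lambda>k. if k \<in> A - B then x k else 0) \<le> (2 * upper) powr (1/q) * nrm YS z"
      by (intro mult_left_mono dyadic_mono(2)[OF z]) (auto simp: zk)
    ultimately have "nrm YS r \<le> ?D * nrm YS z" by (simp add: distrib_right)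
    then show "nrm YS r / ?D \<le> y" using D unfolding y z_def by (simp add: divide_le_eq mult.commute)
  qed
  then show "nrm YS (x - greedy_approx YS unit_vec A x) \<le> ?D * best_error YS unit_vec n x"
    using D unfolding r_def by (simp add: divide_le_eq mult.commute)
qed

lemma ell_sum_has_greedy_basis: "has_greedy_basis (ell_sum q (\<lambda>n. ell p (Suc n)))"
  by (rule has_greedy_basis_isomorphic[OF seminormed_dyadic_space[OF p q] seminormed_XS[OF p q] isomorphic_XS_dyadic[OF p q]])
    (use greedy_unit_vec in \<open>unfold has_greedy_basis_def, blast\<close>)

end

(* Sequences are indexed from 0, so the n-th summand is the space of dimension Suc n. *)
theorem theorem1:
  fixes p :: ereal and q :: ereal
  assumes "1 \<le> p" and "1 \<le> q"
  shows "(1 < q \<and> q < \<infinity> \<longrightarrow> has_greedy_basis (ell_sum (real_of_ereal q) (\<lambda>n. ell p (Suc n)))) \<and>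
    (1 < p \<longrightarrow> \<not> has_greedy_basis (ell_sum 1 (\<lambda>n. ell p (Suc n)))) \<and>
    (p < \<infinity> \<longrightarrow> \<not> has_greedy_basis (c0_sum (\<lambda>n. ell p (Suc n))))"
proof (intro conjI impI)
  assume "1 < q \<and> q < \<infinity>"
  then have "1 < real_of_ereal q" by (cases q) (auto simp: one_ereal_def)
  then show "has_greedy_basis (ell_sum (real_of_ereal q) (\<lambda>n. ell p (Suc n)))"
    by (rule ell_sum_has_greedy_basis[OF assms(1)])
next
  assume "1 < p"
  then show "\<not> has_greedy_basis (ell_sum 1 (\<lambda>n. ell p (Suc n)))" by (rule l1_sum_no_greedy_basis)
next
  assume "p < \<infinity>"
  then show "\<not> has_greedy_basis (c0_sum (\<lambda>n. ell p (Suc n)))" by (rule c0_sum_no_greedy_basis[OF assms(1)])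
qed

end
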